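(* Let $A$ be a separable $C^*$-algebra and $B$ a stable $\sigma$-unital $C^*$-algebra. Let $p:EL(A,B)\to EM(A,B)$ be the map $[(\Phi^+,\Phi^-)]\mapsto[(v\Phi^+,v\Phi^-)]$ defined in the context. Then $p$ is an isomorphism.
   Context: Notation. $\mathbb R_+=[0,\infty)$; $MB$ is the multiplier algebra of $B$; $IB=C([0,1];B)$. $C_b(\mathbb R_+;B)$ is the algebra of bounded norm-continuous $B$-valued functions, $C_0(\mathbb R_+;B)$ its ideal of functions vanishing at infinity; $C_{b,s}(\mathbb R_+;MB)$ is the algebra of bounded $MB$-valued functions continuous in the strict topology. For a pair $(\Phi^+,\Phi^-)$ of (not necessarily linear) continuous maps from $A$ to $C_{b,s}(\mathbb R_+;MB)$ let $E$ be the $C^*$-algebra generated by all $\Phi^\pm(a)$, $a\in A$, and let $D\subset E$ be the ideal of $E$ generated by $\Phi^+(a)-\Phi^-(a)$, $a\in A$. The pair $\Phi^\pm:A\to C_{b,s}(\mathbb R_+;MB)$ is an asymptotic $KK$-cycle from $A$ to $B$ if: (i) $\Phi^\pm(\lambda a)=\lambda\Phi^\pm(a)$ for $\lambda\in\mathbb C$, $a\in A$, and $\Phi^\pm(a^* )-\Phi^\pm(a)^*\in C_0(\mathbb R_+;B)$ for $a\in A$; (ii) $D\subset C_b(\mathbb R_+;B)$; (iii) $(\Phi^\pm(a+b)-\Phi^\pm(a)-\Phi^\pm(b))x\in C_0(\mathbb R_+;B)$ and $(\Phi^\pm(ab)-\Phi^\pm(a)\Phi^\pm(b))x\in C_0(\mathbb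 R_+;B)$ for all $a,b\in A$, $x\in D$. It is a compact asymptotic $KK$-cycle if moreover $\Phi^\pm$ are continuous maps $A\to C_b(\mathbb R_+;B)$. Two (compact) asymptotic $KK$-cycles from $A$ to $B$ are homotopic if there is a (compact) asymptotic $KK$-cycle from $A$ to $IB$ whose evaluations at $0$ and $1$ are the given ones. $EL(A,B)$ (resp. $EM(A,B)$) is the set of homotopy classes of asymptotic (resp. compact asymptotic) $KK$-cycles from $A$ to $B$. Both are abelian groups under $[(\Phi^+,\Phi^-)]+[(\Psi^+,\Psi^-)]=[(s_1\Phi^+s_1^*+s_2\Psi^+s_2^*,\ s_1\Phi^-s_1^*+s_2\Psi^-s_2^* )]$, where $s_1,s_2\in MB$ are isometries with $s_1s_1^*+s_2s_2^*=1$ (regarded as constant functions). Definition of $p$. Given an asymptotic $KK$-cycle $(\Phi^+,\Phi^-)$, let $(v_r)_{r\in\mathbb R_+}$ be an approximate unit of $D$, quasicentral in $E$, and choose an order-preserving homeomorphism $r$ of $[0,\infty)$ such that $v(t):=v_{r(t)}(t)$, $v\in C_b(\mathbb R_+;B)$, satisfies $\lim_{t\to\infty}[v(t),\Phi^\pm_t(a)]=0$ for all $a\in A$ and $\lim_{t\to\infty}(v(t)x_t-x_t)=0$ for all $x\in D$. Then $(v\Phi^+,v\Phi^-)$ is a compact asymptotic $KK$-cycle, and $p([(\Phi^+,\Phi^-)])=[(v\Phi^+,v\Phi^-)]$, which does not depend on the choices. *)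

theory Defs
  imports "HOL-Analysis.Analysis" "HOL-Algebra.Group"
begin

section \<open>\<open>C*\<close>-algebras\<close>

class star =
  fixes star :: "'a \<Rightarrow> 'a"

class scaleC =
  fixes scaleC :: "complex \<Rightarrow> 'a \<Rightarrow> 'a" (infixr "*\<^sub>C" 75)

class cstar_algebra = real_normed_algebra + banach + scaleC + star +
  assumes scaleC_of_real: "complex_of_real r *\<^sub>C x = r *\<^sub>R x"
    and scaleC_add_right: "c *\<^sub>C (x + y) = c *\<^sub>C x + c *\<^sub>C y"
    and scaleC_add_left: "(c + d) *\<^sub>C x = c *\<^sub>C x + d *\<^sub>C x"
    and scaleC_scaleC: "c *\<^sub>C (d *\<^sub>C x) = (c * d) *\<^sub>C x"
    and scaleC_mult_left: "(c *\<^sub>C x) * y = c *\<^sub>C (x * y)"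
    and scaleC_mult_right: "x * (c *\<^sub>C y) = c *\<^sub>C (x * y)"
    and norm_scaleC: "norm (c *\<^sub>C x) = cmod c * norm x"
    and star_star: "star (star x) = x"
    and star_add: "star (x + y) = star x + star y"
    and star_scaleC: "star (c *\<^sub>C x) = cnj c *\<^sub>C star x"
    and star_mult: "star (x * y) = star y * star x"
    and cstar_identity: "norm (star x * x) = (norm x)\<^sup>2"
begin

lemma star_zero [simp]: "star 0 = 0"
  using star_add[of 0 0] by simp

lemma star_scaleR: "star (r *\<^sub>R x) = r *\<^sub>R star x"
  by (metis star_scaleC scaleC_of_real complex_cnj_complex_of_real)

lemma star_minus: "star (- x) = - star x"
  using star_add[of x "- x"] by (simp add: eq_neg_iff_add_eq_0 add.commute)

lemma star_diff: "star (x - y) = star x - star y"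
  using star_add[of x "- y"] star_minus by simp

lemma norm_star [simp]: "norm (star x) = norm x"
proof -
  have le: "norm y \<le> norm (star y)" for y
  proof (cases "norm y = 0")
    case False
    have "(norm y)\<^sup>2 \<le> norm (star y) * norm y"
      using norm_mult_ineq[of "star y" y] cstar_identity[of y] by simp
    with False show ?thesis by (simp add: power2_eq_square)
  qed simp
  show ?thesis using le[of x] le[of "star x"] star_star[of x] by simp
qed

lemma norm_eq_zero_of_star: "star x * x = 0 \<Longrightarrow> x = 0"
  using cstar_identity[of x] by simp

end

lemma bounded_linear_star: "bounded_linear (star :: 'a::cstar_algebra \<Rightarrow> 'a)"
  by (rule bounded_linear_intro[where K = 1]) (simp_all add: star_add star_scaleR)

lemma scaleC_minus_right: "c *\<^sub>C (- x) = - (c *\<^sub>C x)" for x :: "'a::cstar_algebra"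
proof -
  have "c *\<^sub>C 0 = (0::'a)" using scaleC_add_right[of c 0 "0::'a"] by simp
  then show ?thesis using scaleC_add_right[of c x "- x"] by (simp add: eq_neg_iff_add_eq_0 add.commute)
qed

lemma bounded_linear_scaleC: "bounded_linear (\<lambda>x. c *\<^sub>C x :: 'a::cstar_algebra)"
proof (rule bounded_linear_intro[where K = "cmod c"])
  show "c *\<^sub>C (r *\<^sub>R x) = r *\<^sub>R (c *\<^sub>C x)" for r and x :: 'a
    by (metis scaleC_of_real scaleC_scaleC mult.commute)
qed (simp_all add: scaleC_add_right norm_scaleC mult.commute)

lemma cmult_eqI: "(\<And>z. x * z = y * z) \<Longrightarrow> x = y" for x y :: "'a::cstar_algebra"
proof -
  assume *: "\<And>z. x * z = y * z"
  have "star (star (x - y)) * star (x - y) = 0"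
    using *[of "star (x - y)"] by (simp add: star_star left_diff_distrib)
  then have "star (x - y) = 0" by (rule norm_eq_zero_of_star)
  then show "x = y" by (metis star_star star_zero eq_iff_diff_eq_0)
qed

lemma cmult_eqI': "(\<And>z. z * x = z * y) \<Longrightarrow> x = y" for x y :: "'a::cstar_algebra"
proof -
  assume *: "\<And>z. z * x = z * y"
  have "star (x - y) * (x - y) = 0"
    using *[of "star (x - y)"] by (simp add: right_diff_distrib)
  then have "x - y = 0" by (rule norm_eq_zero_of_star)
  then show "x = y" by simp
qed


section \<open>Bounded continuous functions with values in a \<open>C*\<close>-algebra\<close>

unbundle bcontfun.lifting

instantiation bcontfun :: (metric_space, cstar_algebra) cstar_algebra
begin

lift_definition times_bcontfun :: "('a \<Rightarrow>\<^sub>C 'b) \<Rightarrow> ('a \<Rightarrow>\<^sub>C 'b) \<Rightarrow> 'a \<Rightarrow>\<^sub>C 'b" is "\<lambda>f g x. f x * g x"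
proof -
  fix f g :: "'a \<Rightarrow> 'b"
  assume f: "f \<in> bcontfun" and g: "g \<in> bcontfun"
  obtain a where a: "norm (f x) \<le> a" for x
    using f by (auto simp: bcontfun_def bounded_iff)
  obtain b where b: "norm (g x) \<le> b" for x
    using g by (auto simp: bcontfun_def bounded_iff)
  have "norm (f x * g x) \<le> a * b" for x
    by (rule order_trans[OF norm_mult_ineq mult_mono'[OF a b]]) auto
  then show "(\<lambda>x. f x * g x) \<in> bcontfun"
    using f g by (intro bcontfun_normI[where b = "a * b"])
      (auto simp: bcontfun_def intro!: continuous_intros)
qed

lift_definition scaleC_bcontfun :: "complex \<Rightarrow> ('a \<Rightarrow>\<^sub>C 'b) \<Rightarrow> 'a \<Rightarrow>\<^sub>C 'b" is "\<lambda>c f x. c *\<^sub>C f x"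
  by (auto simp: bcontfun_def image_image[symmetric]
      intro: bounded_linear_image[OF _ bounded_linear_scaleC]
        bounded_linear.continuous_on[OF bounded_linear_scaleC])

lift_definition star_bcontfun :: "('a \<Rightarrow>\<^sub>C 'b) \<Rightarrow> 'a \<Rightarrow>\<^sub>C 'b" is "\<lambda>f x. star (f x)"
  by (auto simp: bcontfun_def image_image[symmetric]
      intro: bounded_linear_image[OF _ bounded_linear_star]
        bounded_linear.continuous_on[OF bounded_linear_star])

lemmas bcontfun_cstar_simps =
  times_bcontfun.rep_eq scaleC_bcontfun.rep_eq star_bcontfun.rep_eq

instance
proof
  fix f g h :: "'a \<Rightarrow>\<^sub>C 'b" and a :: real and c d :: complex
  show "(f * g) * h = f * (g * h)"
    by (rule bcontfun_eqI) (simp add: bcontfun_cstar_simps mult.assoc)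
  show "(f + g) * h = f * h + g * h"
    by (rule bcontfun_eqI) (simp add: bcontfun_cstar_simps distrib_right)
  show "f * (g + h) = f * g + f * h"
    by (rule bcontfun_eqI) (simp add: bcontfun_cstar_simps distrib_left)
  show "a *\<^sub>R f * g = a *\<^sub>R (f * g)"
    by (rule bcontfun_eqI) (simp add: bcontfun_cstar_simps)
  show "f * a *\<^sub>R g = a *\<^sub>R (f * g)"
    by (rule bcontfun_eqI) (simp add: bcontfun_cstar_simps)
  show "norm (f * g) \<le> norm f * norm g"
    by (rule norm_bound) (auto simp: bcontfun_cstar_simps
        intro!: order_trans[OF norm_mult_ineq] mult_mono norm_bounded)
  show "complex_of_real a *\<^sub>C f = a *\<^sub>R f"
    by (rule bcontfun_eqI) (simp add: bcontfun_cstar_simps scaleC_of_real)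
  show "c *\<^sub>C (f + g) = c *\<^sub>C f + c *\<^sub>C g"
    by (rule bcontfun_eqI) (simp add: bcontfun_cstar_simps scaleC_add_right)
  show "(c + d) *\<^sub>C f = c *\<^sub>C f + d *\<^sub>C f"
    by (rule bcontfun_eqI) (simp add: bcontfun_cstar_simps scaleC_add_left)
  show cc: "c *\<^sub>C d *\<^sub>C f = (c * d) *\<^sub>C f" for c d and f :: "'a \<Rightarrow>\<^sub>C 'b"
    by (rule bcontfun_eqI) (simp add: bcontfun_cstar_simps scaleC_scaleC)
  show "c *\<^sub>C f * g = c *\<^sub>C (f * g)"
    by (rule bcontfun_eqI) (simp add: bcontfun_cstar_simps scaleC_mult_left)
  show "f * c *\<^sub>C g = c *\<^sub>C (f * g)"
    by (rule bcontfun_eqI) (simp add: bcontfun_cstar_simps scaleC_mult_right)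
  have le: "norm (c *\<^sub>C f) \<le> cmod c * norm f" for c and f :: "'a \<Rightarrow>\<^sub>C 'b"
    by (rule norm_bound) (auto simp: bcontfun_cstar_simps norm_scaleC intro!: mult_left_mono norm_bounded)
  have one: "1 *\<^sub>C f = f" for f :: "'a \<Rightarrow>\<^sub>C 'b"
    by (rule bcontfun_eqI) (use scaleC_of_real[of 1] in \<open>simp add: bcontfun_cstar_simps\<close>)
  show "norm (c *\<^sub>C f) = cmod c * norm f"
  proof (cases "c = 0")
    case True
    then show ?thesis using le[of c f] by simp
  next
    case False
    have "norm f \<le> cmod (inverse c) * norm (c *\<^sub>C f)"
      using le[of "inverse c" "c *\<^sub>C f"] False by (simp add: cc one)
    then have "cmod c * norm f \<le> norm (c *\<^sub>C f)"
      using False by (simp add: norm_inverse norm_divide field_simps)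
    with le[of c f] show ?thesis by simp
  qed
  show "star (star f) = f"
    by (rule bcontfun_eqI) (simp add: bcontfun_cstar_simps star_star)
  show "star (f + g) = star f + star g"
    by (rule bcontfun_eqI) (simp add: bcontfun_cstar_simps star_add)
  show "star (c *\<^sub>C f) = cnj c *\<^sub>C star f"
    by (rule bcontfun_eqI) (simp add: bcontfun_cstar_simps star_scaleC)
  show "star (f * g) = star g * star f"
    by (rule bcontfun_eqI) (simp add: bcontfun_cstar_simps star_mult)
  show "norm (star f * f) = (norm f)\<^sup>2"
  proof (rule antisym)
    show "norm (star f * f) \<le> (norm f)\<^sup>2"
      by (rule norm_bound) (simp add: bcontfun_cstar_simps cstar_identity norm_bounded power_mono)
    have "(norm (apply_bcontfun f x))\<^sup>2 \<le> norm (star f * f)" for x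
      using norm_bounded[of "star f * f" x] by (simp add: bcontfun_cstar_simps cstar_identity)
    then have "norm (apply_bcontfun f x) \<le> sqrt (norm (star f * f))" for x
      by (rule real_le_rsqrt)
    then have "norm f \<le> sqrt (norm (star f * f))"
      by (rule norm_bound)
    then show "(norm f)\<^sup>2 \<le> norm (star f * f)"
      by (metis norm_ge_zero power_mono real_sqrt_pow2)
  qed
qed

end

lifting_update bcontfun.lifting
lifting_forget bcontfun.lifting


section \<open>The multiplier algebra\<close>

text \<open>Double centralizers \<open>(L, R)\<close>, i.e. \<open>L b = m b\<close> and \<open>R b = b m\<close> for the multiplier \<open>m\<close>.\<close>

typedef (overloaded) 'b multiplier =
  "{(L :: 'b::cstar_algebra \<Rightarrow>\<^sub>L 'b, R :: 'b \<Rightarrow>\<^sub>L 'b).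
      (\<forall>c x. L (c *\<^sub>C x) = c *\<^sub>C L x) \<and> (\<forall>c x. R (c *\<^sub>C x) = c *\<^sub>C R x) \<and>
      (\<forall>x y. L (x * y) = L x * y) \<and> (\<forall>x y. R (x * y) = x * R y) \<and>
      (\<forall>x y. R x * y = x * L y)}"
  morphisms centralizer Multiplier
proof -
  have "c *\<^sub>C 0 = (0::'b)" for c
    using scaleC_add_right[of c 0 "0::'b"] by simp
  then show ?thesis by (intro exI[of _ "(0, 0)"]) simp
qed

definition lmul :: "'b::cstar_algebra multiplier \<Rightarrow> 'b \<Rightarrow> 'b" where
  "lmul m b = blinfun_apply (fst (centralizer m)) b"

definition rmul :: "'b::cstar_algebra \<Rightarrow> 'b multiplier \<Rightarrow> 'b" where
  "rmul b m = blinfun_apply (snd (centralizer m)) b"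

definition mk_multiplier :: "('b::cstar_algebra \<Rightarrow> 'b) \<Rightarrow> ('b \<Rightarrow> 'b) \<Rightarrow> 'b multiplier" where
  "mk_multiplier L R = Multiplier (Blinfun L, Blinfun R)"

lemma lmul_simps:
  "lmul m (c *\<^sub>C x) = c *\<^sub>C lmul m x" "rmul (c *\<^sub>C x) m = c *\<^sub>C rmul x m"
  "lmul m (x * y) = lmul m x * y" "rmul (x * y) m = x * rmul y m"
  using centralizer[of m] by (cases "centralizer m"; auto simp: lmul_def rmul_def)+

lemma rmul_lmul: "rmul x m * y = x * lmul m y"
  using centralizer[of m] by (cases "centralizer m"; auto simp: lmul_def rmul_def)+

lemma bounded_linear_lmul: "bounded_linear (lmul m)"
  unfolding lmul_def[abs_def] by (rule blinfun.bounded_linear_right)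

lemma bounded_linear_rmul: "bounded_linear (\<lambda>b. rmul b m)"
  unfolding rmul_def[abs_def] by (rule blinfun.bounded_linear_right)

lemma multiplier_eqI:
  assumes "\<And>b. lmul m b = lmul n b" shows "m = n"
proof -
  have "rmul b m = rmul b n" for b
    by (rule cmult_eqI) (simp add: rmul_lmul assms)
  with assms have "centralizer m = centralizer n"
    by (intro prod_eqI blinfun_eqI) (simp_all add: lmul_def rmul_def)
  then show ?thesis by (simp add: centralizer_inject)
qed

lemma mk_multiplier:
  assumes L: "bounded_linear L" and R: "bounded_linear R"
    and "\<And>c x. L (c *\<^sub>C x) = c *\<^sub>C L x" "\<And>c x. R (c *\<^sub>C x) = c *\<^sub>C R x"
    and "\<And>x y. L (x * y) = L x * y" "\<And>x y. R (x * y) = x * R y" "\<And>x y. R x * y = x * L y"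
  shows "lmul (mk_multiplier L R) x = L x" "rmul x (mk_multiplier L R) = R x"
proof -
  have "centralizer (mk_multiplier L R) = (Blinfun L, Blinfun R)"
    unfolding mk_multiplier_def
    by (rule Multiplier_inverse) (use assms in \<open>simp add: bounded_linear_Blinfun_apply\<close>)
  then show "lmul (mk_multiplier L R) x = L x" "rmul x (mk_multiplier L R) = R x"
    by (simp_all add: lmul_def rmul_def bounded_linear_Blinfun_apply L R)
qed

lemma bounded_linear_star_conj:
  "bounded_linear f \<Longrightarrow> bounded_linear (\<lambda>x :: 'b::cstar_algebra. star (f (star x) :: 'b))"
  by (intro bounded_linear_compose[OF bounded_linear_star] bounded_linear_compose[OF _ bounded_linear_star])

instantiation multiplier :: (cstar_algebra) "{zero, one, plus, minus, uminus, times, scaleR, scaleC, star}"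
begin

definition "0 = mk_multiplier (\<lambda>x. 0) (\<lambda>x. 0 :: 'a)"
definition "1 = mk_multiplier (\<lambda>x. x) (\<lambda>x. x :: 'a)"
definition "m + n = mk_multiplier (\<lambda>x. lmul m x + lmul n x) (\<lambda>x. rmul x m + rmul x n :: 'a)"
definition "m - n = mk_multiplier (\<lambda>x. lmul m x - lmul n x) (\<lambda>x. rmul x m - rmul x n :: 'a)"
definition "- m = mk_multiplier (\<lambda>x. - lmul m x) (\<lambda>x. - rmul x m :: 'a)"
definition "m * n = mk_multiplier (\<lambda>x. lmul m (lmul n x)) (\<lambda>x. rmul (rmul x m) n :: 'a)"
definition "r *\<^sub>R m = mk_multiplier (\<lambda>x. r *\<^sub>R lmul m x) (\<lambda>x. r *\<^sub>R rmul x m :: 'a)"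
definition "c *\<^sub>C m = mk_multiplier (\<lambda>x. c *\<^sub>C lmul m x) (\<lambda>x. c *\<^sub>C rmul x m :: 'a)"
definition "star m = mk_multiplier (\<lambda>x. star (rmul (star x) m)) (\<lambda>x. star (lmul m (star x)) :: 'a)"

instance ..

end

definition mnorm :: "'b::cstar_algebra multiplier \<Rightarrow> real" where
  "mnorm m = onorm (lmul m)"

lemma scaleC_scaleR_commute: "c *\<^sub>C (r *\<^sub>R x) = r *\<^sub>R (c *\<^sub>C x)" for x :: "'a::cstar_algebra"
  by (metis scaleC_of_real scaleC_scaleC mult.commute)

lemma scaleC_diff_right: "c *\<^sub>C (x - y) = c *\<^sub>C x - c *\<^sub>C y" for x :: "'a::cstar_algebra"
  using scaleC_add_right[of c x "- y"] by (simp add: scaleC_minus_right)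

lemma scaleC_commute: "c *\<^sub>C (d *\<^sub>C x) = d *\<^sub>C (c *\<^sub>C x)" for x :: "'a::cstar_algebra"
  by (simp add: scaleC_scaleC mult.commute)

lemma scaleC_zero_right [simp]: "c *\<^sub>C 0 = (0::'a::cstar_algebra)"
  using scaleC_add_right[of c 0 "0::'a"] by simp

lemma scaleC_zero_left [simp]: "0 *\<^sub>C x = (0::'a::cstar_algebra)"
  using scaleC_of_real[of 0 x] by simp

lemmas mulbl = bounded_linear_lmul bounded_linear_rmul

lemma star_mult_swap: "x * star y = star (y * star x)" for x :: "'a::cstar_algebra"
  by (simp add: star_mult star_star)

lemma mul_zero [simp]: "lmul 0 x = 0" "rmul x 0 = 0"
  unfolding zero_multiplier_def by (subst mk_multiplier; simp)+

lemma mul_one [simp]: "lmul 1 x = x" "rmul x 1 = x"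
  unfolding one_multiplier_def by (subst mk_multiplier; simp)+

lemma mul_add: "lmul (m + n) x = lmul m x + lmul n x" "rmul x (m + n) = rmul x m + rmul x n"
  unfolding plus_multiplier_def
  by (subst mk_multiplier; simp add: bounded_linear_add mulbl lmul_simps rmul_lmul
      scaleC_add_right distrib_left distrib_right)+

lemma mul_diff: "lmul (m - n) x = lmul m x - lmul n x" "rmul x (m - n) = rmul x m - rmul x n"
  unfolding minus_multiplier_def
  by (subst mk_multiplier; simp add: bounded_linear_sub mulbl lmul_simps rmul_lmul
      scaleC_diff_right left_diff_distrib right_diff_distrib)+

lemma mul_minus: "lmul (- m) x = - lmul m x" "rmul x (- m) = - rmul x m"
  unfolding uminus_multiplier_def
  by (subst mk_multiplier; simp add: bounded_linear_minus mulbl lmul_simps rmul_lmul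
      scaleC_minus_right)+

lemma mul_mult: "lmul (m * n) x = lmul m (lmul n x)" "rmul x (m * n) = rmul (rmul x m) n"
  unfolding times_multiplier_def
  by (subst mk_multiplier; simp add: bounded_linear_compose[OF bounded_linear_lmul bounded_linear_lmul]
      bounded_linear_compose[OF bounded_linear_rmul bounded_linear_rmul] lmul_simps rmul_lmul)+

lemma mul_scaleR: "lmul (r *\<^sub>R m) x = r *\<^sub>R lmul m x" "rmul x (r *\<^sub>R m) = r *\<^sub>R rmul x m"
  unfolding scaleR_multiplier_def
  by (subst mk_multiplier; simp add: bounded_linear_const_scaleR mulbl lmul_simps rmul_lmul
      scaleC_scaleR_commute)+

lemma mul_scaleC: "lmul (c *\<^sub>C m) x = c *\<^sub>C lmul m x" "rmul x (c *\<^sub>C m) = c *\<^sub>C rmul x m"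
  unfolding scaleC_multiplier_def
  by (subst mk_multiplier; simp add: bounded_linear_compose[OF bounded_linear_scaleC bounded_linear_lmul]
      bounded_linear_compose[OF bounded_linear_scaleC bounded_linear_rmul] lmul_simps rmul_lmul
      scaleC_mult_left scaleC_mult_right scaleC_scaleC mult.commute)+

lemma mul_star: "lmul (star m) x = star (rmul (star x) m)" "rmul x (star m) = star (lmul m (star x))"
proof -
  have 1: "star (lmul m (star x)) * y = x * star (rmul (star y) m)" for x y
    by (metis star_mult star_star rmul_lmul)
  show "lmul (star m) x = star (rmul (star x) m)" "rmul x (star m) = star (lmul m (star x))"
    unfolding star_multiplier_def
    by (subst mk_multiplier; simp add: bounded_linear_star_conj[OF bounded_linear_lmul]
        bounded_linear_star_conj[OF bounded_linear_rmul] lmul_simps 1 star_scaleC star_mult star_star)+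
qed

lemmas mul_simps = mul_add mul_diff mul_minus mul_mult mul_scaleR mul_scaleC mul_star

lemma mnorm_lmul: "norm (lmul m x) \<le> mnorm m * norm x"
  unfolding mnorm_def by (rule onorm[OF bounded_linear_lmul])

lemma mnorm_nonneg: "0 \<le> mnorm (m :: 'a::cstar_algebra multiplier)"
  unfolding mnorm_def by (rule onorm_pos_le[OF bounded_linear_lmul])

lemma mnorm_le:
  "0 \<le> c \<Longrightarrow> (\<And>x. norm (lmul m x) \<le> c * norm x) \<Longrightarrow> mnorm m \<le> c"
  unfolding mnorm_def by (rule onorm_bound)

lemma mnorm_mult: "mnorm (m * n) \<le> mnorm m * mnorm (n :: 'a::cstar_algebra multiplier)"
proof (rule mnorm_le)
  show "norm (lmul (m * n) x) \<le> mnorm m * mnorm n * norm x" for x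
    by (simp add: mul_mult mult.assoc)
      (meson mnorm_lmul mnorm_nonneg mult_left_mono order_trans)
qed (simp add: mnorm_nonneg)

lemma mnorm_cstar:
  fixes m :: "'a::cstar_algebra multiplier"
  shows "mnorm (star m * m) = (mnorm m)\<^sup>2" and "mnorm (star m) = mnorm m"
proof -
  have key: "(mnorm m)\<^sup>2 \<le> mnorm (star m * m)" for m :: "'a multiplier"
  proof -
    have "norm (lmul m x) \<le> sqrt (mnorm (star m * m)) * norm x" for x
    proof -
      have "star (lmul m x) * lmul m x = star x * lmul (star m * m) x"
        by (metis mul_mult(1) mul_star(2) rmul_lmul star_star)
      then have "(norm (lmul m x))\<^sup>2 = norm (star x * lmul (star m * m) x)"
        by (metis cstar_identity)
      also have "\<dots> \<le> norm (star x) * norm (lmul (star m * m) x)"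
        by (rule norm_mult_ineq)
      also have "\<dots> \<le> norm x * (mnorm (star m * m) * norm x)"
        by (simp add: mult_left_mono mnorm_lmul)
      finally have "(norm (lmul m x))\<^sup>2 \<le> (sqrt (mnorm (star m * m)) * norm x)\<^sup>2"
        by (simp add: power_mult_distrib mnorm_nonneg power2_eq_square ac_simps)
      then show ?thesis
        by (rule power2_le_imp_le) (simp add: mnorm_nonneg)
    qed
    then have "mnorm m \<le> sqrt (mnorm (star m * m))"
      by (intro mnorm_le) (simp_all add: mnorm_nonneg)
    then show ?thesis
      by (metis mnorm_nonneg power_mono real_sqrt_pow2)
  qed
  have le: "mnorm m \<le> mnorm (star m)" for m :: "'a multiplier"
  proof (cases "mnorm m = 0")
    case False
    have "mnorm m * mnorm m \<le> mnorm (star m) * mnorm m"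
      using order_trans[OF key[of m] mnorm_mult] by (simp add: power2_eq_square)
    with False show ?thesis
      using mnorm_nonneg[of m] by simp
  qed (simp add: mnorm_nonneg)
  have "star (star m) = m"
    by (rule multiplier_eqI) (simp add: mul_star star_star)
  then show eq: "mnorm (star m) = mnorm m"
    using le[of m] le[of "star m"] by simp
  show "mnorm (star m * m) = (mnorm m)\<^sup>2"
    using key[of m] mnorm_mult[of "star m" m] by (simp add: eq power2_eq_square)
qed

lemma mnorm_rmul: "norm (rmul x m) \<le> mnorm m * norm x"
proof -
  have "rmul x m = star (lmul (star m) (star x))"
    by (simp add: mul_star star_star)
  then show ?thesis
    using mnorm_lmul[of "star m" "star x"] by (simp add: mnorm_cstar)
qed

instantiation multiplier :: (cstar_algebra) "{real_normed_algebra, monoid_mult}"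
begin

definition "norm m = mnorm m" for m :: "'a multiplier"
definition "dist m n = mnorm (m - n)" for m n :: "'a multiplier"
definition "sgn m = m /\<^sub>R mnorm m" for m :: "'a multiplier"
definition "uniformity = (INF e\<in>{0 <..}. principal {(x, y :: 'a multiplier). dist x y < e})"
definition "open U = (\<forall>x\<in>U. \<forall>\<^sub>F (x', y) in uniformity. x' = x \<longrightarrow> y \<in> U)" for U :: "'a multiplier set"

instance
proof
  fix m n k :: "'a multiplier" and r s :: real
  show "dist m n = norm (m - n)" by (simp add: dist_multiplier_def norm_multiplier_def)
  show "sgn m = m /\<^sub>R norm m" by (simp add: sgn_multiplier_def norm_multiplier_def)
  show "uniformity = (INF e\<in>{0 <..}. principal {(x, y :: 'a multiplier). dist x y < e})"
    by (rule uniformity_multiplier_def)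
  show "open U = (\<forall>x\<in>U. \<forall>\<^sub>F (x', y) in uniformity. x' = x \<longrightarrow> y \<in> U)" for U :: "'a multiplier set"
    by (rule open_multiplier_def)
  show "norm m = 0 \<longleftrightarrow> m = 0"
    unfolding norm_multiplier_def mnorm_def onorm_eq_0[OF bounded_linear_lmul]
    by (auto intro: multiplier_eqI)
  show "norm (m + n) \<le> norm m + norm n"
    using onorm_triangle[OF bounded_linear_lmul bounded_linear_lmul, of m n]
    by (simp add: norm_multiplier_def mnorm_def mul_add[abs_def])
  show "norm (r *\<^sub>R m) = \<bar>r\<bar> * norm m"
    using onorm_scaleR[OF bounded_linear_lmul, of r m]
    by (simp add: norm_multiplier_def mnorm_def mul_scaleR[abs_def])
  show "norm (m * n) \<le> norm m * norm n"
    unfolding norm_multiplier_def by (rule mnorm_mult)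
  show "m + n + k = m + (n + k)" "m + n = n + m" "0 + m = m" "- m + m = 0" "m - n = m + - n"
    "r *\<^sub>R (m + n) = r *\<^sub>R m + r *\<^sub>R n" "(r + s) *\<^sub>R m = r *\<^sub>R m + s *\<^sub>R m"
    "r *\<^sub>R s *\<^sub>R m = (r * s) *\<^sub>R m" "1 *\<^sub>R m = m"
    "m * n * k = m * (n * k)" "(m + n) * k = m * k + n * k" "m * (n + k) = m * n + m * k"
    "r *\<^sub>R m * n = r *\<^sub>R (m * n)" "m * r *\<^sub>R n = r *\<^sub>R (m * n)"
    "1 * m = m" "m * 1 = m"
    by (rule multiplier_eqI, simp add: mul_simps algebra_simps
        linear_add[OF bounded_linear.linear[OF bounded_linear_lmul]]
        linear_scale[OF bounded_linear.linear[OF bounded_linear_lmul]])+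
qed

end

lemmas norm_lmul = mnorm_lmul[folded norm_multiplier_def]
  and norm_rmul = mnorm_rmul[folded norm_multiplier_def]
  and norm_multiplier_le = mnorm_le[folded norm_multiplier_def]

instance multiplier :: (cstar_algebra) banach
proof
  fix X :: "nat \<Rightarrow> 'a multiplier"
  assume X: "Cauchy X"
  define CL where "CL m = fst (centralizer m)" for m :: "'a multiplier"
  define CR where "CR m = snd (centralizer m)" for m :: "'a multiplier"
  have ap: "blinfun_apply (CL m) x = lmul m x" "blinfun_apply (CR m) x = rmul x m" for m :: "'a multiplier" and x
    by (simp_all add: CL_def CR_def lmul_def rmul_def)
  have dL: "dist (CL m) (CL n) \<le> dist m n" for m n
    unfolding dist_norm
    by (rule norm_blinfun_bound)
      (simp_all add: blinfun.diff_left ap mul_diff[symmetric] norm_lmul)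
  have dR: "dist (CR m) (CR n) \<le> dist m n" for m n
    unfolding dist_norm
    by (rule norm_blinfun_bound)
      (simp_all add: blinfun.diff_left ap mul_diff[symmetric] norm_rmul)
  have "Cauchy (\<lambda>n. CL (X n))" "Cauchy (\<lambda>n. CR (X n))"
    using X unfolding Cauchy_def by (meson dL dR le_less_trans)+
  then obtain L R where L: "(\<lambda>n. CL (X n)) \<longlonglongrightarrow> L" and R: "(\<lambda>n. CR (X n)) \<longlonglongrightarrow> R"
    by (meson Cauchy_convergent convergent_def)
  have Lx: "(\<lambda>n. lmul (X n) x) \<longlonglongrightarrow> L x" for x
    using blinfun.tendsto[OF L tendsto_const[of x]] by (simp add: ap)
  have Rx: "(\<lambda>n. rmul x (X n)) \<longlonglongrightarrow> R x" for x
    using blinfun.tendsto[OF R tendsto_const[of x]] by (simp add: ap)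
  define Y where "Y = mk_multiplier L R"
  have 1: "lmul Y x = L x" for x
    unfolding Y_def
  proof (rule mk_multiplier(1))
    show "L (c *\<^sub>C x) = c *\<^sub>C L x" for c x
      using LIMSEQ_unique[OF Lx[of "c *\<^sub>C x"]] bounded_linear.tendsto[OF bounded_linear_scaleC Lx[of x]]
      by (auto simp: lmul_simps)
    show "R (c *\<^sub>C x) = c *\<^sub>C R x" for c x
      using LIMSEQ_unique[OF Rx[of "c *\<^sub>C x"]] bounded_linear.tendsto[OF bounded_linear_scaleC Rx[of x]]
      by (auto simp: lmul_simps)
    show "L (x * y) = L x * y" for x y
      using LIMSEQ_unique[OF Lx[of "x * y"]] tendsto_mult[OF Lx[of x] tendsto_const[of y]]
      by (auto simp: lmul_simps)
    show "R (x * y) = x * R y" for x y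
      using LIMSEQ_unique[OF Rx[of "x * y"]] tendsto_mult[OF tendsto_const[of x] Rx[of y]]
      by (auto simp: lmul_simps)
    show "R x * y = x * L y" for x y
      using LIMSEQ_unique[OF tendsto_mult[OF Rx[of x] tendsto_const[of y]]]
        tendsto_mult[OF tendsto_const[of x] Lx[of y]]
      by (auto simp: rmul_lmul)
  qed (auto intro: blinfun.bounded_linear_right)
  have "dist (X n) Y = dist (CL (X n)) L" for n
    unfolding dist_norm norm_blinfun.rep_eq norm_multiplier_def mnorm_def
    by (rule arg_cong[where f = onorm]) (simp add: fun_eq_iff blinfun.diff_left ap mul_diff 1)
  then have "X \<longlonglongrightarrow> Y"
    using L unfolding LIMSEQ_def by simp
  then show "convergent X" by (auto simp: convergent_def)
qed

instance multiplier :: (cstar_algebra) cstar_algebra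
proof
  fix m n :: "'a multiplier" and c d :: complex and r :: real
  show "complex_of_real r *\<^sub>C m = r *\<^sub>R m" "c *\<^sub>C (m + n) = c *\<^sub>C m + c *\<^sub>C n"
    "(c + d) *\<^sub>C m = c *\<^sub>C m + d *\<^sub>C m" "c *\<^sub>C d *\<^sub>C m = (c * d) *\<^sub>C m"
    "c *\<^sub>C m * n = c *\<^sub>C (m * n)" "m * c *\<^sub>C n = c *\<^sub>C (m * n)"
    "star (star m) = m" "star (m + n) = star m + star n" "star (c *\<^sub>C m) = cnj c *\<^sub>C star m"
    "star (m * n) = star n * star m"
    by (rule multiplier_eqI, simp add: mul_simps scaleC_of_real scaleC_add_right scaleC_add_left
        scaleC_scaleC lmul_simps star_star star_add star_scaleC)+
  show "norm (star m * m) = (norm m)\<^sup>2" unfolding norm_multiplier_def by (rule mnorm_cstar)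
  have "norm (c *\<^sub>C m) = onorm (\<lambda>x. c *\<^sub>C lmul m x)"
    by (simp add: norm_multiplier_def mnorm_def mul_scaleC[abs_def])
  also have "\<dots> = onorm (\<lambda>x. cmod c *\<^sub>R lmul m x)"
    by (simp add: onorm_def norm_scaleC)
  also have "\<dots> = cmod c * norm m"
    by (simp add: onorm_scaleR[OF bounded_linear_lmul] norm_multiplier_def mnorm_def)
  finally show "norm (c *\<^sub>C m) = cmod c * norm m" .
qed

definition mult_embed :: "'b::cstar_algebra \<Rightarrow> 'b multiplier" where
  "mult_embed b = mk_multiplier (\<lambda>x. b * x) (\<lambda>x. x * b)"

lemma mul_mult_embed: "lmul (mult_embed b) x = b * x" "rmul x (mult_embed b) = x * b"
  unfolding mult_embed_def
  by (subst mk_multiplier; simp add: bounded_linear_mult_right bounded_linear_mult_left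
      scaleC_mult_left scaleC_mult_right mult.assoc)+


section \<open>The half-line and the unit interval\<close>

typedef halfline = "{0::real..}" morphisms real_of_halfline halfline by auto

instantiation halfline :: "{linorder, metric_space}"
begin

definition "s \<le> t \<longleftrightarrow> real_of_halfline s \<le> real_of_halfline t"
definition "s < t \<longleftrightarrow> real_of_halfline s < real_of_halfline t"
definition "dist s t = dist (real_of_halfline s) (real_of_halfline t)"
definition "uniformity = (INF e\<in>{0 <..}. principal {(x, y :: halfline). dist x y < e})"
definition "open U = (\<forall>x\<in>U. \<forall>\<^sub>F (x', y) in uniformity. x' = x \<longrightarrow> y \<in> U)" for U :: "halfline set"

instance
  by standard (auto simp: less_eq_halfline_def less_halfline_def dist_halfline_def
      uniformity_halfline_def open_halfline_def real_of_halfline_inject dist_triangle2)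

end

typedef unit_interval = "{0..1::real}" morphisms real_of_unit unit_of_real by auto

instantiation unit_interval :: metric_space
begin

definition "dist s t = dist (real_of_unit s) (real_of_unit t)"
definition "uniformity = (INF e\<in>{0 <..}. principal {(x, y :: unit_interval). dist x y < e})"
definition "open U = (\<forall>x\<in>U. \<forall>\<^sub>F (x', y) in uniformity. x' = x \<longrightarrow> y \<in> U)" for U :: "unit_interval set"

instance
  by standard (auto simp: dist_unit_interval_def
      uniformity_unit_interval_def open_unit_interval_def real_of_unit_inject dist_triangle2)

end

text \<open>\<open>IB = C([0,1]; B)\<close>; all continuous functions on the compact interval are bounded.\<close>

type_synonym 'b path_algebra = "unit_interval \<Rightarrow>\<^sub>C 'b"

abbreviation at_infty :: "halfline filter" where
  "at_infty \<equiv> filtercomap real_of_halfline at_top"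


section \<open>Strictly continuous functions\<close>

text \<open>\<open>C\<^sub>b\<^sub>,\<^sub>s(\<real>\<^sub>+; MB)\<close> with the supremum norm\<close>

typedef (overloaded) 'b scont =
  "{F :: halfline \<Rightarrow> 'b::cstar_algebra multiplier. bounded (range F) \<and>
      (\<forall>b. continuous_on UNIV (\<lambda>t. lmul (F t) b)) \<and> (\<forall>b. continuous_on UNIV (\<lambda>t. rmul b (F t)))}"
  morphisms apply_scont Scont
  by (rule exI[of _ "\<lambda>_. 0"]) (auto simp: bounded_iff)

setup_lifting type_definition_scont

lemma scont_eqI: "(\<And>t. apply_scont F t = apply_scont G t) \<Longrightarrow> F = G"
  by (simp add: apply_scont_inject[symmetric] fun_eq_iff)

lemma continuous_lmul_joint:
  fixes F :: "halfline \<Rightarrow> 'b::cstar_algebra multiplier"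
  assumes bd: "bounded (range F)" and F: "\<And>b. continuous_on UNIV (\<lambda>t. lmul (F t) b)"
    and g: "continuous_on UNIV g"
  shows "continuous_on UNIV (\<lambda>t. lmul (F t) (g t))"
  unfolding continuous_on_def
proof
  fix t0
  obtain C where C: "norm (F t) \<le> C" for t
    using bd by (auto simp: bounded_iff)
  have "((\<lambda>t. lmul (F t) (g t - g t0)) \<longlongrightarrow> 0) (at t0)"
  proof (rule Lim_null_comparison)
    show "\<forall>\<^sub>F t in at t0. norm (lmul (F t) (g t - g t0)) \<le> C * norm (g t - g t0)"
      by (intro always_eventually allI order_trans[OF norm_lmul] mult_right_mono C) auto
    have "(g \<longlongrightarrow> g t0) (at t0)"
      using g by (simp add: continuous_on_def)
    then have "((\<lambda>t. norm (g t - g t0)) \<longlongrightarrow> 0) (at t0)"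
      by (simp add: LIM_zero tendsto_norm_zero)
    then show "((\<lambda>t. C * norm (g t - g t0)) \<longlongrightarrow> 0) (at t0)"
      by (rule tendsto_mult_right_zero)
  qed
  moreover have "((\<lambda>t. lmul (F t) (g t0)) \<longlongrightarrow> lmul (F t0) (g t0)) (at t0)"
    using F by (simp add: continuous_on_def)
  ultimately have "((\<lambda>t. lmul (F t) (g t - g t0) + lmul (F t) (g t0)) \<longlongrightarrow> 0 + lmul (F t0) (g t0)) (at t0)"
    by (rule tendsto_add)
  then show "((\<lambda>t. lmul (F t) (g t)) \<longlongrightarrow> lmul (F t0) (g t0)) (at t0)"
    by (simp add: linear_diff[OF bounded_linear.linear[OF bounded_linear_lmul]])
qed

lemma continuous_star: "continuous_on S f \<Longrightarrow> continuous_on S (\<lambda>t. star (f t :: 'b::cstar_algebra))"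
  by (rule bounded_linear.continuous_on[OF bounded_linear_star])

lemma rmul_via_star: "rmul x m = star (lmul (star m) (star x))"
  by (simp add: mul_star star_star)

lemma continuous_rmul_joint:
  fixes F :: "halfline \<Rightarrow> 'b::cstar_algebra multiplier"
  assumes bd: "bounded (range F)" and F: "\<And>b. continuous_on UNIV (\<lambda>t. rmul b (F t))"
    and g: "continuous_on UNIV g"
  shows "continuous_on UNIV (\<lambda>t. rmul (g t) (F t))"
  unfolding rmul_via_star
  by (rule continuous_star, rule continuous_lmul_joint)
    (use bd in \<open>simp_all add: bounded_iff mul_star continuous_star F g\<close>)

lemma apply_scont_bounded: "bounded (range (apply_scont F))"
  and apply_scont_lmul: "continuous_on UNIV g \<Longrightarrow> continuous_on UNIV (\<lambda>t. lmul (apply_scont F t) (g t))"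
  and apply_scont_rmul: "continuous_on UNIV g \<Longrightarrow> continuous_on UNIV (\<lambda>t. rmul (g t) (apply_scont F t))"
  using apply_scont[of F] continuous_lmul_joint[of "apply_scont F" g] continuous_rmul_joint[of "apply_scont F" g]
  by simp_all

lemma bounded_range_normI: "(\<And>t. norm (f t) \<le> c) \<Longrightarrow> bounded (range f)"
  by (auto simp: bounded_iff)

instantiation scont :: (cstar_algebra) "{zero, plus, minus, uminus, times, scaleR, scaleC, star}"
begin

lift_definition zero_scont :: "'a scont" is "\<lambda>_. 0"
  by (auto simp: bounded_iff)

lift_definition plus_scont :: "'a scont \<Rightarrow> 'a scont \<Rightarrow> 'a scont" is "\<lambda>F G t. F t + G t"
  by (auto simp: mul_simps bounded_plus_comp intro!: continuous_intros)

lift_definition minus_scont :: "'a scont \<Rightarrow> 'a scont \<Rightarrow> 'a scont" is "\<lambda>F G t. F t - G t"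
  by (auto simp: mul_simps bounded_minus_comp intro!: continuous_intros)

lift_definition uminus_scont :: "'a scont \<Rightarrow> 'a scont" is "\<lambda>F t. - F t"
  by (auto simp: mul_simps bounded_iff intro!: continuous_intros)

lift_definition scaleR_scont :: "real \<Rightarrow> 'a scont \<Rightarrow> 'a scont" is "\<lambda>r F t. r *\<^sub>R F t"
  by (auto simp: mul_simps bounded_scaleR_comp intro!: continuous_intros)

lift_definition scaleC_scont :: "complex \<Rightarrow> 'a scont \<Rightarrow> 'a scont" is "\<lambda>c F t. c *\<^sub>C F t"
  by (auto simp: mul_simps image_image[symmetric]
      intro: bounded_linear_image[OF _ bounded_linear_scaleC]
        bounded_linear.continuous_on[OF bounded_linear_scaleC])

lift_definition star_scont :: "'a scont \<Rightarrow> 'a scont" is "\<lambda>F t. star (F t)"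
  by (auto simp: mul_simps bounded_iff intro!: continuous_star)

lift_definition times_scont :: "'a scont \<Rightarrow> 'a scont \<Rightarrow> 'a scont" is "\<lambda>F G t. F t * G t"
proof -
  fix F G :: "halfline \<Rightarrow> 'a multiplier"
  assume F: "bounded (range F) \<and> (\<forall>b. continuous_on UNIV (\<lambda>t. lmul (F t) b)) \<and> (\<forall>b. continuous_on UNIV (\<lambda>t. rmul b (F t)))"
    and G: "bounded (range G) \<and> (\<forall>b. continuous_on UNIV (\<lambda>t. lmul (G t) b)) \<and> (\<forall>b. continuous_on UNIV (\<lambda>t. rmul b (G t)))"
  obtain a where a: "norm (F t) \<le> a" for t using F by (auto simp: bounded_iff)
  obtain b where b: "norm (G t) \<le> b" for t using G by (auto simp: bounded_iff)
  have "bounded (range (\<lambda>t. F t * G t))"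
    by (rule bounded_range_normI[where c = "a * b"])
      (rule order_trans[OF norm_mult_ineq mult_mono'[OF a b]]; simp)
  with F G show "bounded (range (\<lambda>t. F t * G t)) \<and>
      (\<forall>b. continuous_on UNIV (\<lambda>t. lmul (F t * G t) b)) \<and> (\<forall>b. continuous_on UNIV (\<lambda>t. rmul b (F t * G t)))"
    using continuous_lmul_joint[of F "\<lambda>t. lmul (G t) b" for b] continuous_rmul_joint[of G "\<lambda>t. rmul b (F t)" for b]
    by (simp add: mul_simps)
qed

instance ..

end

lemmas scont_simps = zero_scont.rep_eq plus_scont.rep_eq minus_scont.rep_eq uminus_scont.rep_eq
  scaleR_scont.rep_eq scaleC_scont.rep_eq star_scont.rep_eq times_scont.rep_eq

definition snorm :: "'b::cstar_algebra scont \<Rightarrow> real" where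
  "snorm F = (SUP t. norm (apply_scont F t))"

lemma snorm_bdd: "bdd_above (range (\<lambda>t. norm (apply_scont F t)))"
  using apply_scont_bounded[of F] by (auto simp: bounded_iff bdd_above_def)

lemma snorm_ge: "norm (apply_scont F t) \<le> snorm F"
  unfolding snorm_def by (rule cSUP_upper[OF _ snorm_bdd]) simp

lemma snorm_le: "(\<And>t. norm (apply_scont F t) \<le> c) \<Longrightarrow> snorm F \<le> c"
  unfolding snorm_def by (rule cSUP_least) auto

lemma snorm_nonneg: "0 \<le> snorm (F :: 'a::cstar_algebra scont)"
  using snorm_ge[of F undefined] norm_ge_zero order_trans by blast

instantiation scont :: (cstar_algebra) real_normed_algebra
begin

definition "norm F = snorm F" for F :: "'a scont"
definition "dist F G = snorm (F - G)" for F G :: "'a scont"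
definition "sgn F = F /\<^sub>R snorm F" for F :: "'a scont"
definition "uniformity = (INF e\<in>{0 <..}. principal {(x, y :: 'a scont). dist x y < e})"
definition "open U = (\<forall>x\<in>U. \<forall>\<^sub>F (x', y) in uniformity. x' = x \<longrightarrow> y \<in> U)" for U :: "'a scont set"

instance
proof
  have norm_scont_ge: "norm (apply_scont F t) \<le> norm F" for F :: "'a scont" and t
    by (simp add: norm_scont_def snorm_ge)
  have norm_scont_le: "(\<And>t. norm (apply_scont F t) \<le> c) \<Longrightarrow> norm F \<le> c" for F :: "'a scont" and c
    by (simp add: norm_scont_def snorm_le)
  have norm_scont_nonneg: "0 \<le> norm F" for F :: "'a scont"
    by (simp add: norm_scont_def snorm_nonneg)
  fix F G H :: "'a scont" and r s :: real
  show "dist F G = norm (F - G)" by (simp add: dist_scont_def norm_scont_def)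
  show "sgn F = F /\<^sub>R norm F" by (simp add: sgn_scont_def norm_scont_def)
  show "uniformity = (INF e\<in>{0 <..}. principal {(x, y :: 'a scont). dist x y < e})"
    by (rule uniformity_scont_def)
  show "open U = (\<forall>x\<in>U. \<forall>\<^sub>F (x', y) in uniformity. x' = x \<longrightarrow> y \<in> U)" for U :: "'a scont set"
    by (rule open_scont_def)
  show eqs: "F + G + H = F + (G + H)" "F + G = G + F" "0 + F = F" "- F + F = 0" "F - G = F + - G"
    "r *\<^sub>R (F + G) = r *\<^sub>R F + r *\<^sub>R G" "(r + s) *\<^sub>R F = r *\<^sub>R F + s *\<^sub>R F"
    "r *\<^sub>R s *\<^sub>R F = (r * s) *\<^sub>R F" "1 *\<^sub>R F = F"
    "F * G * H = F * (G * H)" "(F + G) * H = F * H + G * H" "F * (G + H) = F * G + F * H"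
    "r *\<^sub>R F * G = r *\<^sub>R (F * G)" "F * r *\<^sub>R G = r *\<^sub>R (F * G)" for r s and F G H :: "'a scont"
    by (rule scont_eqI, simp add: scont_simps algebra_simps)+
  show "norm F = 0 \<longleftrightarrow> F = 0"
  proof
    assume "norm F = 0"
    then show "F = 0"
      using norm_scont_ge[of F] by (intro scont_eqI) (simp add: scont_simps)
  next
    assume "F = 0"
    then show "norm F = 0"
      by (simp add: norm_scont_def snorm_def scont_simps)
  qed
  show "norm (F + G) \<le> norm F + norm G"
    by (rule norm_scont_le) (simp add: scont_simps norm_triangle_le add_mono norm_scont_ge)
  have le: "norm (r *\<^sub>R F) \<le> \<bar>r\<bar> * norm F" for r and F :: "'a scont"
    by (rule norm_scont_le) (simp add: scont_simps mult_left_mono norm_scont_ge)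
  show "norm (r *\<^sub>R F) = \<bar>r\<bar> * norm F"
  proof (cases "r = 0")
    case True
    then show ?thesis using le[of r F] norm_scont_nonneg[of "r *\<^sub>R F"] by simp
  next
    case False
    have "norm F \<le> \<bar>inverse r\<bar> * norm (r *\<^sub>R F)"
      using le[of "inverse r" "r *\<^sub>R F"] False by (simp add: eqs)
    then have "\<bar>r\<bar> * norm F \<le> norm (r *\<^sub>R F)"
      using False by (simp add: field_simps)
    with le[of r F] show ?thesis by simp
  qed
  show "norm (F * G) \<le> norm F * norm G"
    by (rule norm_scont_le) (auto simp: scont_simps intro!: order_trans[OF norm_mult_ineq]
        mult_mono norm_scont_ge norm_scont_nonneg)
qed

end

lemmas norm_scont_ge = snorm_ge[folded norm_scont_def]
  and norm_scont_le = snorm_le[folded norm_scont_def]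
  and norm_scont_nonneg = snorm_nonneg[folded norm_scont_def]

instance scont :: (cstar_algebra) banach
proof
  fix X :: "nat \<Rightarrow> 'a scont"
  assume X: "Cauchy X"
  have dle: "dist (apply_scont F t) (apply_scont G t) \<le> dist F G" for F G :: "'a scont" and t
    using norm_scont_ge[of "F - G" t] by (simp add: dist_norm scont_simps)
  have "Cauchy (\<lambda>n. apply_scont (X n) t)" for t
    using X unfolding Cauchy_def by (meson dle le_less_trans)
  then have "\<exists>y. (\<lambda>n. apply_scont (X n) t) \<longlonglongrightarrow> y" for t
    by (meson Cauchy_convergent convergent_def)
  then obtain Y where Y: "(\<lambda>n. apply_scont (X n) t) \<longlonglongrightarrow> Y t" for t
    by metis
  have unif: "\<exists>N. \<forall>n\<ge>N. \<forall>t. norm (apply_scont (X n) t - Y t) \<le> e" if "e > 0" for e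
  proof -
    obtain N where N: "\<forall>m\<ge>N. \<forall>n\<ge>N. dist (X m) (X n) < e"
      using X \<open>e > 0\<close> unfolding Cauchy_def by blast
    have "norm (apply_scont (X n) t - Y t) \<le> e" if "n \<ge> N" for n t
    proof (rule Lim_norm_ubound[OF sequentially_bot])
      show "(\<lambda>m. apply_scont (X n) t - apply_scont (X m) t) \<longlonglongrightarrow> apply_scont (X n) t - Y t"
        by (intro tendsto_intros Y)
      show "\<forall>\<^sub>F m in sequentially. norm (apply_scont (X n) t - apply_scont (X m) t) \<le> e"
        using eventually_ge_at_top[of N]
      proof eventually_elim
        case (elim m)
        then show ?case
          using dle[of "X n" t "X m"] N that by (metis dist_norm le_less_trans less_imp_le)
      qed
    qed
    then show ?thesis by blast
  qed
  obtain N where N: "\<And>t. norm (apply_scont (X N) t - Y t) \<le> 1"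
    using unif[of 1] by auto
  have "norm (Y t) \<le> norm (X N) + 1" for t
    using N[of t] norm_scont_ge[of "X N" t] norm_triangle_sub[of "Y t" "apply_scont (X N) t"]
    by (simp add: norm_minus_commute)
  then have bd: "bounded (range Y)"
    by (rule bounded_range_normI)
  have L: "continuous_on UNIV (\<lambda>t. lmul (Y t) b)" for b
  proof (rule uniform_limit_theorem[where F = sequentially and f = "\<lambda>n t. lmul (apply_scont (X n) t) b"])
    show "uniform_limit UNIV (\<lambda>n t. lmul (apply_scont (X n) t) b) (\<lambda>t. lmul (Y t) b) sequentially"
    proof (rule uniform_limitI)
      fix e :: real assume "e > 0"
      then have "e / (2 * (norm b + 1)) > 0"
        by (intro divide_pos_pos) (auto intro: add_nonneg_pos)
      then obtain N where N: "\<And>n t. n \<ge> N \<Longrightarrow> norm (apply_scont (X n) t - Y t) \<le> e / (2 * (norm b + 1))"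
        using unif by blast
      have "dist (lmul (apply_scont (X n) t) b) (lmul (Y t) b) < e" if "n \<ge> N" for n t
      proof -
        have "dist (lmul (apply_scont (X n) t) b) (lmul (Y t) b) \<le> norm (apply_scont (X n) t - Y t) * norm b"
          unfolding dist_norm by (metis mul_diff(1) norm_lmul)
        also have "\<dots> \<le> e / (2 * (norm b + 1)) * (norm b + 1)"
          by (intro mult_mono N that) (use \<open>e > 0\<close> in auto)
        also have "\<dots> = e / 2"
          using norm_ge_zero[of b] by (simp add: field_simps add_nonneg_eq_0_iff)
        also have "\<dots> < e" using \<open>e > 0\<close> by simp
        finally show ?thesis .
      qed
      then show "\<forall>\<^sub>F n in sequentially. \<forall>t\<in>UNIV. dist (lmul (apply_scont (X n) t) b) (lmul (Y t) b) < e"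
        unfolding eventually_sequentially by blast
    qed
  qed (simp_all add: apply_scont_lmul)
  have R: "continuous_on UNIV (\<lambda>t. rmul b (Y t))" for b
  proof (rule uniform_limit_theorem[where F = sequentially and f = "\<lambda>n t. rmul b (apply_scont (X n) t)"])
    show "uniform_limit UNIV (\<lambda>n t. rmul b (apply_scont (X n) t)) (\<lambda>t. rmul b (Y t)) sequentially"
    proof (rule uniform_limitI)
      fix e :: real assume "e > 0"
      then have "e / (2 * (norm b + 1)) > 0"
        by (intro divide_pos_pos) (auto intro: add_nonneg_pos)
      then obtain N where N: "\<And>n t. n \<ge> N \<Longrightarrow> norm (apply_scont (X n) t - Y t) \<le> e / (2 * (norm b + 1))"
        using unif by blast
      have "dist (rmul b (apply_scont (X n) t)) (rmul b (Y t)) < e" if "n \<ge> N" for n t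
      proof -
        have "dist (rmul b (apply_scont (X n) t)) (rmul b (Y t)) \<le> norm (apply_scont (X n) t - Y t) * norm b"
          unfolding dist_norm by (metis mul_diff(2) norm_rmul)
        also have "\<dots> \<le> e / (2 * (norm b + 1)) * (norm b + 1)"
          by (intro mult_mono N that) (use \<open>e > 0\<close> in auto)
        also have "\<dots> = e / 2"
          using norm_ge_zero[of b] by (simp add: field_simps add_nonneg_eq_0_iff)
        also have "\<dots> < e" using \<open>e > 0\<close> by simp
        finally show ?thesis .
      qed
      then show "\<forall>\<^sub>F n in sequentially. \<forall>t\<in>UNIV. dist (rmul b (apply_scont (X n) t)) (rmul b (Y t)) < e"
        unfolding eventually_sequentially by blast
    qed
  qed (simp_all add: apply_scont_rmul)
  have Yap: "apply_scont (Scont Y) = Y"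
    by (rule Scont_inverse) (use bd L R in simp)
  have "X \<longlonglongrightarrow> Scont Y"
  proof (rule metric_LIMSEQ_I)
    fix e :: real assume "e > 0"
    then obtain N where N: "\<And>n t. n \<ge> N \<Longrightarrow> norm (apply_scont (X n) t - Y t) \<le> e / 2"
      using unif[of "e / 2"] by auto
    have "dist (X n) (Scont Y) \<le> e / 2" if "n \<ge> N" for n
      unfolding dist_norm by (rule norm_scont_le) (use N that in \<open>simp add: scont_simps Yap\<close>)
    with \<open>e > 0\<close> show "\<exists>N. \<forall>n\<ge>N. dist (X n) (Scont Y) < e"
      by (intro exI[of _ N]) (force intro: le_less_trans)
  qed
  then show "convergent X" by (auto simp: convergent_def)
qed

instance scont :: (cstar_algebra) cstar_algebra
proof
  fix F G :: "'a scont" and c d :: complex and r :: real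
  show eqs: "complex_of_real r *\<^sub>C F = r *\<^sub>R F" "c *\<^sub>C (F + G) = c *\<^sub>C F + c *\<^sub>C G"
    "(c + d) *\<^sub>C F = c *\<^sub>C F + d *\<^sub>C F" "c *\<^sub>C d *\<^sub>C F = (c * d) *\<^sub>C F"
    "c *\<^sub>C F * G = c *\<^sub>C (F * G)" "F * c *\<^sub>C G = c *\<^sub>C (F * G)"
    "star (star F) = F" "star (F + G) = star F + star G" "star (c *\<^sub>C F) = cnj c *\<^sub>C star F"
    "star (F * G) = star G * star F" for c d r and F G :: "'a scont"
    by (rule scont_eqI, simp add: scont_simps scaleC_of_real scaleC_add_right scaleC_add_left
        scaleC_scaleC scaleC_mult_left scaleC_mult_right star_star star_add star_scaleC star_mult)+
  have "(\<lambda>t. norm (apply_scont (c *\<^sub>C F) t)) = (\<lambda>t. norm (apply_scont (cmod c *\<^sub>R F) t))"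
    by (simp add: scont_simps norm_scaleC)
  then have "norm (c *\<^sub>C F) = norm (cmod c *\<^sub>R F)"
    unfolding norm_scont_def snorm_def by (rule arg_cong)
  then show "norm (c *\<^sub>C F) = cmod c * norm F"
    by simp
  show "norm (star F * F) = (norm F)\<^sup>2"
  proof (rule antisym)
    show "norm (star F * F) \<le> (norm F)\<^sup>2"
      by (rule norm_scont_le) (simp add: scont_simps cstar_identity norm_scont_ge power_mono)
    have "(norm (apply_scont F t))\<^sup>2 \<le> norm (star F * F)" for t
      using norm_scont_ge[of "star F * F" t] by (simp add: scont_simps cstar_identity)
    then have "norm (apply_scont F t) \<le> sqrt (norm (star F * F))" for t
      by (rule real_le_rsqrt)
    then have "norm F \<le> sqrt (norm (star F * F))"
      by (rule norm_scont_le)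
    then show "(norm F)\<^sup>2 \<le> norm (star F * F)"
      by (metis norm_ge_zero power_mono real_sqrt_pow2)
  qed
qed

lift_definition const_scont :: "'b::cstar_algebra multiplier \<Rightarrow> 'b scont" is "\<lambda>m _. m"
  by (auto simp: bounded_iff)

text \<open>\<open>C\<^sub>b(\<real>\<^sub>+; B)\<close> and \<open>C\<^sub>0(\<real>\<^sub>+; B)\<close> as subsets of \<open>C\<^sub>b\<^sub>,\<^sub>s(\<real>\<^sub>+; MB)\<close>\<close>

definition Cb :: "'b::cstar_algebra scont set" where
  "Cb = {F. \<exists>f :: halfline \<Rightarrow>\<^sub>C 'b. \<forall>t. apply_scont F t = mult_embed (f t)}"

definition C0 :: "'b::cstar_algebra scont set" where
  "C0 = {F. \<exists>f :: halfline \<Rightarrow>\<^sub>C 'b. (\<forall>t. apply_scont F t = mult_embed (f t)) \<and>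
      ((\<lambda>t. f t) \<longlongrightarrow> 0) at_infty}"

text \<open>
  The evaluation \<open>M(IB) \<rightarrow> MB\<close> at \<open>s\<close> is the canonical extension of the surjection
  \<open>ev\<^sub>s : IB \<rightarrow> B\<close>; it is determined by \<open>ev\<^sub>s(m) ev\<^sub>s(f) = ev\<^sub>s(m f)\<close>, used here for constant \<open>f\<close>.
\<close>

definition ev_multiplier :: "unit_interval \<Rightarrow> 'b::cstar_algebra path_algebra multiplier \<Rightarrow> 'b multiplier" where
  "ev_multiplier s m = mk_multiplier
     (\<lambda>b. apply_bcontfun (lmul m (const_bcontfun b)) s)
     (\<lambda>b. apply_bcontfun (rmul (const_bcontfun b) m) s)"

lemma bounded_linear_ev: "bounded_linear (\<lambda>f :: 'a::metric_space \<Rightarrow>\<^sub>C 'b::cstar_algebra. apply_bcontfun f s)"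
  by (rule bounded_linear_intro[where K = 1]) (auto simp: norm_bounded)

lemma bounded_linear_const_bcontfun:
  "bounded_linear (const_bcontfun :: 'b::cstar_algebra \<Rightarrow> 'a::metric_space \<Rightarrow>\<^sub>C 'b)"
  by (rule bounded_linear_intro[where K = 1]) (auto intro!: bcontfun_eqI norm_bound)

lemma const_bcontfun_cstar:
  "const_bcontfun (x * y) = const_bcontfun x * const_bcontfun (y :: 'b::cstar_algebra)"
  "const_bcontfun (c *\<^sub>C x) = c *\<^sub>C const_bcontfun x"
  by (rule bcontfun_eqI; simp add: bcontfun_cstar_simps)+

lemma ev_multiplier:
  "lmul (ev_multiplier s m) b = apply_bcontfun (lmul m (const_bcontfun b)) s" (is ?L)
  "rmul b (ev_multiplier s m) = apply_bcontfun (rmul (const_bcontfun b) m) s" (is ?R)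
proof -
  have bl: "bounded_linear (\<lambda>b. apply_bcontfun (lmul m (const_bcontfun b)) s)"
    "bounded_linear (\<lambda>b. apply_bcontfun (rmul (const_bcontfun b) m) s)"
    by (intro bounded_linear_compose[OF bounded_linear_ev] bounded_linear_compose[OF bounded_linear_lmul]
        bounded_linear_compose[OF bounded_linear_rmul] bounded_linear_const_bcontfun)+
  have "apply_bcontfun (rmul (const_bcontfun x) m) s * y = x * apply_bcontfun (lmul m (const_bcontfun y)) s" for x y
    using arg_cong[OF rmul_lmul[of "const_bcontfun x" m "const_bcontfun y"], of "\<lambda>f. apply_bcontfun f s"]
    by (simp add: bcontfun_cstar_simps)
  then show ?L ?R
    unfolding ev_multiplier_def
    by (subst mk_multiplier; simp add: bl const_bcontfun_cstar lmul_simps bcontfun_cstar_simps)+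
qed

lemma norm_const_bcontfun_le: "norm (const_bcontfun b :: 'a::metric_space \<Rightarrow>\<^sub>C 'b::cstar_algebra) \<le> norm b"
  by (rule norm_bound) simp

lift_definition ev_scont :: "unit_interval \<Rightarrow> 'b::cstar_algebra path_algebra scont \<Rightarrow> 'b scont"
  is "\<lambda>s F t. ev_multiplier s (F t)"
proof -
  fix s and F :: "halfline \<Rightarrow> 'b path_algebra multiplier"
  assume F: "bounded (range F) \<and> (\<forall>b. continuous_on UNIV (\<lambda>t. lmul (F t) b)) \<and> (\<forall>b. continuous_on UNIV (\<lambda>t. rmul b (F t)))"
  then obtain C where C: "norm (F t) \<le> C" for t by (auto simp: bounded_iff)
  have "norm (ev_multiplier s (F t)) \<le> C" for t
  proof (rule norm_multiplier_le)
    show "0 \<le> C" using C norm_ge_zero order_trans by blast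
    fix b
    have "norm (lmul (ev_multiplier s (F t)) b) \<le> norm (lmul (F t) (const_bcontfun b))"
      by (simp add: ev_multiplier norm_bounded)
    also have "\<dots> \<le> norm (F t) * norm (const_bcontfun b :: 'b path_algebra)"
      by (rule norm_lmul)
    also have "\<dots> \<le> C * norm b"
      by (intro mult_mono C norm_const_bcontfun_le \<open>0 \<le> C\<close>) simp
    finally show "norm (lmul (ev_multiplier s (F t)) b) \<le> C * norm b" .
  qed
  then show "bounded (range (\<lambda>t. ev_multiplier s (F t))) \<and>
      (\<forall>b. continuous_on UNIV (\<lambda>t. lmul (ev_multiplier s (F t)) b)) \<and>
      (\<forall>b. continuous_on UNIV (\<lambda>t. rmul b (ev_multiplier s (F t))))"
    using F by (auto simp: ev_multiplier intro: bounded_range_normI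
        intro!: bounded_linear.continuous_on[OF bounded_linear_ev])
qed


section \<open>Subalgebras, ideals, approximate units\<close>

definition cstar_subalgebra :: "'a::cstar_algebra set \<Rightarrow> bool" where
  "cstar_subalgebra E \<longleftrightarrow> closed E \<and> 0 \<in> E \<and> (\<forall>x\<in>E. \<forall>y\<in>E. x + y \<in> E \<and> x * y \<in> E) \<and>
     (\<forall>x\<in>E. star x \<in> E \<and> (\<forall>c. c *\<^sub>C x \<in> E))"

definition cstar_generated :: "'a::cstar_algebra set \<Rightarrow> 'a set" where
  "cstar_generated S = \<Inter> {E. cstar_subalgebra E \<and> S \<subseteq> E}"

definition closed_ideal :: "'a::cstar_algebra set \<Rightarrow> 'a set \<Rightarrow> bool" where
  "closed_ideal E D \<longleftrightarrow> D \<subseteq> E \<and> closed D \<and> 0 \<in> D \<and> (\<forall>x\<in>D. \<forall>y\<in>D. x + y \<in> D) \<and>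
     (\<forall>x\<in>D. \<forall>c. c *\<^sub>C x \<in> D) \<and> (\<forall>x\<in>D. \<forall>e\<in>E. e * x \<in> D \<and> x * e \<in> D)"

definition ideal_generated :: "'a::cstar_algebra set \<Rightarrow> 'a set \<Rightarrow> 'a set" where
  "ideal_generated E S = \<Inter> {D. closed_ideal E D \<and> S \<subseteq> D}"

text \<open>Approximate units consist of positive contractions; they are not required to be increasing.\<close>

definition approximate_unit :: "'a::cstar_algebra set \<Rightarrow> ('i \<Rightarrow> 'a) \<Rightarrow> 'i filter \<Rightarrow> bool" where
  "approximate_unit D u F \<longleftrightarrow>
     (\<forall>i. (\<exists>y\<in>D. u i = star y * y) \<and> norm (u i) \<le> 1) \<and>
     (\<forall>x\<in>D. ((\<lambda>i. u i * x) \<longlongrightarrow> x) F \<and> ((\<lambda>i. x * u i) \<longlongrightarrow> x) F)"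

definition quasicentral :: "'a::cstar_algebra set \<Rightarrow> ('i \<Rightarrow> 'a) \<Rightarrow> 'i filter \<Rightarrow> bool" where
  "quasicentral E u F \<longleftrightarrow> (\<forall>e\<in>E. ((\<lambda>i. u i * e - e * u i) \<longlongrightarrow> 0) F)"

definition sigma_unital :: "'b::cstar_algebra itself \<Rightarrow> bool" where
  "sigma_unital _ \<longleftrightarrow> (\<exists>u :: nat \<Rightarrow> 'b. approximate_unit UNIV u sequentially)"


section \<open>Stability\<close>

text \<open>
  \<open>B \<otimes> K\<close> is the norm closure of the finite matrices over \<open>B\<close>, where a matrix carries its operator norm
  on the Hilbert \<open>B\<close>-module \<open>\<ell>\<^sup>2(B)\<close>; its elements are realised as infinite matrices.
  For such matrices the series in the matrix product converge in norm. \<open>B\<close> is stable if \<open>B \<cong> B \<otimes> K\<close>.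
\<close>

definition matrix_norm_le :: "(nat \<Rightarrow> nat \<Rightarrow> 'b::cstar_algebra) \<Rightarrow> real \<Rightarrow> bool" where
  "matrix_norm_le M c \<longleftrightarrow> (\<forall>n x. norm (\<Sum>i<n. star (\<Sum>j<n. M i j * x j) * (\<Sum>j<n. M i j * x j))
      \<le> c\<^sup>2 * norm (\<Sum>j<n. star (x j) * x j))"

definition tensor_compacts :: "(nat \<Rightarrow> nat \<Rightarrow> 'b::cstar_algebra) set" where
  "tensor_compacts = {M. \<forall>e>0. \<exists>F. finite {(i, j). F i j \<noteq> 0} \<and> matrix_norm_le (\<lambda>i j. M i j - F i j) e}"

definition stable_algebra :: "'b::cstar_algebra itself \<Rightarrow> bool" where
  "stable_algebra _ \<longleftrightarrow> (\<exists>\<phi> :: (nat \<Rightarrow> nat \<Rightarrow> 'b) \<Rightarrow> 'b. bij_betw \<phi> tensor_compacts UNIV \<and>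
     (\<forall>M\<in>tensor_compacts. \<forall>N\<in>tensor_compacts.
        \<phi> (\<lambda>i j. M i j + N i j) = \<phi> M + \<phi> N \<and>
        \<phi> (\<lambda>i j. \<Sum>k. M i k * N k j) = \<phi> M * \<phi> N) \<and>
     (\<forall>M\<in>tensor_compacts. (\<forall>c. \<phi> (\<lambda>i j. c *\<^sub>C M i j) = c *\<^sub>C \<phi> M) \<and>
        \<phi> (\<lambda>i j. star (M j i)) = star (\<phi> M)))"


section \<open>Asymptotic \<open>KK\<close>-cycles\<close>

type_synonym ('a, 'b) kk_pair = "('a \<Rightarrow> 'b scont) \<times> ('a \<Rightarrow> 'b scont)"

definition kk_E :: "('a::cstar_algebra, 'b::cstar_algebra) kk_pair \<Rightarrow> 'b scont set" where
  "kk_E \<Phi> = cstar_generated (range (fst \<Phi>) \<union> range (snd \<Phi>))"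

definition kk_D :: "('a::cstar_algebra, 'b::cstar_algebra) kk_pair \<Rightarrow> 'b scont set" where
  "kk_D \<Phi> = ideal_generated (kk_E \<Phi>) (range (\<lambda>a. fst \<Phi> a - snd \<Phi> a))"

definition asymptotic_cycle :: "('a::cstar_algebra, 'b::cstar_algebra) kk_pair \<Rightarrow> bool" where
  "asymptotic_cycle \<Phi> \<longleftrightarrow>
     (\<forall>\<phi>\<in>{fst \<Phi>, snd \<Phi>}.
        continuous_on UNIV \<phi> \<and>
        (\<forall>c a. \<phi> (c *\<^sub>C a) = c *\<^sub>C \<phi> a) \<and>
        (\<forall>a. \<phi> (star a) - star (\<phi> a) \<in> C0) \<and>
        (\<forall>a b. \<forall>x\<in>kk_D \<Phi>. (\<phi> (a + b) - \<phi> a - \<phi> b) * x \<in> C0 \<and>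
                           (\<phi> (a * b) - \<phi> a * \<phi> b) * x \<in> C0)) \<and>
     kk_D \<Phi> \<subseteq> Cb"

definition compact_cycle :: "('a::cstar_algebra, 'b::cstar_algebra) kk_pair \<Rightarrow> bool" where
  "compact_cycle \<Phi> \<longleftrightarrow> asymptotic_cycle \<Phi> \<and> range (fst \<Phi>) \<subseteq> Cb \<and> range (snd \<Phi>) \<subseteq> Cb"

definition ev_pair :: "real \<Rightarrow> ('a, 'b::cstar_algebra path_algebra) kk_pair \<Rightarrow> ('a, 'b) kk_pair" where
  "ev_pair s H = (\<lambda>a. ev_scont (unit_of_real s) (fst H a), \<lambda>a. ev_scont (unit_of_real s) (snd H a))"

definition EL_homotopic :: "(('a::cstar_algebra, 'b::cstar_algebra) kk_pair \<times> ('a, 'b) kk_pair) set" where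
  "EL_homotopic = {(\<Phi>, \<Psi>). asymptotic_cycle \<Phi> \<and> asymptotic_cycle \<Psi> \<and>
     (\<exists>H :: ('a, 'b path_algebra) kk_pair. asymptotic_cycle H \<and> ev_pair 0 H = \<Phi> \<and> ev_pair 1 H = \<Psi>)}"

definition EM_homotopic :: "(('a::cstar_algebra, 'b::cstar_algebra) kk_pair \<times> ('a, 'b) kk_pair) set" where
  "EM_homotopic = {(\<Phi>, \<Psi>). compact_cycle \<Phi> \<and> compact_cycle \<Psi> \<and>
     (\<exists>H :: ('a, 'b path_algebra) kk_pair. compact_cycle H \<and> ev_pair 0 H = \<Phi> \<and> ev_pair 1 H = \<Psi>)}"

definition cuntz_pair :: "'b::cstar_algebra multiplier \<Rightarrow> 'b multiplier \<Rightarrow> bool" where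
  "cuntz_pair s1 s2 \<longleftrightarrow> star s1 * s1 = 1 \<and> star s2 * s2 = 1 \<and> s1 * star s1 + s2 * star s2 = 1"

definition map_sum :: "'b::cstar_algebra multiplier \<Rightarrow> 'b multiplier \<Rightarrow>
    ('a \<Rightarrow> 'b scont) \<Rightarrow> ('a \<Rightarrow> 'b scont) \<Rightarrow> 'a \<Rightarrow> 'b scont" where
  "map_sum s1 s2 \<phi> \<psi> a = const_scont s1 * \<phi> a * const_scont (star s1)
     + const_scont s2 * \<psi> a * const_scont (star s2)"

definition kk_sum :: "'b::cstar_algebra multiplier \<Rightarrow> 'b multiplier \<Rightarrow>
    ('a, 'b) kk_pair \<Rightarrow> ('a, 'b) kk_pair \<Rightarrow> ('a, 'b) kk_pair" where
  "kk_sum s1 s2 \<Phi> \<Psi> = (map_sum s1 s2 (fst \<Phi>) (fst \<Psi>), map_sum s1 s2 (snd \<Phi>) (snd \<Psi>))"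

text \<open>
  Operations on homotopy classes are lifted from representatives as the union of all resulting classes.
  When the result does not depend on the representatives this is the resulting class; otherwise the
  union of distinct classes is not a class.
\<close>

definition EL :: "'b::cstar_algebra multiplier \<Rightarrow> 'b multiplier \<Rightarrow> ('a::cstar_algebra, 'b) kk_pair set monoid" where
  "EL s1 s2 = \<lparr>carrier = {\<Phi>. asymptotic_cycle \<Phi>} // EL_homotopic,
     monoid.mult = (\<lambda>X Y. \<Union>\<Phi>\<in>X. \<Union>\<Psi>\<in>Y. EL_homotopic `` {kk_sum s1 s2 \<Phi> \<Psi>}),
     one = EL_homotopic `` {(\<lambda>_. 0, \<lambda>_. 0)}\<rparr>"

definition EM :: "'b::cstar_algebra multiplier \<Rightarrow> 'b multiplier \<Rightarrow> ('a::cstar_algebra, 'b) kk_pair set monoid" where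
  "EM s1 s2 = \<lparr>carrier = {\<Phi>. compact_cycle \<Phi>} // EM_homotopic,
     monoid.mult = (\<lambda>X Y. \<Union>\<Phi>\<in>X. \<Union>\<Psi>\<in>Y. EM_homotopic `` {kk_sum s1 s2 \<Phi> \<Psi>}),
     one = EM_homotopic `` {(\<lambda>_. 0, \<lambda>_. 0)}\<rparr>"


section \<open>The map \<open>p\<close>\<close>

text \<open>\<open>cutoff \<Phi> v\<close>: the function \<open>v\<close> is an admissible choice for \<open>\<Phi>\<close> in the definition of \<open>p\<close>.\<close>

definition cutoff :: "('a::cstar_algebra, 'b::cstar_algebra) kk_pair \<Rightarrow> 'b scont \<Rightarrow> bool" where
  "cutoff \<Phi> v \<longleftrightarrow> v \<in> Cb \<and>
     (\<exists>u :: halfline \<Rightarrow> 'b scont. \<exists>r r' :: halfline \<Rightarrow> halfline.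
        approximate_unit (kk_D \<Phi>) u at_infty \<and> quasicentral (kk_E \<Phi>) u at_infty \<and>
        homeomorphism UNIV UNIV r r' \<and> strict_mono r \<and>
        (\<forall>t. apply_scont v t = apply_scont (u (r t)) t)) \<and>
     (\<forall>\<phi>\<in>{fst \<Phi>, snd \<Phi>}. \<forall>a. ((\<lambda>t. apply_scont (v * \<phi> a - \<phi> a * v) t) \<longlongrightarrow> 0) at_infty) \<and>
     (\<forall>x\<in>kk_D \<Phi>. ((\<lambda>t. apply_scont (v * x - x) t) \<longlongrightarrow> 0) at_infty)"

definition kk_cut :: "'b::cstar_algebra scont \<Rightarrow> ('a, 'b) kk_pair \<Rightarrow> ('a, 'b) kk_pair" where
  "kk_cut v \<Phi> = (\<lambda>a. v * fst \<Phi> a, \<lambda>a. v * snd \<Phi> a)"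

definition p_map :: "('a::cstar_algebra, 'b::cstar_algebra) kk_pair set \<Rightarrow> ('a, 'b) kk_pair set" where
  "p_map X = (\<Union>\<Phi>\<in>X. \<Union>v\<in>{v. cutoff \<Phi> v}. EM_homotopic `` {kk_cut v \<Phi>})"

end

theory Submission
  imports Defs
begin

text \<open>
  Suppose \<open>M\<close> is self-adjoint, commutes with \<open>\<Phi>\<^sup>\<plusminus>(a)\<close> modulo \<open>C\<^sub>0\<close> and acts as a unit on \<open>\<Phi>\<^sup>+(a) - \<Phi>\<^sup>-(a)\<close>
  modulo \<open>C\<^sub>0\<close>. Then \<open>M\<Phi>\<close> is again a cycle, and for two such elements the linear path between them
  gives a homotopy of cycles. Both \<open>1\<close> and every admissible \<open>v\<close> are such elements. Hence \<open>v\<Phi>\<close> is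
  homotopic to \<open>\<Phi>\<close> in \<open>EL\<close>, and in \<open>EM\<close> if \<open>\<Phi>\<close> is compact, so the inclusion \<open>EM \<rightarrow> EL\<close> is
  inverse to \<open>p\<close>; independence of choices follows by cutting off a whole homotopy. An admissible \<open>v\<close> exists
  because a closed ideal whose generators have a countable dense subset has a norm-continuous
  quasicentral approximate unit, which is obtained by averaging an approximate unit.
\<close>

section \<open>Approximate units in closed ideals\<close>

text \<open>Three obstacles shape the proof. The axioms of a cycle quantify over the closed ideal
  \<open>kk_D\<close>, and these ideals are hard to compare once a pair is multiplied by
  \<open>M\<close>, mapped by a homomorphism, added or concatenated. The axioms are therefore
  rewritten as conditions on products defect times word times difference, modulo \<open>C0\<close>,
  and every such operation acts on these letter by letter. In this form a unit \<open>M\<close>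
  slides through a word and is absorbed by the difference at its end.

  Homotopies involve multipliers of IB, which are given only as double centralizers. They are
  identified with bounded strictly continuous families over [0,1]; joint continuity in time and path
  parameter then makes concatenation and linear paths available.

  Approximate units are obtained from the C*-identity alone. The inequality
  \<open>norm (1 - k * k) \<le> 1\<close> for self-adjoint contractions \<open>k\<close> takes the
  place of positivity and functional calculus.\<close>

lemma star_one [simp]: "star (1 :: 'c::{cstar_algebra,monoid_mult}) = 1"
  by (metis mult_1_left mult_1_right star_mult star_star)

text \<open>Only an inequality, because the zero algebra belongs to these classes as well and there
  1 = 0.\<close>

lemma norm_one_le: "norm (1 :: 'c::{cstar_algebra,monoid_mult}) \<le> 1"
  using cstar_identity[of "1::'c"] by (auto simp: power2_eq_square)

lemma star_sum: "star (sum f I) = (\<Sum>i\<in>I. star (f i :: 'c::cstar_algebra))"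
  by (rule linear_sum[OF bounded_linear.linear[OF bounded_linear_star]])

lemma norm_square_selfadjoint:
  fixes c :: "'c::cstar_algebra"
  shows "star c = c \<Longrightarrow> norm (c * c) = (norm c)\<^sup>2"
  using cstar_identity[of c] by simp

lemma norm_square_right: "(norm x)\<^sup>2 = norm (x * star x)" for x :: "'c::cstar_algebra"
  using cstar_identity[of "star x"] by (simp add: star_star)

text \<open>Completing \<open>k\<close> to a unitary \<open>a + i k\<close>: the root \<open>a = 1 - b\<close> of \<open>1 - k\<^sup>2\<close> comes from the fixed point \<open>b = (k\<^sup>2 + b\<^sup>2) / 2\<close>.\<close>

lemma norm_one_minus_square_le_strict:
  fixes k :: "'c::{cstar_algebra,monoid_mult}"
  assumes k: "star k = k" "norm k < 1"
  shows "norm (1 - k * k) \<le> 1"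
proof -
  \<comment> \<open>The conditions in \<open>S\<close> are closed and are inherited by
    \<open>f b\<close>, so the fixed point is automatically self-adjoint and commutes with
    \<open>k\<close>. On the ball of radius \<open>norm k\<close> the map contracts with factor
    \<open>norm k\<close>.\<close>
  define S where "S = {b. norm b \<le> norm k \<and> star b = b \<and> b * k = k * b}"
  define f where "f b = (1/2) *\<^sub>R (k * k + b * b)" for b
  have [continuous_intros]: "continuous_on UNIV (star :: 'c \<Rightarrow> 'c)"
    by (rule linear_continuous_on[OF bounded_linear_star])
  have "closed S"
    unfolding S_def by (intro closed_Collect_conj closed_Collect_le closed_Collect_eq continuous_intros)
  have "\<exists>!b\<in>S. f b = b"
  proof (rule Banach_fix)
    show "complete S" using \<open>closed S\<close> by (simp add: complete_eq_closed)
    show "S \<noteq> {}" using k by (auto simp: S_def intro!: exI[of _ 0])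
    show "f ` S \<subseteq> S"
    proof (intro image_subsetI)
      fix b assume b: "b \<in> S"
      have "norm (k * k + b * b) \<le> norm k * norm k + norm b * norm b"
        by (rule norm_triangle_le[OF add_mono[OF norm_mult_ineq norm_mult_ineq]])
      also have "\<dots> \<le> norm k * 1 + norm k * 1"
        using b k by (intro add_mono mult_mono) (auto simp: S_def)
      finally have "norm (f b) \<le> norm k" by (simp add: f_def)
      moreover have "star (f b) = f b"
        using b k by (simp add: f_def S_def star_scaleR star_add star_mult)
      moreover have "b * b * k = k * (b * b)"
        using b by (simp add: S_def mult.assoc) (simp add: mult.assoc[symmetric])
      then have "f b * k = k * f b"
        using b by (simp add: f_def algebra_simps)
      ultimately show "f b \<in> S" by (simp add: S_def)
    qed
    show "dist (f b) (f b') \<le> norm k * dist b b'" if "b \<in> S" "b' \<in> S" for b b'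
    proof -
      have "b * b - b' * b' = b * (b - b') + (b - b') * b'" by (simp add: algebra_simps)
      then have "norm (b * b - b' * b') \<le> norm b * norm (b - b') + norm (b - b') * norm b'"
        by (simp add: norm_triangle_le[OF add_mono[OF norm_mult_ineq norm_mult_ineq]])
      also have "\<dots> \<le> norm k * norm (b - b') + norm (b - b') * norm k"
        using that by (intro add_mono mult_mono) (auto simp: S_def)
      finally have "norm ((1/2) *\<^sub>R (b * b - b' * b')) \<le> norm k * norm (b - b')" by simp
      then show ?thesis by (simp add: f_def dist_norm scaleR_diff_right[symmetric])
    qed
  qed (use k in auto)
  then obtain b where b: "b \<in> S" "f b = b" by blast
  define a where "a = 1 - b"
  have "2 *\<^sub>R b = k * k + b * b" using arg_cong[OF b(2), of "\<lambda>x. 2 *\<^sub>R x"] by (simp add: f_def)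
  then have aa: "a * a = 1 - k * k" by (simp add: a_def algebra_simps scaleR_2)
  have sa: "star a = a" using b by (simp add: a_def star_diff S_def)
  have ak: "a * k = k * a" using b by (simp add: a_def S_def algebra_simps)
  \<comment> \<open>Since \<open>a * a + k * k = 1\<close> and \<open>a\<close>, \<open>k\<close>
    commute, \<open>star w * w = 1\<close>. Thus \<open>w\<close> is a contraction, and so is its
    real part \<open>a\<close>.\<close>
  define w where "w = a + \<i> *\<^sub>C k"
  have sw: "star w = a - \<i> *\<^sub>C k"
    using scaleC_minus_right[of \<i> k] scaleC_scaleC[of "-1" \<i> k] scaleC_of_real[of "-1" "\<i> *\<^sub>C k"]
    by (simp add: w_def star_add star_scaleC sa k)
  have "star w * w = a * a - (\<i> *\<^sub>C k) * (\<i> *\<^sub>C k)"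
    unfolding sw by (simp add: w_def algebra_simps scaleC_mult_left scaleC_mult_right scaleC_diff_right
        scaleC_add_right ak)
  also have "\<dots> = 1"
    using scaleC_of_real[of "-1" "k * k"]
    by (simp add: scaleC_mult_left scaleC_mult_right scaleC_scaleC aa)
  finally have "(norm w)\<^sup>2 = norm (1 :: 'c)" using cstar_identity[of w] by simp
  then have "(norm w)\<^sup>2 \<le> 1\<^sup>2" using norm_one_le[where 'c = 'c] by simp
  then have nw: "norm w \<le> 1" by (rule power2_le_imp_le) simp
  have "a = (1/2) *\<^sub>R (w + star w)" unfolding sw by (simp add: w_def scaleR_2[symmetric])
  then have "norm a \<le> 1" using nw norm_triangle_ineq[of w "star w"] by simp
  then have "norm (a * a) \<le> 1"
    by (simp add: norm_square_selfadjoint sa power_le_one)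
  then show ?thesis by (simp add: aa)
qed

text \<open>The strict case is applied to multiples of \<open>k\<close> by factors below 1 that tend
  to 1. This estimate is the source of contractivity for all elements built later as 1 minus a
  square.\<close>

lemma norm_one_minus_square_le:
  fixes k :: "'c::{cstar_algebra,monoid_mult}"
  assumes k: "star k = k" "norm k \<le> 1"
  shows "norm (1 - k * k) \<le> 1"
proof (rule tendsto_upperbound)
  let ?r = "\<lambda>n. 1 - 1 / real (Suc (Suc n))"
  have r: "?r \<longlonglongrightarrow> 1 - 0"
    using LIMSEQ_Suc[OF LIMSEQ_inverse_real_of_nat] by (intro tendsto_diff) (simp_all add: inverse_eq_divide)
  have "(\<lambda>n. norm (1 - (?r n *\<^sub>R k) * (?r n *\<^sub>R k))) \<longlonglongrightarrow> norm (1 - ((1 - 0) *\<^sub>R k) * ((1 - 0) *\<^sub>R k))"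
    by (intro tendsto_intros r)
  then show "(\<lambda>n. norm (1 - (?r n *\<^sub>R k) * (?r n *\<^sub>R k))) \<longlonglongrightarrow> norm (1 - k * k)" by simp
  have "norm (1 - (?r n *\<^sub>R k) * (?r n *\<^sub>R k)) \<le> 1" for n
  proof (rule norm_one_minus_square_le_strict)
    have "norm (?r n *\<^sub>R k) \<le> \<bar>?r n\<bar> * 1"
      unfolding norm_scaleR using k by (intro mult_left_mono) auto
    also have "\<dots> < 1" by simp
    finally show "norm (?r n *\<^sub>R k) < 1" .
  qed (simp add: star_scaleR k)
  then show "\<forall>\<^sub>F n in sequentially. norm (1 - (?r n *\<^sub>R k) * (?r n *\<^sub>R k)) \<le> 1" by simp
qed simp

section \<open>Local units in a closed ideal\<close>

locale cstar_ideal =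
  fixes E D :: "'c::{cstar_algebra,monoid_mult} set"
  assumes subalgebra: "cstar_subalgebra E" and ideal: "closed_ideal E D"
begin

lemma DE: "x \<in> D \<Longrightarrow> x \<in> E"
  and D_closed: "closed D" and D_zero: "0 \<in> D"
  and D_add: "x \<in> D \<Longrightarrow> y \<in> D \<Longrightarrow> x + y \<in> D"
  and D_scaleC: "x \<in> D \<Longrightarrow> c *\<^sub>C x \<in> D"
  and D_left: "e \<in> E \<Longrightarrow> x \<in> D \<Longrightarrow> e * x \<in> D"
  and D_right: "x \<in> D \<Longrightarrow> e \<in> E \<Longrightarrow> x * e \<in> D"
  using ideal by (auto simp: closed_ideal_def)

lemma E_star: "x \<in> E \<Longrightarrow> star x \<in> E"
  using subalgebra by (auto simp: cstar_subalgebra_def)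

lemma D_scaleR: "x \<in> D \<Longrightarrow> r *\<^sub>R x \<in> D"
  using D_scaleC[of x "complex_of_real r"] by (simp add: scaleC_of_real)

lemma D_minus: "x \<in> D \<Longrightarrow> - x \<in> D"
  using D_scaleR[of x "-1"] by simp

lemma D_diff: "x \<in> D \<Longrightarrow> y \<in> D \<Longrightarrow> x - y \<in> D"
  using D_add[of x "- y"] D_minus by simp

lemma D_mult: "x \<in> D \<Longrightarrow> y \<in> D \<Longrightarrow> x * y \<in> D"
  by (simp add: D_left DE)

lemma D_sum: "(\<And>i. i \<in> I \<Longrightarrow> f i \<in> D) \<Longrightarrow> sum f I \<in> D"
  by (induction I rule: infinite_finite_induct) (auto simp: D_zero D_add)

text \<open>An element \<open>c\<close> with \<open>1 - c\<close> in \<open>D\<close> plays the part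
  of 1 minus an approximate unit, where 1 is the unit of the ambient algebra. Such elements compose,
  so members of \<open>D\<close> can be annihilated one after another.\<close>

lemma co_mult: "1 - c \<in> D \<Longrightarrow> 1 - d \<in> D \<Longrightarrow> 1 - c * d \<in> D"
proof -
  assume *: "1 - c \<in> D" "1 - d \<in> D"
  have eq: "1 - c * d = (1 - c) + (1 - d) - (1 - c) * (1 - d)" by (simp add: algebra_simps)
  show ?thesis unfolding eq using * by (simp add: D_add D_diff D_mult)
qed

lemma co_absorb_left: "1 - c \<in> D \<Longrightarrow> x \<in> D \<Longrightarrow> c * x \<in> D"
  using D_diff[of x "(1 - c) * x"] D_mult[of "1 - c" x] by (simp add: algebra_simps)

text \<open>Cesaro means of the powers of \<open>T = 1 - k\<^sup>2\<close>: the mean times \<open>1 - T\<close> telescopes.\<close>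

lemma annihilate_selfadjoint_contraction:
  assumes k: "k \<in> D" "star k = k" "norm k \<le> 1" and e: "e > 0"
  obtains c where "1 - c \<in> D" "norm c \<le> 1" "norm (c * k) < e"
proof -
  define T where "T = 1 - k * k"
  have kk: "k * k \<in> D" using k by (simp add: D_mult)
  have T: "norm T \<le> 1" "1 - T \<in> D" "star T = T" "T * k = k * T"
    using norm_one_minus_square_le[OF k(2,3)] kk k by (simp_all add: T_def star_diff star_mult algebra_simps)
  have Tn: "norm (T ^ j) \<le> 1 \<and> 1 - T ^ j \<in> D \<and> star (T ^ j) = T ^ j \<and> T ^ j * k = k * T ^ j" for j
  proof (induction j)
    case 0
    show ?case by (simp add: norm_one_le D_zero)
  next
    case (Suc j)
    have "norm (T * T ^ j) \<le> 1 * 1"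
      using Suc T by (intro order_trans[OF norm_mult_ineq] mult_mono) auto
    moreover have "star (T * T ^ j) = T * T ^ j"
      using Suc T(3) by (simp add: star_mult power_commutes)
    moreover have "T * T ^ j * k = k * (T * T ^ j)"
      using Suc T(4) by (metis mult.assoc)
    ultimately show ?case using Suc co_mult T(2) by simp
  qed
  \<comment> \<open>The final estimate is that the square of \<open>norm (c * k)\<close> is at most
    \<open>2 / n\<close>, where 2 bounds \<open>norm (1 - T ^ n)\<close>.\<close>
  obtain n :: nat where n: "n > 0" "2 / e\<^sup>2 < n"
    by (metis gr0I less_trans of_nat_0 of_nat_less_iff reals_Archimedean2 zero_less_one of_nat_0_less_iff)
  define c where "c = (1 / real n) *\<^sub>R (\<Sum>j<n. T ^ j)"
  show ?thesis
  proof
    have "1 - c = (1 / real n) *\<^sub>R (\<Sum>j<n. 1 - T ^ j)"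
      using n by (simp add: c_def sum_subtractf sum_constant_scaleR algebra_simps)
    then show "1 - c \<in> D" using Tn by (simp add: D_scaleR D_sum)
    have "norm (\<Sum>j<n. T ^ j) \<le> (\<Sum>j<n. 1)" using Tn by (intro sum_norm_le) simp
    then show nc: "norm c \<le> 1" using n by (simp add: c_def field_simps)
    have "(\<Sum>j<m. T ^ j) * (1 - T) = 1 - T ^ m" for m
    proof (induction m)
      case (Suc m)
      have "(\<Sum>j<Suc m. T ^ j) * (1 - T) = (\<Sum>j<m. T ^ j) * (1 - T) + T ^ m * (1 - T)"
        by (simp add: distrib_right)
      then show ?case unfolding Suc by (simp add: right_diff_distrib power_commutes)
    qed simp
    then have "c * (k * k) = (1 / real n) *\<^sub>R (1 - T ^ n)"
      by (simp add: c_def T_def)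
    moreover have "norm (1 - T ^ n) \<le> 1 + 1"
      using Tn[of n] by (intro order_trans[OF norm_triangle_ineq4] add_mono norm_one_le) auto
    ultimately have ckk: "norm (c * (k * k)) \<le> 2 / real n"
      using n by (simp add: divide_right_mono)
    have sc: "star c = c"
      using Tn by (simp add: c_def star_scaleR star_sum)
    have "(norm (c * k))\<^sup>2 = norm (c * (k * k) * c)"
      by (simp add: norm_square_right star_mult k sc mult.assoc)
    also have "\<dots> \<le> (2 / real n) * 1"
      by (rule order_trans[OF norm_mult_ineq mult_mono[OF ckk nc]]) auto
    also have "\<dots> < e\<^sup>2" using n e by (simp add: field_simps)
    finally show "norm (c * k) < e" using e by (simp add: power2_less_imp_less)
  qed
qed

lemma annihilate_selfadjoint:
  assumes k: "k \<in> D" "star k = k" and e: "e > 0"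
  obtains c where "1 - c \<in> D" "norm c \<le> 1" "norm (c * k) < e"
proof -
  \<comment> \<open>Adding 1 keeps the scale positive when \<open>k = 0\<close>.\<close>
  define s where "s = norm k + 1"
  have s: "s > 0" by (simp add: s_def add_nonneg_pos)
  have "norm ((1 / s) *\<^sub>R k) \<le> 1" using s by (simp add: s_def field_simps)
  then obtain c where c: "1 - c \<in> D" "norm c \<le> 1" "norm (c * ((1 / s) *\<^sub>R k)) < e / s"
    using annihilate_selfadjoint_contraction[of "(1 / s) *\<^sub>R k" "e / s"] k e s by (auto simp: D_scaleR star_scaleR)
  then have "norm (c * k) < e" using s by (simp add: field_simps)
  with c that show ?thesis by blast
qed

text \<open>By the C*-identity it suffices to annihilate \<open>x * star x\<close>. Only this
  product is assumed to lie in \<open>D\<close>, because the lemma is applied to the adjoint of an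
  element of \<open>D\<close> before \<open>D\<close> is known to be closed under adjoints.\<close>

lemma annihilate:
  assumes x: "x * star x \<in> D" and e: "e > 0"
  obtains c where "1 - c \<in> D" "norm c \<le> 1" "norm (c * x) < e"
proof -
  obtain c where c: "1 - c \<in> D" "norm c \<le> 1" "norm (c * (x * star x)) < e\<^sup>2"
    using annihilate_selfadjoint[of "x * star x" "e\<^sup>2"] x e by (auto simp: star_mult star_star)
  have "(norm (c * x))\<^sup>2 = norm (c * (x * star x) * star c)"
    by (simp add: norm_square_right star_mult mult.assoc)
  also have "\<dots> \<le> norm (c * (x * star x)) * 1"
    using c by (intro order_trans[OF norm_mult_ineq] mult_left_mono) auto
  also have "\<dots> < e\<^sup>2" using c by simp
  finally have "norm (c * x) < e" using e by (simp add: power2_less_imp_less)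
  with c that show ?thesis by blast
qed

text \<open>The definition of a closed ideal does not ask for adjoints. If \<open>c\<close> nearly
  annihilates \<open>star x\<close>, then \<open>(1 - c) * star x\<close> lies in \<open>D\<close>,
  because \<open>1 - c\<close> does, and it approximates \<open>star x\<close>.\<close>

lemma D_star:
  assumes x: "x \<in> D" shows "star x \<in> D"
proof -
  have "\<exists>y\<in>D. dist y (star x) < e" if e: "e > 0" for e
  proof -
    obtain c where c: "1 - c \<in> D" "norm (c * star x) < e"
      by (rule annihilate[of "star x" e]) (use e x E_star[OF DE[OF x]] in \<open>auto simp: star_star D_left\<close>)
    have "(1 - c) * star x \<in> D" using c E_star[OF DE[OF x]] by (simp add: D_right)
    moreover have "dist ((1 - c) * star x) (star x) < e"
      using c by (simp add: dist_norm algebra_simps)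
    ultimately show ?thesis by blast
  qed
  then have "star x \<in> closure D" by (simp add: closure_approachable)
  then show ?thesis using D_closed by simp
qed

text \<open>Given \<open>c\<close> for the elements treated so far, a new \<open>z\<close> is
  handled by annihilating \<open>c * z\<close>, which still lies in \<open>D\<close>. The further
  factor \<open>d\<close> is a contraction and so preserves the earlier estimates.\<close>

lemma annihilate_finite:
  assumes "finite F" "F \<subseteq> D" "e > 0"
  obtains c where "1 - c \<in> D" "norm c \<le> 1" "\<And>x. x \<in> F \<Longrightarrow> norm (c * x) < e"
proof -
  have "\<exists>c. 1 - c \<in> D \<and> norm c \<le> 1 \<and> (\<forall>x\<in>F. norm (c * x) < e)"
    using assms
  proof (induction F)
    case empty
    show ?case using norm_one_le by (intro exI[of _ 1]) (simp add: D_zero)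
  next
    case (insert z F)
    then obtain c where c: "1 - c \<in> D" "norm c \<le> 1" "\<And>x. x \<in> F \<Longrightarrow> norm (c * x) < e" by auto
    have cz: "c * z \<in> D" using c insert by (simp add: co_absorb_left)
    obtain d where d: "1 - d \<in> D" "norm d \<le> 1" "norm (d * (c * z)) < e"
      using annihilate[of "c * z" e] cz insert by (auto simp: D_mult D_star)
    have "norm (d * (c * x)) < e" if "x \<in> F" for x
    proof -
      have "norm (d * (c * x)) \<le> 1 * norm (c * x)"
        using d by (intro order_trans[OF norm_mult_ineq] mult_right_mono) auto
      then show ?thesis using c(3)[OF that] by simp
    qed
    moreover have "norm (d * c) \<le> 1 * 1"
      using c d by (intro order_trans[OF norm_mult_ineq] mult_mono) auto
    ultimately show ?case using c d by (intro exI[of _ "d * c"]) (auto simp: co_mult mult.assoc)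
  qed
  then show ?thesis using that by blast
qed

text \<open>Passing from \<open>c\<close> to \<open>k = star c * c\<close> gives a self-adjoint
  annihilator. Squaring it once more makes \<open>1 - k * k\<close> a contraction by
  \<open>norm_one_minus_square_le\<close>.\<close>

lemma selfadjoint_local_unit:
  assumes "finite F" "F \<subseteq> D" "e > 0"
  obtains h where "h \<in> D" "star h = h" "norm h \<le> 1" "\<And>x. x \<in> F \<Longrightarrow> norm (x - h * x) < e"
proof -
  obtain c where c: "1 - c \<in> D" "norm c \<le> 1" "\<And>x. x \<in> F \<Longrightarrow> norm (c * x) < e"
    using annihilate_finite[OF assms] by blast
  define k where "k = star c * c"
  have sc: "1 - star c \<in> D" using D_star[OF c(1)] by (simp add: star_diff)
  have k: "star k = k" "1 - k \<in> D" "norm k \<le> 1"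
    using c sc by (simp_all add: k_def star_mult star_star co_mult cstar_identity power_le_one)
  show ?thesis
  proof
    show "1 - k * k \<in> D" using k by (simp add: co_mult)
    show "star (1 - k * k) = 1 - k * k" using k by (simp add: star_diff star_mult)
    show "norm (1 - k * k) \<le> 1" using norm_one_minus_square_le k by blast
    fix x assume "x \<in> F"
    have "x - (1 - k * k) * x = (k * star c) * (c * x)" by (simp add: k_def algebra_simps)
    moreover have "norm ((k * star c) * (c * x)) \<le> (1 * 1) * norm (c * x)"
      using c k by (intro order_trans[OF norm_mult_ineq] mult_right_mono)
        (auto intro!: order_trans[OF norm_mult_ineq] mult_le_one)
    ultimately show "norm (x - (1 - k * k) * x) < e" using c(3)[OF \<open>x \<in> F\<close>] by simp
  qed
qed

end

section \<open>Quasicentral sequences\<close>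

context cstar_ideal
begin

text \<open>Commutators with a sufficiently fast approximate unit are almost orthogonal,
  so averaging \<open>n\<close> of them divides the norm by \<open>\<surd>n\<close>.\<close>

lemma quasicentral_sequence:
  fixes x e :: "nat \<Rightarrow> 'c"
  assumes x: "\<And>j. x j \<in> D" and e: "\<And>j. e j \<in> E"
  obtains y where "\<And>n. y n \<in> D" "\<And>n. star (y n) = y n" "\<And>n. norm (y n) \<le> 1"
    "\<And>j. (\<lambda>n. y n * x j) \<longlonglongrightarrow> x j" "\<And>j. (\<lambda>n. x j * y n) \<longlonglongrightarrow> x j"
    "\<And>j. (\<lambda>n. y n * e j - e j * y n) \<longlonglongrightarrow> 0"
proof -
  define comm where "comm h j = h * e j - e j * h" for h j
  have commD: "comm h j \<in> D" if "h \<in> D" for h j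
    using that e by (simp add: comm_def D_left D_right D_diff)
  \<comment> \<open>The adjoints \<open>star (x j)\<close> are included because the right-hand
    limits come from left-hand ones by taking adjoints. The commutators of earlier terms, alone and
    multiplied by \<open>star (e j)\<close>, are what the expansion of
    \<open>star (c i) * c l\<close> with i < l requires.\<close>
  define P where "P f n h \<longleftrightarrow> h \<in> D \<and> star h = h \<and> norm h \<le> 1 \<and>
      (\<forall>j\<le>n. norm (x j - h * x j) < 1 / Suc n \<and> norm (star (x j) - h * star (x j)) < 1 / Suc n) \<and>
      (\<forall>i<n. \<forall>j\<le>n. norm (comm (f i) j - h * comm (f i) j) < 1 / Suc n \<and>
         norm (star (e j) * comm (f i) j - h * (star (e j) * comm (f i) j)) < 1 / Suc n)"
    for f :: "nat \<Rightarrow> 'c" and n h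
  \<comment> \<open>\<open>P f n\<close> reads \<open>f\<close> only below n, so the terms can be
    chosen by course-of-values recursion.\<close>
  have "\<exists>g. \<forall>n. P g n (g n)"
  proof (rule dependent_wf_choice[of "{(i, n). i < n}"])
    show "wf {(i, n :: nat). i < n}" by (rule wf_less)
    show "P f n r = P g n r" if "\<And>z. (z, n) \<in> {(i, n). i < n} \<Longrightarrow> f z = g z" for f g n r
    proof -
      have "f i = g i" if "i < n" for i using that \<open>\<And>z. _ \<Longrightarrow> f z = g z\<close> by simp
      then show ?thesis by (simp add: P_def)
    qed
    fix n :: nat and f assume f: "\<And>i. (i, n) \<in> {(i, n). i < n} \<Longrightarrow> P f i (f i)"
    define F where "F = x ` {..n} \<union> (\<lambda>j. star (x j)) ` {..n} \<union> (\<lambda>(i, j). comm (f i) j) ` ({..<n} \<times> {..n})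
      \<union> (\<lambda>(i, j). star (e j) * comm (f i) j) ` ({..<n} \<times> {..n})"
    have "f i \<in> D" if "i < n" for i using f[of i] that by (simp add: P_def)
    then have "F \<subseteq> D" by (auto simp: F_def x D_star commD D_left E_star e)
    moreover have "finite F" by (simp add: F_def)
    ultimately obtain h where "h \<in> D" "star h = h" "norm h \<le> 1" "\<And>x. x \<in> F \<Longrightarrow> norm (x - h * x) < 1 / Suc n"
      using selfadjoint_local_unit[of F "1 / Suc n"] by auto
    then show "\<exists>h. P f n h"
      by (intro exI[of _ h]) (auto simp: P_def F_def)
  qed
  then obtain g where "P g n (g n)" for n by blast
  then have gD: "g n \<in> D" and gs: "star (g n) = g n" and gn: "norm (g n) \<le> 1"
    and gx: "j \<le> n \<Longrightarrow> norm (x j - g n * x j) < 1 / Suc n"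
    and gx': "j \<le> n \<Longrightarrow> norm (star (x j) - g n * star (x j)) < 1 / Suc n"
    and gc: "i < n \<Longrightarrow> j \<le> n \<Longrightarrow> norm (comm (g i) j - g n * comm (g i) j) < 1 / Suc n"
    and gc': "i < n \<Longrightarrow> j \<le> n \<Longrightarrow>
      norm (star (e j) * comm (g i) j - g n * (star (e j) * comm (g i) j)) < 1 / Suc n" for i j n
    unfolding P_def by blast+
  \<comment> \<open>The mean of \<open>Suc n\<close> consecutive terms starting at
    \<open>Suc n\<close>: the block is long enough for averaging to gain a factor, and so far out
    that each of its terms is already a good unit.\<close>
  define y where "y n = (1 / Suc n) *\<^sub>R (\<Sum>i=Suc n..<2 * Suc n. g i)" for n
  have avg: "norm ((1 / Suc n) *\<^sub>R (\<Sum>i=Suc n..<2 * Suc n. z i)) \<le> C"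
    if "\<And>i. Suc n \<le> i \<Longrightarrow> norm (z i) \<le> C" for n C and z :: "nat \<Rightarrow> 'c"
  proof -
    define S where "S = (\<Sum>i=Suc n..<2 * Suc n. z i)"
    have "norm S \<le> (\<Sum>i=Suc n..<2 * Suc n. C)"
      unfolding S_def using that by (intro sum_norm_le) auto
    then have "norm S \<le> Suc n * C" by simp
    then show ?thesis unfolding S_def[symmetric] by (simp add: field_simps)
  qed
  have avg_diff: "(1 / Suc n) *\<^sub>R (\<Sum>i=Suc n..<2 * Suc n. z - w i) = z - (1 / Suc n) *\<^sub>R (\<Sum>i=Suc n..<2 * Suc n. w i)"
    for n and z :: 'c and w
    by (simp add: sum_subtractf sum_constant_scaleR scaleR_diff_right)
  have null: "(\<lambda>n. 1 / real (Suc (Suc n))) \<longlonglongrightarrow> 0"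
    using LIMSEQ_Suc[OF LIMSEQ_inverse_real_of_nat] by (simp add: inverse_eq_divide)
  have near: "norm (x j - y n * x j) \<le> 1 / Suc (Suc n) \<and> norm (star (x j) - y n * star (x j)) \<le> 1 / Suc (Suc n)"
    if "j \<le> n" for j n
  proof -
    have i: "norm (x j - g i * x j) \<le> 1 / Suc (Suc n) \<and> norm (star (x j) - g i * star (x j)) \<le> 1 / Suc (Suc n)"
      if "Suc n \<le> i" for i
    proof -
      have "1 / real (Suc i) \<le> 1 / Suc (Suc n)" using that by (simp add: frac_le)
      then show ?thesis using gx[of j i] gx'[of j i] that \<open>j \<le> n\<close> by force
    qed
    have avg_le: "norm (z - y n * z) \<le> C" if "\<And>i. Suc n \<le> i \<Longrightarrow> norm (z - g i * z) \<le> C" for z C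
    proof -
      have "y n * z = (1 / Suc n) *\<^sub>R (\<Sum>i=Suc n..<2 * Suc n. g i * z)"
        unfolding y_def by (simp only: mult_scaleR_left sum_distrib_right)
      then have "z - y n * z = (1 / Suc n) *\<^sub>R (\<Sum>i=Suc n..<2 * Suc n. z - g i * z)"
        by (simp only: avg_diff)
      then show ?thesis using avg[of n "\<lambda>i. z - g i * z" C] that by (simp only:)
    qed
    show ?thesis by (intro conjI avg_le; use i in blast)
  qed
  have lim: "(\<lambda>n. y n * z) \<longlonglongrightarrow> z" if "\<And>n. j \<le> n \<Longrightarrow> norm (z - y n * z) \<le> 1 / Suc (Suc n)" for j and z
  proof -
    have "(\<lambda>n. y n * z - z) \<longlonglongrightarrow> 0"
      by (rule Lim_null_comparison[OF _ null])
        (use that in \<open>auto simp: eventually_sequentially norm_minus_commute intro!: exI[of _ j]\<close>)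
    then show ?thesis by (simp add: LIM_zero_iff)
  qed
  show ?thesis
  proof
    show "y n \<in> D" for n unfolding y_def by (intro D_scaleR D_sum gD)
    show ys: "star (y n) = y n" for n unfolding y_def by (simp only: star_scaleR star_sum gs)
    show "norm (y n) \<le> 1" for n unfolding y_def by (rule avg) (rule gn)
    show "(\<lambda>n. y n * x j) \<longlonglongrightarrow> x j" for j using near by (intro lim[of j]) blast
    have "(\<lambda>n. y n * star (x j)) \<longlonglongrightarrow> star (x j)" for j using near by (intro lim[of j]) blast
    then have "(\<lambda>n. star (y n * star (x j))) \<longlonglongrightarrow> star (star (x j))" for j
      by (rule bounded_linear.tendsto[OF bounded_linear_star])
    then show "(\<lambda>n. x j * y n) \<longlonglongrightarrow> x j" for j by (simp add: star_mult star_star ys)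
    show "(\<lambda>n. y n * e j - e j * y n) \<longlonglongrightarrow> 0" for j
    proof -
      \<comment> \<open>In one row of the block the diagonal pair costs
        \<open>4 * (norm (e j))\<^sup>2\<close>, and \<open>Suc n\<close> bounds of size
        \<open>(norm (e j) + 1) / Suc n\<close> add up to \<open>norm (e j) + 1\<close>.\<close>
      define C where "C = 4 * (norm (e j))\<^sup>2 + (norm (e j) + 1)"
      define c where "c i = comm (g i) j" for i
      have nc: "norm (c i) \<le> 2 * norm (e j)" for i
      proof -
        have "norm (c i) \<le> norm (g i) * norm (e j) + norm (e j) * norm (g i)"
          unfolding c_def comm_def
          by (rule order_trans[OF norm_triangle_ineq4 add_mono[OF norm_mult_ineq norm_mult_ineq]])
        also have "\<dots> \<le> 1 * norm (e j) + norm (e j) * 1"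
          using gn[of i] by (intro add_mono mult_mono) auto
        finally show ?thesis by simp
      qed
      have less: "norm (star (c i) * c l) \<le> (norm (e j) + 1) / Suc n"
        if "i < l" "j \<le> l" "n \<le> l" for i l n
      proof -
        \<comment> \<open>Add and subtract \<open>star (c i) * e j\<close>. Both remainders measure
          how far the later term \<open>g l\<close> is from being a unit on earlier
          elements.\<close>
        have "star (c i) * c l = star (star (e j) * c i - g l * (star (e j) * c i))
            - star (c i - g l * c i) * e j"
          by (simp add: c_def[of l] comm_def star_diff star_mult star_star gs algebra_simps)
        also have "norm \<dots> \<le> norm (star (e j) * c i - g l * (star (e j) * c i)) + norm (c i - g l * c i) * norm (e j)"
          by (rule order_trans[OF norm_triangle_ineq4]) (metis add_left_mono norm_mult_ineq norm_star)
        also have "\<dots> \<le> 1 / Suc n + 1 / Suc n * norm (e j)"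
        proof -
          have "1 / real (Suc l) \<le> 1 / Suc n" using that by (simp add: frac_le)
          then show ?thesis using gc[of i l j] gc'[of i l j] that
            by (intro add_mono mult_right_mono) (auto simp: c_def)
        qed
        finally show ?thesis by (simp add: field_simps)
      qed
      have pair: "norm (star (c i) * c l) \<le> (if i = l then 4 * (norm (e j))\<^sup>2 else 0) + (norm (e j) + 1) / Suc n"
        if "Suc n \<le> i" "Suc n \<le> l" "j \<le> n" for i l n
      proof -
        consider "i < l" | "l < i" | "i = l" by linarith
        then show ?thesis
        proof cases
          case 2
          have "norm (star (c i) * c l) = norm (star (c l) * c i)"
            using norm_star[of "star (c l) * c i"] by (simp add: star_mult star_star)
          then show ?thesis using less[of l i n] that 2 by simp
        next
          case 3
          have "norm (star (c i) * c i) \<le> (2 * norm (e j))\<^sup>2"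
            unfolding cstar_identity by (rule power_mono[OF nc]) simp
          then show ?thesis using 3 by (simp add: power_mult_distrib add_increasing2)
        qed (use less[of i l n] that in simp)
      qed
      have sq: "(norm (y n * e j - e j * y n))\<^sup>2 \<le> C / Suc n" if "j \<le> n" for n
      proof -
        let ?I = "{Suc n..<2 * Suc n}"
        have "y n * e j - e j * y n = (1 / Suc n) *\<^sub>R (\<Sum>i\<in>?I. c i)"
          unfolding y_def c_def comm_def
          by (simp only: sum_subtractf sum_distrib_left sum_distrib_right scaleR_diff_right
              mult_scaleR_left mult_scaleR_right)
        then have eq: "(norm (y n * e j - e j * y n))\<^sup>2 = (1 / Suc n)\<^sup>2 * (norm (\<Sum>i\<in>?I. c i))\<^sup>2"
          by (simp add: power_mult_distrib power_divide)
        have "(norm (\<Sum>i\<in>?I. c i))\<^sup>2 = norm (\<Sum>i\<in>?I. \<Sum>l\<in>?I. star (c i) * c l)"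
          by (simp only: cstar_identity[symmetric] star_sum sum_product)
        also have "\<dots> \<le> (\<Sum>i\<in>?I. \<Sum>l\<in>?I. (if i = l then 4 * (norm (e j))\<^sup>2 else 0) + (norm (e j) + 1) / Suc n)"
          using that by (intro sum_norm_le pair) auto
        also have "\<dots> = (\<Sum>i\<in>?I. 4 * (norm (e j))\<^sup>2 + (norm (e j) + 1))"
          by (intro sum.cong refl) (simp add: sum.distrib sum.delta)
        also have "\<dots> = Suc n * C" by (simp add: C_def)
        finally have "(1 / Suc n)\<^sup>2 * (norm (\<Sum>i\<in>?I. c i))\<^sup>2 \<le> (1 / Suc n)\<^sup>2 * (Suc n * C)"
          by (rule mult_left_mono) simp
        also have "\<dots> = C / Suc n" by (simp add: power2_eq_square)
        finally show ?thesis unfolding eq .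
      qed
      have "(\<lambda>n. (norm (y n * e j - e j * y n))\<^sup>2) \<longlonglongrightarrow> 0"
      proof (rule Lim_null_comparison)
        show "\<forall>\<^sub>F n in sequentially. norm ((norm (y n * e j - e j * y n))\<^sup>2) \<le> C * (1 / Suc n)"
          using sq by (auto simp: eventually_sequentially intro!: exI[of _ j])
        show "(\<lambda>n. C * (1 / Suc n)) \<longlonglongrightarrow> 0"
          using LIMSEQ_inverse_real_of_nat by (intro tendsto_mult_right_zero) (simp add: inverse_eq_divide)
      qed
      then have "(\<lambda>n. sqrt ((norm (y n * e j - e j * y n))\<^sup>2)) \<longlonglongrightarrow> sqrt 0"
        by (rule tendsto_real_sqrt)
      then show ?thesis by (simp add: tendsto_norm_zero_iff)
    qed
  qed
qed

end

section \<open>Interpolation of a sequence by a polygonal path\<close>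

lemma polygonal_path:
  fixes y :: "nat \<Rightarrow> 'c::real_normed_vector"
  obtains p :: "real \<Rightarrow> 'c" where "continuous_on {0..} p"
    "\<And>t. 0 \<le> t \<Longrightarrow> \<exists>s\<in>{0..1}. p t = (1 - s) *\<^sub>R y (nat \<lfloor>t\<rfloor>) + s *\<^sub>R y (Suc (nat \<lfloor>t\<rfloor>))"
proof -
  \<comment> \<open>A ramp that rises from 0 at n to 1 at n + 1 and then stays at 1, so each
    increment is switched on once and never removed.\<close>
  define tent where "tent n t = max 0 (min 1 (t - real n))" for n t
  define q where "q N t = y 0 + (\<Sum>n<N. tent n t *\<^sub>R (y (Suc n) - y n))" for N t
  define p where "p t = q (Suc (nat \<lfloor>t\<rfloor>)) t" for t
  have cont_q: "continuous_on UNIV (q N)" for N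
    unfolding q_def tent_def by (intro continuous_intros)
  have q_eq: "q (Suc N) t = q (Suc M) t" if "t \<le> real (Suc M)" "M \<le> N" for M N :: nat and t
    using that(2)
  proof (induction N rule: dec_induct)
    case (step k)
    then show ?case using that(1) by (simp add: q_def tent_def)
  qed simp
  have q_start: "q M t = y M" if "real M \<le> t" for M :: nat and t
  proof -
    have "q M t = y 0 + (\<Sum>n<M. y (Suc n) - y n)"
      unfolding q_def using that by (intro arg_cong2[of _ _ _ _ "(+)"] sum.cong) (auto simp: tent_def)
    then show ?thesis by (simp only: sum_lessThan_telescope) simp
  qed
  have floor: "real (nat \<lfloor>t\<rfloor>) \<le> t" "t < Suc (nat \<lfloor>t\<rfloor>)" if "0 \<le> t" for t
    using that by (simp_all, linarith?)
  show ?thesis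
  proof
    show "\<exists>s\<in>{0..1}. p t = (1 - s) *\<^sub>R y (nat \<lfloor>t\<rfloor>) + s *\<^sub>R y (Suc (nat \<lfloor>t\<rfloor>))" if "0 \<le> t" for t
    proof
      let ?n = "nat \<lfloor>t\<rfloor>"
      have "p t = q ?n t + tent ?n t *\<^sub>R (y (Suc ?n) - y ?n)"
        by (simp add: p_def q_def)
      also have "q ?n t = y ?n" by (rule q_start[OF floor(1)[OF that]])
      finally show "p t = (1 - tent ?n t) *\<^sub>R y ?n + tent ?n t *\<^sub>R y (Suc ?n)"
        by (simp add: algebra_simps)
      show "tent ?n t \<in> {0..1}" by (simp add: tent_def)
    qed
    show "continuous_on {0..} p"
    proof (rule continuous_on_subset)
      \<comment> \<open>Below \<open>Suc N\<close> only the ramps up to N are active, so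
        \<open>p\<close> agrees there with the finite sum \<open>q (Suc N)\<close>.\<close>
      have "continuous_on {..<real (Suc N)} p" for N
      proof (rule continuous_on_eq)
        show "continuous_on {..<real (Suc N)} (q (Suc N))" by (rule continuous_on_subset[OF cont_q]) simp
        show "q (Suc N) t = p t" if "t \<in> {..<real (Suc N)}" for t
          unfolding p_def by (rule q_eq) (use that in \<open>auto, linarith+\<close>)
      qed
      then show "continuous_on (\<Union>N. {..<real (Suc N)}) p"
        by (intro continuous_on_open_UN) auto
      show "{0..} \<subseteq> (\<Union>N. {..<real (Suc N)})"
        using floor(2) by blast
    qed
  qed
qed

section \<open>Generated subalgebras and ideals\<close>

lemma cstar_subalgebra_generated: "cstar_subalgebra (cstar_generated S)"
  unfolding cstar_generated_def cstar_subalgebra_def by (auto intro!: closed_Inter)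

lemma cstar_generated_superset: "S \<subseteq> cstar_generated S"
  unfolding cstar_generated_def by auto

lemma cstar_generated_least: "cstar_subalgebra E \<Longrightarrow> S \<subseteq> E \<Longrightarrow> cstar_generated S \<subseteq> E"
  unfolding cstar_generated_def by auto

lemma closed_ideal_self: "cstar_subalgebra E \<Longrightarrow> closed_ideal E E"
  unfolding cstar_subalgebra_def closed_ideal_def by auto

text \<open>\<open>E\<close> is itself a closed ideal containing \<open>S\<close>, so the
  intersection runs over a nonempty family and stays inside \<open>E\<close>.\<close>

lemma closed_ideal_generated:
  assumes "cstar_subalgebra E" "S \<subseteq> E" shows "closed_ideal E (ideal_generated E S)"
  using closed_ideal_self[OF assms(1)] assms(2)
  unfolding ideal_generated_def closed_ideal_def by (auto intro!: closed_Inter)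

lemma ideal_generated_superset: "S \<subseteq> ideal_generated E S"
  unfolding ideal_generated_def by auto

lemma ideal_generated_least: "closed_ideal E D \<Longrightarrow> S \<subseteq> D \<Longrightarrow> ideal_generated E S \<subseteq> D"
  unfolding ideal_generated_def by auto

text \<open>The bound \<open>K\<close> is uniform in t, so a nearby point at which the limit holds
  controls the norm up to epsilon. The lemma carries limits from dense subsets to closures and gives
  closedness of \<open>C0\<close>.\<close>

lemma closed_null_set:
  fixes L :: "'t \<Rightarrow> 'c::real_normed_vector \<Rightarrow> 'd::real_normed_vector"
  assumes diff: "\<And>t x y. L t (x - y) = L t x - L t y" and bound: "\<And>t x. norm (L t x) \<le> K * norm x"
  shows "closed {x. ((\<lambda>t. L t x) \<longlongrightarrow> 0) F}"
proof -
  have "((\<lambda>t. L t x) \<longlongrightarrow> 0) F" if x: "x \<in> closure {x. ((\<lambda>t. L t x) \<longlongrightarrow> 0) F}" for x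
  proof (rule tendstoI)
    fix e :: real assume e: "e > 0"
    define \<delta> where "\<delta> = e / (2 * (\<bar>K\<bar> + 1))"
    have "\<delta> > 0" using e by (simp add: \<delta>_def add_nonneg_pos)
    then obtain y where y: "((\<lambda>t. L t y) \<longlongrightarrow> 0) F" "dist y x < \<delta>"
      using x by (auto simp: closure_approachable)
    have "norm (L t x - L t y) \<le> e / 2" for t
    proof -
      have "norm (L t x - L t y) \<le> K * norm (x - y)" by (metis diff bound)
      also have "\<dots> \<le> (\<bar>K\<bar> + 1) * \<delta>"
        using y \<open>\<delta> > 0\<close> by (intro mult_mono) (auto simp: dist_norm norm_minus_commute)
      also have "\<dots> = e / 2" by (simp add: \<delta>_def field_simps)
      finally show ?thesis .
    qed
    moreover have "\<forall>\<^sub>F t in F. norm (L t y) < e / 2"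
      using tendstoD[OF y(1), of "e / 2"] e by simp
    ultimately show "\<forall>\<^sub>F t in F. dist (L t x) 0 < e"
      by (elim eventually_mono) (smt (verit) dist_0_norm dist_commute field_sum_of_halves norm_triangle_sub)
  qed
  then show ?thesis by (metis (no_types, lifting) closure_subset_eq mem_Collect_eq subsetI)
qed

text \<open>Convex combinations of neighbouring terms of a quasicentral sequence keep all its
  properties, so the limits hold along \<open>e\<close> and \<open>x\<close>. They extend to
  \<open>E\<close> and \<open>D\<close> because the elements that commute asymptotically form a
  C*-subalgebra, and those of \<open>E\<close> on which \<open>h\<close> is an asymptotic unit form
  a closed ideal.\<close>

lemma quasicentral_path:
  fixes S S' :: "'c::{cstar_algebra,monoid_mult} set" and e x :: "nat \<Rightarrow> 'c"
  defines "E \<equiv> cstar_generated S" and "D \<equiv> ideal_generated (cstar_generated S) S'"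
  assumes S'E: "S' \<subseteq> E" and e: "range e \<subseteq> S" "S \<subseteq> closure (range e)"
    and x: "range x \<subseteq> S'" "S' \<subseteq> closure (range x)"
  obtains h :: "halfline \<Rightarrow> 'c" where "continuous_on UNIV h" "\<And>t. h t \<in> D" "\<And>t. star (h t) = h t"
    "\<And>t. norm (h t) \<le> 1" "\<And>z. z \<in> E \<Longrightarrow> ((\<lambda>t. h t * z - z * h t) \<longlongrightarrow> 0) at_infty"
    "\<And>z. z \<in> D \<Longrightarrow> ((\<lambda>t. h t * z - z) \<longlongrightarrow> 0) at_infty"
    "\<And>z. z \<in> D \<Longrightarrow> ((\<lambda>t. z * h t - z) \<longlongrightarrow> 0) at_infty"
proof -
  interpret cstar_ideal E D
    unfolding D_def using S'E
    by unfold_locales (simp_all add: closed_ideal_generated E_def cstar_subalgebra_generated)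
  have eE: "e j \<in> E" and xD: "x j \<in> D" for j
    using e(1) x(1) cstar_generated_superset[of S] ideal_generated_superset[of S' "cstar_generated S"]
    unfolding E_def D_def by (meson rangeI subsetD)+
  obtain y where y: "\<And>n. y n \<in> D" "\<And>n. star (y n) = y n" "\<And>n. norm (y n) \<le> 1"
    "\<And>j. (\<lambda>n. y n * x j) \<longlonglongrightarrow> x j" "\<And>j. (\<lambda>n. x j * y n) \<longlonglongrightarrow> x j"
    "\<And>j. (\<lambda>n. y n * e j - e j * y n) \<longlonglongrightarrow> 0"
    by (rule quasicentral_sequence[of x e, OF xD eE], rule that; assumption)
  obtain p :: "real \<Rightarrow> 'c" where p: "continuous_on {0..} p" and seg:
    "\<And>t. 0 \<le> t \<Longrightarrow> \<exists>s\<in>{0..1}. p t = (1 - s) *\<^sub>R y (nat \<lfloor>t\<rfloor>) + s *\<^sub>R y (Suc (nat \<lfloor>t\<rfloor>))"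
    by (rule polygonal_path[of y], rule that; blast)
  define h where "h t = p (real_of_halfline t)" for t
  have pos: "0 \<le> real_of_halfline t" for t using real_of_halfline[of t] by simp
  have hD: "h t \<in> D" and hs: "star (h t) = h t" and hn: "norm (h t) \<le> 1" for t
  proof -
    obtain s n where s: "s \<in> {0..1}" "h t = (1 - s) *\<^sub>R y n + s *\<^sub>R y (Suc n)"
      using seg[OF pos[of t]] unfolding h_def by blast
    show "h t \<in> D" "star (h t) = h t" by (simp_all add: s(2) y D_add D_scaleR star_add star_scaleR)
    have "norm (h t) \<le> (1 - s) * norm (y n) + s * norm (y (Suc n))"
      unfolding s(2) using s(1) by (intro norm_triangle_le) simp
    also have "\<dots> \<le> (1 - s) * 1 + s * 1"
      using s(1) y(3) by (intro add_mono mult_left_mono) auto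
    finally show "norm (h t) \<le> 1" by simp
  qed
  have lim: "((\<lambda>t. L (h t) - l) \<longlongrightarrow> 0) at_infty"
    if L: "linear L" and l: "(\<lambda>n. L (y n)) \<longlonglongrightarrow> l" for L :: "'c \<Rightarrow> 'c" and l
  proof (rule tendstoI)
    fix \<delta> :: real assume "\<delta> > 0"
    then obtain N where N: "\<And>n. n \<ge> N \<Longrightarrow> norm (L (y n) - l) < \<delta>"
      using LIMSEQ_D[OF l] by blast
    have "dist (L (h t) - l) 0 < \<delta>" if "real N \<le> real_of_halfline t" for t
    proof -
      obtain s n where s: "s \<in> {0..1}" "h t = (1 - s) *\<^sub>R y n + s *\<^sub>R y (Suc n)" "n = nat \<lfloor>real_of_halfline t\<rfloor>"
        using seg[OF pos[of t]] unfolding h_def by blast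
      have n: "N \<le> n" using that s(3) by (simp add: le_nat_floor)
      have "L (h t) - l = (1 - s) *\<^sub>R (L (y n) - l) + s *\<^sub>R (L (y (Suc n)) - l)"
        unfolding s(2) linear_add[OF L] linear_scale[OF L] by (simp add: algebra_simps)
      also have "norm \<dots> \<le> (1 - s) * norm (L (y n) - l) + s * norm (L (y (Suc n)) - l)"
        using s(1) by (intro norm_triangle_le) simp
      also have "\<dots> < \<delta>"
        using s(1) N[OF n] N[of "Suc n"] n by (intro convex_bound_lt) auto
      finally show ?thesis by simp
    qed
    then show "\<forall>\<^sub>F t in at_infty. dist (L (h t) - l) 0 < \<delta>"
      unfolding eventually_filtercomap using eventually_ge_at_top[of "real N"] by blast
  qed
  have hz: "norm (h t * z) \<le> norm z" "norm (z * h t) \<le> norm z" for t z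
  proof -
    have "norm (h t * z) \<le> 1 * norm z" "norm (z * h t) \<le> norm z * 1"
      using hn[of t] by (intro order_trans[OF norm_mult_ineq] mult_mono; simp)+
    then show "norm (h t * z) \<le> norm z" "norm (z * h t) \<le> norm z" by simp_all
  qed
  define C where "C = {z. ((\<lambda>t. h t * z - z * h t) \<longlongrightarrow> 0) at_infty}"
  define U where "U = {z. ((\<lambda>t. h t * z - z) \<longlongrightarrow> 0) at_infty}"
  define V where "V = {z. ((\<lambda>t. z * h t - z) \<longlongrightarrow> 0) at_infty}"
  have two: "norm (a - b) \<le> 2 * norm z" if "norm a \<le> norm z" "norm b \<le> norm z" for a b z :: 'c
    using norm_triangle_ineq4[of a b] that by simp
  have closed: "closed C" "closed U" "closed V"
    unfolding C_def U_def V_def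
    by (rule closed_null_set[where K = 2], simp add: algebra_simps, rule two; simp add: hz)+
  have "cstar_subalgebra C"
    unfolding cstar_subalgebra_def
  proof (intro conjI ballI allI closed)
    fix z w assume z: "z \<in> C" and w: "w \<in> C"
    have "((\<lambda>t. (h t * z - z * h t) + (h t * w - w * h t)) \<longlongrightarrow> 0 + 0) at_infty"
      using z w by (intro tendsto_add) (simp_all add: C_def)
    then show "z + w \<in> C" by (simp add: C_def algebra_simps)
    have "((\<lambda>t. (h t * z - z * h t) * w + z * (h t * w - w * h t)) \<longlongrightarrow> 0 * w + z * 0) at_infty"
      using z w by (intro tendsto_intros) (simp_all add: C_def)
    then show "z * w \<in> C" by (simp add: C_def algebra_simps)
    have "((\<lambda>t. - star (h t * z - z * h t)) \<longlongrightarrow> - star 0) at_infty"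
      using z by (intro tendsto_minus bounded_linear.tendsto[OF bounded_linear_star]) (simp add: C_def)
    then show "star z \<in> C" by (simp add: C_def star_diff star_mult hs)
    have "((\<lambda>t. c *\<^sub>C (h t * z - z * h t)) \<longlongrightarrow> c *\<^sub>C 0) at_infty" for c
      using z by (intro bounded_linear.tendsto[OF bounded_linear_scaleC]) (simp add: C_def)
    then show "c *\<^sub>C z \<in> C" for c by (simp add: C_def scaleC_diff_right scaleC_mult_left scaleC_mult_right)
  qed (simp add: C_def)
  moreover have "range e \<subseteq> C"
  proof
    fix z assume "z \<in> range e"
    then obtain j where "z = e j" by blast
    moreover have "linear (\<lambda>a. a * e j - e j * a)" by (rule linearI) (simp_all add: algebra_simps)
    ultimately show "z \<in> C" using lim[OF _ y(6)[of j]] by (simp add: C_def)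
  qed
  then have "S \<subseteq> C" using e(2) closed(1) by (meson closure_minimal order_trans)
  ultimately have EC: "E \<subseteq> C" unfolding E_def by (rule cstar_generated_least)
  \<comment> \<open>Stability under multiplication by \<open>E\<close> rests on the inclusion just
    shown: \<open>h t * a * z\<close> may be replaced by \<open>a * h t * z\<close>, and
    \<open>z * a * h t\<close> by \<open>z * h t * a\<close>.\<close>
  have "closed_ideal E (E \<inter> U \<inter> V)"
    unfolding closed_ideal_def
  proof (intro conjI ballI allI)
    have cE: "closed E" and addE: "\<And>z w. z \<in> E \<Longrightarrow> w \<in> E \<Longrightarrow> z + w \<in> E \<and> z * w \<in> E"
      and scE: "\<And>z c. z \<in> E \<Longrightarrow> c *\<^sub>C z \<in> E" and zE: "0 \<in> E"
      using subalgebra by (auto simp: cstar_subalgebra_def)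
    show "closed (E \<inter> U \<inter> V)" using cE closed by (intro closed_Int)
    show "0 \<in> E \<inter> U \<inter> V" using zE by (simp add: U_def V_def)
    fix z assume z: "z \<in> E \<inter> U \<inter> V"
    show "c *\<^sub>C z \<in> E \<inter> U \<inter> V" for c
    proof -
      have "((\<lambda>t. c *\<^sub>C (h t * z - z)) \<longlongrightarrow> c *\<^sub>C 0) at_infty" "((\<lambda>t. c *\<^sub>C (z * h t - z)) \<longlongrightarrow> c *\<^sub>C 0) at_infty"
        using z by (intro bounded_linear.tendsto[OF bounded_linear_scaleC]; simp add: U_def V_def)+
      then show ?thesis using z scE
        by (simp add: U_def V_def scaleC_diff_right scaleC_mult_left scaleC_mult_right)
    qed
    show "z + w \<in> E \<inter> U \<inter> V" if w: "w \<in> E \<inter> U \<inter> V" for w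
    proof -
      have "((\<lambda>t. (h t * z - z) + (h t * w - w)) \<longlongrightarrow> 0 + 0) at_infty"
        "((\<lambda>t. (z * h t - z) + (w * h t - w)) \<longlongrightarrow> 0 + 0) at_infty"
        using z w by (intro tendsto_add; simp add: U_def V_def)+
      then show ?thesis using z w addE by (simp add: U_def V_def algebra_simps)
    qed
    fix a assume a: "a \<in> E"
    then have "((\<lambda>t. h t * a - a * h t) \<longlongrightarrow> 0) at_infty" using EC by (auto simp: C_def)
    note comm = this tendsto_mult_left_zero[OF this, of z] tendsto_mult_right_zero[OF this, of z]
    have "((\<lambda>t. (h t * a - a * h t) * z + a * (h t * z - z)) \<longlongrightarrow> 0 + a * 0) at_infty"
      "((\<lambda>t. a * (z * h t - z)) \<longlongrightarrow> a * 0) at_infty"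
      using z by (intro tendsto_intros comm; simp add: U_def V_def)+
    then show "a * z \<in> E \<inter> U \<inter> V" using z a addE by (simp add: U_def V_def algebra_simps)
    have "((\<lambda>t. (h t * z - z) * a) \<longlongrightarrow> 0 * a) at_infty"
      "((\<lambda>t. (z * h t - z) * a - z * (h t * a - a * h t)) \<longlongrightarrow> 0 * a - 0) at_infty"
      using z by (intro tendsto_intros comm; simp add: U_def V_def)+
    then show "z * a \<in> E \<inter> U \<inter> V" using z a addE by (simp add: U_def V_def algebra_simps)
  qed auto
  moreover have "range x \<subseteq> U \<inter> V"
  proof
    fix z assume "z \<in> range x"
    then obtain j where "z = x j" by blast
    moreover have "linear (\<lambda>a. a * x j)" "linear (\<lambda>a. x j * a)" by (rule linearI; simp add: algebra_simps)+
    ultimately show "z \<in> U \<inter> V" using lim[OF _ y(4)[of j]] lim[OF _ y(5)[of j]] by (simp add: U_def V_def)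
  qed
  then have "S' \<subseteq> U \<inter> V" using x(2) closed by (meson closed_Int closure_minimal order_trans)
  ultimately have "D \<subseteq> E \<inter> U \<inter> V"
    unfolding D_def E_def[symmetric] using S'E by (intro ideal_generated_least) auto
  moreover have "continuous_on UNIV h"
    unfolding h_def
  proof (rule continuous_on_compose2[OF p])
    show "continuous_on UNIV real_of_halfline"
      by (auto simp: continuous_on_iff dist_halfline_def)
  qed (use pos in auto)
  ultimately show ?thesis
    by (intro that[of h] hD hs hn) (use EC in \<open>auto simp: C_def U_def V_def\<close>)
qed

section \<open>Functions vanishing at infinity\<close>

text \<open>The unit makes the results on closed ideals applicable to \<open>kk_E\<close> and
  \<open>kk_D\<close>. It also serves as the empty word and as the trivial asymptotic unit.\<close>

instantiation scont :: (cstar_algebra) monoid_mult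
begin

lift_definition one_scont :: "'a scont" is "\<lambda>_. 1"
  by (auto simp: bounded_iff)

instance
  by standard (rule scont_eqI; simp add: scont_simps one_scont.rep_eq)+

end

lemmas scont_ap = scont_simps one_scont.rep_eq const_scont.rep_eq

lemma bounded_linear_apply_scont: "bounded_linear (\<lambda>F :: 'b::cstar_algebra scont. apply_scont F t)"
  by (rule bounded_linear_intro[where K = 1]) (simp_all add: scont_ap norm_scont_ge)

section \<open>The ideals \<open>Cb\<close> and \<open>C0\<close> of the strictly continuous
  functions\<close>

lemma mult_embed_mult: "m * mult_embed b = mult_embed (lmul m b)" "mult_embed b * m = mult_embed (rmul b m)"
  by (rule multiplier_eqI, simp add: mul_simps mul_mult_embed lmul_simps rmul_lmul)+

lemma bounded_linear_mult_embed: "bounded_linear (mult_embed :: 'b::cstar_algebra \<Rightarrow> 'b multiplier)"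
proof (rule bounded_linear_intro[where K = 1])
  show "norm (mult_embed b) \<le> norm b * 1" for b :: 'b
    by (rule norm_multiplier_le) (simp_all add: mul_mult_embed norm_mult_ineq)
qed (rule multiplier_eqI, simp add: mul_simps mul_mult_embed algebra_simps)+

text \<open>The lower bound tests the multiplier on \<open>star b\<close>, where the C*-identity
  yields the square of \<open>norm b\<close>.\<close>

lemma norm_mult_embed: "norm (mult_embed b) = norm b"
proof (rule antisym)
  show "norm (mult_embed b) \<le> norm b"
    by (rule norm_multiplier_le) (simp_all add: mul_mult_embed norm_mult_ineq)
  have "norm b * norm b = norm (lmul (mult_embed b) (star b))"
    by (simp add: mul_mult_embed norm_square_right[symmetric] power2_eq_square[symmetric])
  also have "\<dots> \<le> norm (mult_embed b) * norm b"
    using norm_lmul[of "mult_embed b" "star b"] by simp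
  finally show "norm b \<le> norm (mult_embed b)"
    by (cases "norm b = 0") auto
qed

lemma mult_embed_scaleC: "c *\<^sub>C mult_embed b = mult_embed (c *\<^sub>C b)"
  by (rule multiplier_eqI) (simp add: mul_simps mul_mult_embed scaleC_mult_left)

lemma mult_embed_star: "star (mult_embed b) = mult_embed (star b)"
  by (rule multiplier_eqI) (simp add: mul_simps mul_mult_embed star_mult star_star)

lemma mult_embed_linear: "mult_embed (b + c) = mult_embed b + mult_embed c"
    "mult_embed (b - c) = mult_embed b - mult_embed c" "mult_embed 0 = 0"
  using linear_add linear_diff linear_0 bounded_linear.linear[OF bounded_linear_mult_embed] by blast+

lemma dist_mult_embed: "dist (mult_embed b) (mult_embed c) = dist b c"
  by (simp add: dist_norm mult_embed_linear[symmetric] norm_mult_embed)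

lemma closed_range_mult_embed: "closed (range (mult_embed :: 'b::cstar_algebra \<Rightarrow> 'b multiplier))"
proof (rule complete_imp_closed, rule complete_isometric_image[where e = 1])
  show "complete (UNIV :: 'b set)" by (rule complete_UNIV)
qed (auto simp: bounded_linear_mult_embed norm_mult_embed)

text \<open>As \<open>mult_embed\<close> is isometric, norm continuity of \<open>F\<close> is the
  same as continuity of the underlying \<open>B\<close>-valued function, which therefore need not be
  carried along.\<close>

lemma Cb_iff: "F \<in> Cb \<longleftrightarrow> range (apply_scont F) \<subseteq> range mult_embed \<and> continuous_on UNIV (apply_scont F)"
proof
  assume "F \<in> Cb"
  then obtain f :: "halfline \<Rightarrow>\<^sub>C 'a" where f: "apply_scont F t = mult_embed (f t)" for t by (auto simp: Cb_def)
  then have "apply_scont F = (\<lambda>t. mult_embed (f t))" by auto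
  moreover have "continuous_on UNIV (\<lambda>t. mult_embed (f t))"
    by (intro bounded_linear.continuous_on[OF bounded_linear_mult_embed]) simp
  ultimately show "range (apply_scont F) \<subseteq> range mult_embed \<and> continuous_on UNIV (apply_scont F)" by auto
next
  assume *: "range (apply_scont F) \<subseteq> range mult_embed \<and> continuous_on UNIV (apply_scont F)"
  then have "\<exists>b. apply_scont F t = mult_embed b" for t by blast
  then obtain f where f: "apply_scont F t = mult_embed (f t)" for t by metis
  then have "f \<in> bcontfun"
    using * apply_scont_bounded[of F]
    by (auto simp: bcontfun_def bounded_iff norm_mult_embed continuous_on_iff dist_mult_embed)
  then have "apply_scont F t = mult_embed (Bcontfun f t)" for t by (simp add: f Bcontfun_inverse)
  then show "F \<in> Cb" by (auto simp: Cb_def)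
qed

lemma C0_iff: "F \<in> C0 \<longleftrightarrow> F \<in> Cb \<and> ((\<lambda>t. apply_scont F t) \<longlongrightarrow> 0) at_infty"
proof -
  have "((\<lambda>t. f t) \<longlongrightarrow> 0) at_infty \<longleftrightarrow> ((\<lambda>t. apply_scont F t) \<longlongrightarrow> 0) at_infty"
    if "\<forall>t. apply_scont F t = mult_embed (f t)" for f
  proof -
    have "norm (apply_scont F t) = norm (f t)" for t using that by (simp add: norm_mult_embed)
    then show ?thesis
      using tendsto_norm_zero_iff[of f at_infty] tendsto_norm_zero_iff[of "apply_scont F" at_infty] by simp
  qed
  then show ?thesis by (auto simp: C0_def Cb_def)
qed

lemma Cb_add: "F \<in> Cb \<Longrightarrow> G \<in> Cb \<Longrightarrow> F + G \<in> Cb"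
  unfolding Cb_iff image_subset_iff plus_scont.rep_eq[abs_def]
  by (auto simp: plus_scont.rep_eq intro!: continuous_on_add) (metis mult_embed_linear(1) rangeE rangeI)

lemma Cb_scaleC: "F \<in> Cb \<Longrightarrow> c *\<^sub>C F \<in> Cb"
  unfolding Cb_iff image_subset_iff
  by (auto simp: scaleC_scont.rep_eq[abs_def] intro!: bounded_linear.continuous_on[OF bounded_linear_scaleC])
    (metis mult_embed_scaleC rangeE rangeI)

lemma Cb_star: "F \<in> Cb \<Longrightarrow> star F \<in> Cb"
  unfolding Cb_iff image_subset_iff
  by (auto simp: star_scont.rep_eq[abs_def] intro!: continuous_star)
    (metis mult_embed_star rangeE rangeI)

text \<open>A bounded strictly continuous function turns norm-continuous \<open>B\<close>-valued
  functions into norm-continuous ones, by joint continuity of the action on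
  \<open>B\<close>.\<close>

lemma Cb_mult: assumes "F \<in> Cb" shows "G * F \<in> Cb" "F * G \<in> Cb"
proof -
  obtain f :: "halfline \<Rightarrow>\<^sub>C 'a" where f: "apply_scont F t = mult_embed (f t)" for t using assms by (auto simp: Cb_def)
  have "apply_scont (G * F) = (\<lambda>t. mult_embed (lmul (apply_scont G t) (f t)))"
    "apply_scont (F * G) = (\<lambda>t. mult_embed (rmul (f t) (apply_scont G t)))"
    by (auto simp: scont_ap f mult_embed_mult)
  then show "G * F \<in> Cb" "F * G \<in> Cb"
    unfolding Cb_iff by (auto intro!: bounded_linear.continuous_on[OF bounded_linear_mult_embed]
        apply_scont_lmul apply_scont_rmul)
qed

lemma Cb_zero: "0 \<in> Cb"
  unfolding Cb_iff zero_scont.rep_eq by (auto intro: range_eqI[of _ _ 0] simp: mult_embed_linear)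

lemma Cb_diff: "F \<in> Cb \<Longrightarrow> G \<in> Cb \<Longrightarrow> F - G \<in> Cb"
  using Cb_add[of F "(-1) *\<^sub>C G"] Cb_scaleC[of G "-1"] scaleC_of_real[of "-1" G] by simp

lemma closed_Cb: "closed (Cb :: 'b::cstar_algebra scont set)"
  unfolding closed_sequential_limits
proof (intro allI impI, elim conjE)
  fix X :: "nat \<Rightarrow> 'b scont" and F
  assume X: "\<forall>n. X n \<in> Cb" and lim: "X \<longlonglongrightarrow> F"
  have limt: "(\<lambda>n. apply_scont (X n) t) \<longlonglongrightarrow> apply_scont F t" for t
    by (rule bounded_linear.tendsto[OF bounded_linear_apply_scont lim])
  have "apply_scont F t \<in> range mult_embed" for t
    using X by (intro closed_sequentially[OF closed_range_mult_embed _ limt]) (auto simp: Cb_iff image_subset_iff)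
  moreover have "continuous_on UNIV (apply_scont F)"
  proof (rule uniform_limit_theorem[where F = sequentially and f = "\<lambda>n. apply_scont (X n)"])
    show "uniform_limit UNIV (\<lambda>n. apply_scont (X n)) (apply_scont F) sequentially"
    proof (rule uniform_limitI)
      fix e :: real assume "e > 0"
      then have "\<forall>\<^sub>F n in sequentially. dist (X n) F < e" using lim by (rule tendstoD[rotated])
      then show "\<forall>\<^sub>F n in sequentially. \<forall>t\<in>UNIV. dist (apply_scont (X n) t) (apply_scont F t) < e"
      proof eventually_elim
        case (elim n)
        have "dist (apply_scont (X n) t) (apply_scont F t) \<le> dist (X n) F" for t
          using norm_scont_ge[of "X n - F" t] by (simp add: dist_norm scont_ap)
        then show ?case using elim by (meson le_less_trans)
      qed
    qed
  qed (use X in \<open>auto simp: Cb_iff\<close>)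
  ultimately show "F \<in> Cb" by (auto simp: Cb_iff)
qed

lemma C0_Cb: "F \<in> C0 \<Longrightarrow> F \<in> Cb"
  by (simp add: C0_iff)

lemma C0_zero: "0 \<in> C0"
  by (simp add: C0_iff Cb_zero scont_ap)

lemma C0_add: "F \<in> C0 \<Longrightarrow> G \<in> C0 \<Longrightarrow> F + G \<in> C0"
  using tendsto_add[of "apply_scont F" 0 at_infty "apply_scont G" 0] by (simp add: C0_iff Cb_add scont_ap)

lemma C0_scaleC: "F \<in> C0 \<Longrightarrow> c *\<^sub>C F \<in> C0"
  using bounded_linear.tendsto[OF bounded_linear_scaleC, of "apply_scont F" 0 at_infty c]
  by (simp add: C0_iff Cb_scaleC scont_ap)

lemma C0_star: "F \<in> C0 \<Longrightarrow> star F \<in> C0"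
  using bounded_linear.tendsto[OF bounded_linear_star, of "apply_scont F" 0 at_infty]
  by (simp add: C0_iff Cb_star scont_ap)

lemma C0_minus: "F \<in> C0 \<Longrightarrow> - F \<in> C0"
  using C0_scaleC[of F "-1"] scaleC_of_real[of "-1" F] by simp

lemma C0_diff: "F \<in> C0 \<Longrightarrow> G \<in> C0 \<Longrightarrow> F - G \<in> C0"
  using C0_add[of F "- G"] C0_minus[of G] by simp

lemma C0_mult: assumes "F \<in> C0" shows "G * F \<in> C0" "F * G \<in> C0"
proof -
  have F: "F \<in> Cb" "(apply_scont F \<longlongrightarrow> 0) at_infty" using assms by (auto simp: C0_iff)
  have lim: "((\<lambda>t. norm G * norm (apply_scont F t)) \<longlongrightarrow> 0) at_infty"
    using F(2) by (intro tendsto_mult_right_zero tendsto_norm_zero)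
  have "norm (apply_scont G t * apply_scont F t) \<le> norm G * norm (apply_scont F t)"
    "norm (apply_scont F t * apply_scont G t) \<le> norm G * norm (apply_scont F t)" for t
    using mult_right_mono[OF norm_scont_ge[of G t], of "norm (apply_scont F t)"]
      norm_mult_ineq[of "apply_scont G t" "apply_scont F t"] norm_mult_ineq[of "apply_scont F t" "apply_scont G t"]
    by (auto simp: mult.commute)
  then show "G * F \<in> C0" "F * G \<in> C0"
    unfolding C0_iff scont_ap using Cb_mult[OF F(1)] by (auto intro: Lim_null_comparison[OF _ lim])
qed

lemma closed_C0: "closed (C0 :: 'b::cstar_algebra scont set)"
proof -
  have "closed {F :: 'b scont. ((\<lambda>t. apply_scont F t) \<longlongrightarrow> 0) at_infty}"
    by (rule closed_null_set[where K = 1]) (simp_all add: scont_ap norm_scont_ge)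
  moreover have "(C0 :: 'b scont set) = Cb \<inter> {F. ((\<lambda>t. apply_scont F t) \<longlongrightarrow> 0) at_infty}" by (auto simp: C0_iff)
  ultimately show ?thesis by (metis closed_Int closed_Cb)
qed

section \<open>Equality modulo \<open>C0\<close>\<close>

definition asymp_eq :: "'b::cstar_algebra scont \<Rightarrow> 'b scont \<Rightarrow> bool" (infix "\<simeq>" 50) where
  "F \<simeq> G \<longleftrightarrow> F - G \<in> C0"

lemma asymp_eq_refl [simp]: "F \<simeq> F"
  by (simp add: asymp_eq_def C0_zero)

lemma asymp_eq_sym: "F \<simeq> G \<Longrightarrow> G \<simeq> F"
  using C0_minus[of "F - G"] by (simp add: asymp_eq_def)

lemma asymp_eq_trans [trans]: "F \<simeq> G \<Longrightarrow> G \<simeq> H \<Longrightarrow> F \<simeq> H"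
  using C0_add[of "F - G" "G - H"] by (simp add: asymp_eq_def)

lemma asymp_eq_add: "F \<simeq> G \<Longrightarrow> F' \<simeq> G' \<Longrightarrow> F + F' \<simeq> G + G'"
  using C0_add[of "F - G" "F' - G'"] by (simp add: asymp_eq_def algebra_simps)

lemma asymp_eq_diff: "F \<simeq> G \<Longrightarrow> F' \<simeq> G' \<Longrightarrow> F - F' \<simeq> G - G'"
  using C0_diff[of "F - G" "F' - G'"] by (simp add: asymp_eq_def algebra_simps)

lemma asymp_eq_mult_left: "F \<simeq> G \<Longrightarrow> H * F \<simeq> H * G"
  using C0_mult(1)[of "F - G" H] by (simp add: asymp_eq_def algebra_simps)

lemma asymp_eq_mult_right: "F \<simeq> G \<Longrightarrow> F * H \<simeq> G * H"
  using C0_mult(2)[of "F - G" H] by (simp add: asymp_eq_def algebra_simps)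

lemma asymp_eq_C0: "F \<simeq> G \<Longrightarrow> G \<in> C0 \<Longrightarrow> F \<in> C0"
  using C0_add[of "F - G" G] by (simp add: asymp_eq_def)

section \<open>Asymptotic cycles in terms of words\<close>

text \<open>Words form a monoid without sums, adjoints or limits, so homomorphisms and diagonal sums
  act on them letter by letter. Growth on the left leaves the right end free for the difference,
  which suits inductions on \<open>w * kk_diff \<Phi> c\<close>.\<close>

inductive_set words :: "('a, 'b::cstar_algebra) kk_pair \<Rightarrow> 'b scont set" for \<Phi> where
  words_one: "1 \<in> words \<Phi>"
| words_fst: "w \<in> words \<Phi> \<Longrightarrow> fst \<Phi> a * w \<in> words \<Phi>"
| words_snd: "w \<in> words \<Phi> \<Longrightarrow> snd \<Phi> a * w \<in> words \<Phi>"

lemma words_letter: "\<phi> \<in> {fst \<Phi>, snd \<Phi>} \<Longrightarrow> w \<in> words \<Phi> \<Longrightarrow> \<phi> a * w \<in> words \<Phi>"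
  by (auto intro: words.intros)

lemma words_mult: "w \<in> words \<Phi> \<Longrightarrow> w' \<in> words \<Phi> \<Longrightarrow> w * w' \<in> words \<Phi>"
  by (induction rule: words.induct) (auto simp: mult.assoc intro: words.intros)

definition defects :: "('a::cstar_algebra \<Rightarrow> 'b::cstar_algebra scont) \<Rightarrow> 'b scont set" where
  "defects \<phi> = range (\<lambda>(a, b). \<phi> (a + b) - \<phi> a - \<phi> b) \<union> range (\<lambda>(a, b). \<phi> (a * b) - \<phi> a * \<phi> b)"

lemma defects_addI: "\<phi> (a + b) - \<phi> a - \<phi> b \<in> defects \<phi>"
  and defects_multI: "\<phi> (a * b) - \<phi> a * \<phi> b \<in> defects \<phi>"
  by (auto simp: defects_def)

abbreviation kk_diff :: "('a, 'b::cstar_algebra) kk_pair \<Rightarrow> 'a \<Rightarrow> 'b scont" where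
  "kk_diff \<Phi> a \<equiv> fst \<Phi> a - snd \<Phi> a"

section \<open>The algebra E and the ideal D of a pair\<close>

lemma kk_E_subalgebra: "cstar_subalgebra (kk_E \<Phi>)"
  unfolding kk_E_def by (rule cstar_subalgebra_generated)

lemma kk_E_letter: "\<phi> \<in> {fst \<Phi>, snd \<Phi>} \<Longrightarrow> \<phi> a \<in> kk_E \<Phi>"
  using cstar_generated_superset[of "range (fst \<Phi>) \<union> range (snd \<Phi>)"] by (auto simp: kk_E_def)

lemma kk_diff_E: "kk_diff \<Phi> a \<in> kk_E \<Phi>"
proof -
  have "fst \<Phi> a + (-1) *\<^sub>C snd \<Phi> a \<in> kk_E \<Phi>"
    using kk_E_subalgebra[of \<Phi>] kk_E_letter[of _ \<Phi> a] by (auto simp: cstar_subalgebra_def)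
  then show ?thesis using scaleC_of_real[of "-1" "snd \<Phi> a"] by simp
qed

lemma kk_D_ideal: "closed_ideal (kk_E \<Phi>) (kk_D \<Phi>)"
  unfolding kk_D_def by (intro closed_ideal_generated kk_E_subalgebra) (auto simp: kk_diff_E)

lemma kk_diff_D: "kk_diff \<Phi> a \<in> kk_D \<Phi>"
  using ideal_generated_superset[of "range (kk_diff \<Phi>)" "kk_E \<Phi>"] by (auto simp: kk_D_def)

lemma words_D: "w \<in> words \<Phi> \<Longrightarrow> x \<in> kk_D \<Phi> \<Longrightarrow> w * x \<in> kk_D \<Phi>"
proof (induction rule: words.induct)
  case words_one
  then show ?case by simp
next
  case (words_fst w a)
  then show ?case
    using kk_D_ideal[of \<Phi>] kk_E_letter[of "fst \<Phi>" \<Phi> a] by (auto simp: closed_ideal_def mult.assoc)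
next
  case (words_snd w a)
  then show ?case
    using kk_D_ideal[of \<Phi>] kk_E_letter[of "snd \<Phi>" \<Phi> a] by (auto simp: closed_ideal_def mult.assoc)
qed

text \<open>Modulo \<open>C\<^sub>0\<close> adjoints of letters are letters, so words without adjoints generate enough of \<open>E\<close>.\<close>

theorem asymptotic_cycle_iff:
  "asymptotic_cycle \<Phi> \<longleftrightarrow>
     (\<forall>\<phi>\<in>{fst \<Phi>, snd \<Phi>}. continuous_on UNIV \<phi> \<and> (\<forall>c a. \<phi> (c *\<^sub>C a) = c *\<^sub>C \<phi> a) \<and>
        (\<forall>a. \<phi> (star a) \<simeq> star (\<phi> a)) \<and>
        (\<forall>z\<in>defects \<phi>. \<forall>w\<in>words \<Phi>. \<forall>c. z * w * kk_diff \<Phi> c \<in> C0)) \<and>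
     (\<forall>c. kk_diff \<Phi> c \<in> Cb)" (is "_ \<longleftrightarrow> ?W")
proof
  assume \<Phi>: "asymptotic_cycle \<Phi>"
  have "z * w * kk_diff \<Phi> c \<in> C0" if "\<phi> \<in> {fst \<Phi>, snd \<Phi>}" "z \<in> defects \<phi>" "w \<in> words \<Phi>" for \<phi> z w c
    using \<Phi> that words_D[OF that(3) kk_diff_D, of c]
    unfolding asymptotic_cycle_def defects_def mult.assoc by fast
  then show ?W using \<Phi> kk_diff_D[of \<Phi>] unfolding asymptotic_cycle_def asymp_eq_def by blast
next
  assume W: ?W
  \<comment> \<open>The word is built into \<open>J\<close> so that left multiplication by a letter
    merely lengthens it.\<close>
  define J where "J = {x. \<forall>\<phi>\<in>{fst \<Phi>, snd \<Phi>}. \<forall>z\<in>defects \<phi>. \<forall>w\<in>words \<Phi>. z * w * x \<in> C0}"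
  have J: "z * w * x \<in> C0"
    if "x \<in> J" "\<phi> \<in> {fst \<Phi>, snd \<Phi>}" "z \<in> defects \<phi>" "w \<in> words \<Phi>" for \<phi> z w x
    using that unfolding J_def by blast
  have JI: "x \<in> J" if "\<And>\<phi> z w. \<phi> \<in> {fst \<Phi>, snd \<Phi>} \<Longrightarrow> z \<in> defects \<phi> \<Longrightarrow> w \<in> words \<Phi> \<Longrightarrow> z * w * x \<in> C0" for x
    using that unfolding J_def by blast
  have closedJ: "closed J"
    unfolding closed_sequential_limits
  proof (intro allI impI, elim conjE, rule JI)
    fix X x \<phi> z w assume X: "\<forall>n. X n \<in> J" "X \<longlonglongrightarrow> x" and *: "\<phi> \<in> {fst \<Phi>, snd \<Phi>}" "z \<in> defects \<phi>" "w \<in> words \<Phi>"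
    have "(\<lambda>n. z * w * X n) \<longlonglongrightarrow> z * w * x" using X(2) by (intro tendsto_intros)
    moreover have "z * w * X n \<in> C0" for n using X(1) J[OF _ *] by blast
    ultimately show "z * w * x \<in> C0" by (rule closed_sequentially[OF closed_C0, rotated])
  qed
  have J_add: "x + y \<in> J" if "x \<in> J" "y \<in> J" for x y
    by (rule JI) (simp only: distrib_left, intro C0_add J that)
  have J_scaleC: "c *\<^sub>C x \<in> J" if "x \<in> J" for x c
    by (rule JI) (simp only: scaleC_mult_right, intro C0_scaleC J that)
  have J_right: "x * e \<in> J" if "x \<in> J" for x e
    by (rule JI) (simp only: mult.assoc[symmetric], intro C0_mult J that)
  have J_letter: "\<phi> a * x \<in> J" if "x \<in> J" "\<phi> \<in> {fst \<Phi>, snd \<Phi>}" for x \<phi> a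
  proof (rule JI)
    fix \<psi> z w assume *: "\<psi> \<in> {fst \<Phi>, snd \<Phi>}" "z \<in> defects \<psi>" "w \<in> words \<Phi>"
    have "w * (\<phi> a * 1) \<in> words \<Phi>" by (intro words_mult words_letter that words_one *)
    then show "z * w * (\<phi> a * x) \<in> C0" using J[OF that(1) *(1,2)] by (fastforce simp: mult.assoc)
  qed
  have J_C0: "x \<in> J" if "x \<in> C0" for x
    using that by (intro JI C0_mult)
  have J_star_letter: "star (\<phi> a) * x \<in> J" if "x \<in> J" "\<phi> \<in> {fst \<Phi>, snd \<Phi>}" for x \<phi> a
  proof -
    have "star (\<phi> a) * x - \<phi> (star a) * x \<in> C0"
      using asymp_eq_mult_right[OF asymp_eq_sym, of "\<phi> (star a)" "star (\<phi> a)" x] W that(2)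
      by (auto simp: asymp_eq_def)
    then show ?thesis using J_add[OF J_C0 J_letter[OF that, of "star a"]] by fastforce
  qed
  \<comment> \<open>Requiring the condition for \<open>e\<close> and \<open>star e\<close> makes
    \<open>N\<close> closed under adjoints. Letters qualify because \<open>star (\<phi> a)\<close>
    and \<open>\<phi> (star a)\<close> differ by an element of \<open>C0\<close>, and
    \<open>C0\<close> is contained in \<open>J\<close>.\<close>
  define N where "N = {e. \<forall>x\<in>J. e * x \<in> J \<and> star e * x \<in> J}"
  have "cstar_subalgebra N"
    unfolding cstar_subalgebra_def
  proof (intro conjI ballI allI)
    show "closed N"
      unfolding closed_sequential_limits
    proof (intro allI impI, elim conjE)
      fix X e assume X: "\<forall>n. X n \<in> N" "X \<longlonglongrightarrow> e"
      have "e * x \<in> J \<and> star e * x \<in> J" if "x \<in> J" for x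
      proof -
        have "(\<lambda>n. X n * x) \<longlonglongrightarrow> e * x" "(\<lambda>n. star (X n) * x) \<longlonglongrightarrow> star e * x"
          by (intro tendsto_intros X bounded_linear.tendsto[OF bounded_linear_star])+
        moreover have m: "X n * x \<in> J" "star (X n) * x \<in> J" for n using X(1) that by (auto simp: N_def)
        ultimately show ?thesis by (metis closed_sequentially[OF closedJ])
      qed
      then show "e \<in> N" by (simp add: N_def)
    qed
  qed (auto simp: N_def J_C0 C0_zero distrib_right star_add star_mult star_star star_scaleC
      mult.assoc scaleC_mult_left J_add J_scaleC)
  moreover have "range (fst \<Phi>) \<union> range (snd \<Phi>) \<subseteq> N"
    by (auto simp: N_def J_letter J_star_letter)
  ultimately have EN: "kk_E \<Phi> \<subseteq> N" unfolding kk_E_def by (rule cstar_generated_least)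
  \<comment> \<open>One closed ideal captures both goals: membership in \<open>Cb\<close> and
    vanishing of the defects. Left multiplication by \<open>kk_E\<close> preserves \<open>J\<close>
    because \<open>kk_E\<close> lies in \<open>N\<close>.\<close>
  have "closed_ideal (kk_E \<Phi>) (kk_E \<Phi> \<inter> Cb \<inter> J)"
    using closed_ideal_self[OF kk_E_subalgebra, of \<Phi>] EN closed_Cb closedJ
    unfolding closed_ideal_def N_def
    by (auto intro: closed_Int Cb_zero J_C0 C0_zero Cb_add J_add Cb_scaleC J_scaleC Cb_mult J_right)
  moreover have "range (kk_diff \<Phi>) \<subseteq> kk_E \<Phi> \<inter> Cb \<inter> J"
    using W by (auto intro!: JI kk_diff_E)
  ultimately have D: "kk_D \<Phi> \<subseteq> kk_E \<Phi> \<inter> Cb \<inter> J" unfolding kk_D_def by (rule ideal_generated_least)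
  have "(\<phi> (a + b) - \<phi> a - \<phi> b) * x \<in> C0 \<and> (\<phi> (a * b) - \<phi> a * \<phi> b) * x \<in> C0"
    if "\<phi> \<in> {fst \<Phi>, snd \<Phi>}" "x \<in> kk_D \<Phi>" for \<phi> a b x
  proof -
    have "x \<in> J" using D that by blast
    then show ?thesis using J[OF \<open>x \<in> J\<close> that(1) _ words_one] by (auto simp: defects_def)
  qed
  then show "asymptotic_cycle \<Phi>"
    unfolding asymptotic_cycle_def using W D by (auto simp: asymp_eq_def)
qed

section \<open>Multiplying cycles by asymptotic units\<close>

definition asym_unit :: "('a::cstar_algebra, 'b::cstar_algebra) kk_pair \<Rightarrow> 'b scont \<Rightarrow> bool" where
  "asym_unit \<Phi> M \<longleftrightarrow> star M = M \<and> (\<forall>\<phi>\<in>{fst \<Phi>, snd \<Phi>}. \<forall>a. M * \<phi> a \<simeq> \<phi> a * M) \<and>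
     (\<forall>c. M * kk_diff \<Phi> c \<simeq> kk_diff \<Phi> c)"

lemma asym_unit_one: "asym_unit \<Phi> 1"
  by (simp add: asym_unit_def)

lemma asym_unit_words:
  assumes M: "asym_unit \<Phi> M" and w: "w \<in> words \<Phi>"
  shows "M * w \<simeq> w * M"
  using w
proof (induction rule: words.induct)
  have step: "M * (\<phi> a * w) \<simeq> \<phi> a * w * M" if "M * w \<simeq> w * M" "\<phi> \<in> {fst \<Phi>, snd \<Phi>}" for \<phi> a w
  proof -
    have "M * \<phi> a * w \<simeq> \<phi> a * M * w" using M that(2) by (intro asymp_eq_mult_right) (auto simp: asym_unit_def)
    also have "\<phi> a * M * w \<simeq> \<phi> a * (w * M)" unfolding mult.assoc using that(1) by (rule asymp_eq_mult_left)
    finally show ?thesis by (simp add: mult.assoc)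
  qed
  show "M * (fst \<Phi> a * w) \<simeq> fst \<Phi> a * w * M" if "M * w \<simeq> w * M" for w a using step that by auto
  show "M * (snd \<Phi> a * w) \<simeq> snd \<Phi> a * w * M" if "M * w \<simeq> w * M" for w a using step that by auto
qed simp

text \<open>\<open>M\<close> is moved past the word and then absorbed by the difference.\<close>

lemma asym_unit_words_diff:
  assumes M: "asym_unit \<Phi> M" and w: "w \<in> words \<Phi>"
  shows "M * (w * kk_diff \<Phi> c) \<simeq> w * kk_diff \<Phi> c"
proof -
  have "M * w * kk_diff \<Phi> c \<simeq> w * M * kk_diff \<Phi> c"
    by (rule asymp_eq_mult_right[OF asym_unit_words[OF assms]])
  also have "w * M * kk_diff \<Phi> c \<simeq> w * kk_diff \<Phi> c"
    unfolding mult.assoc using M by (intro asymp_eq_mult_left) (simp add: asym_unit_def)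
  finally show ?thesis by (simp add: mult.assoc)
qed

text \<open>A letter of the cut pair is \<open>M\<close> times an original letter, and each
  \<open>M\<close> is absorbed by the word and difference on its right. Deleting all factors
  \<open>M\<close> thus yields a word that serves for all \<open>c\<close> at once.\<close>

lemma kk_cut_words:
  assumes M: "asym_unit \<Phi> M" and w: "w' \<in> words (kk_cut M \<Phi>)"
  shows "\<exists>w\<in>words \<Phi>. \<forall>c. w' * kk_diff \<Phi> c \<simeq> w * kk_diff \<Phi> c"
proof -
  have step: "\<exists>w\<in>words \<Phi>. \<forall>c. M * \<phi> a * w' * kk_diff \<Phi> c \<simeq> w * kk_diff \<Phi> c"
    if ex: "\<exists>w\<in>words \<Phi>. \<forall>c. w' * kk_diff \<Phi> c \<simeq> w * kk_diff \<Phi> c" and \<phi>: "\<phi> \<in> {fst \<Phi>, snd \<Phi>}" for \<phi> a w'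
  proof -
    obtain w where w: "w \<in> words \<Phi>" "\<And>c. w' * kk_diff \<Phi> c \<simeq> w * kk_diff \<Phi> c" using ex by blast
    have pw: "\<phi> a * w \<in> words \<Phi>" by (rule words_letter[OF \<phi> w(1)])
    have "M * \<phi> a * w' * kk_diff \<Phi> c \<simeq> (\<phi> a * w) * kk_diff \<Phi> c" for c
    proof -
      have "(M * \<phi> a) * (w' * kk_diff \<Phi> c) \<simeq> (M * \<phi> a) * (w * kk_diff \<Phi> c)"
        by (rule asymp_eq_mult_left[OF w(2)])
      also have "(M * \<phi> a) * (w * kk_diff \<Phi> c) = M * ((\<phi> a * w) * kk_diff \<Phi> c)" by (simp add: mult.assoc)
      also have "\<dots> \<simeq> (\<phi> a * w) * kk_diff \<Phi> c" by (rule asym_unit_words_diff[OF M pw])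
      finally show ?thesis by (simp add: mult.assoc)
    qed
    then show ?thesis using pw by blast
  qed
  show ?thesis
    using w
  proof (induction rule: words.induct)
    case words_one
    show ?case by (intro bexI[of _ 1] words.words_one) simp
  next
    case (words_fst w a)
    show ?case using step[OF words_fst.IH, of "fst \<Phi>" a] by (simp add: kk_cut_def)
  next
    case (words_snd w a)
    show ?case using step[OF words_snd.IH, of "snd \<Phi>" a] by (simp add: kk_cut_def)
  qed
qed

text \<open>In \<open>M * \<phi> a * (M * \<phi> b) * x\<close>, with \<open>x\<close> a word times
  a difference, the inner \<open>M\<close> acts as a unit because \<open>\<phi> b * x\<close> is
  again of that kind. The defects thus reduce to \<open>M\<close> times the old ones. Adjoints are
  handled by \<open>star M = M\<close> and asymptotic commutation.\<close>

theorem asymptotic_cycle_cut: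
  assumes \<Phi>: "asymptotic_cycle \<Phi>" and M: "asym_unit \<Phi> M"
  shows "asymptotic_cycle (kk_cut M \<Phi>)"
proof -
  note W = \<Phi>[unfolded asymptotic_cycle_iff]
  have sM: "star M = M" and Mc: "\<phi> \<in> {fst \<Phi>, snd \<Phi>} \<Longrightarrow> M * \<phi> a \<simeq> \<phi> a * M"
    and Md: "M * kk_diff \<Phi> c \<simeq> kk_diff \<Phi> c" for \<phi> a c
    using M by (auto simp: asym_unit_def)
  have diff: "kk_diff (kk_cut M \<Phi>) c = M * kk_diff \<Phi> c" for c
    by (simp add: kk_cut_def right_diff_distrib)
  have main: "continuous_on UNIV (\<lambda>a. M * \<phi> a) \<and> (\<forall>c a. M * \<phi> (c *\<^sub>C a) = c *\<^sub>C (M * \<phi> a)) \<and>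
        (\<forall>a. M * \<phi> (star a) \<simeq> star (M * \<phi> a)) \<and>
        (\<forall>z\<in>defects (\<lambda>a. M * \<phi> a). \<forall>w\<in>words (kk_cut M \<Phi>). \<forall>c. z * w * kk_diff (kk_cut M \<Phi>) c \<in> C0)"
    if \<phi>: "\<phi> \<in> {fst \<Phi>, snd \<Phi>}" for \<phi>
  proof (intro conjI allI ballI)
    have cont: "continuous_on UNIV \<phi>" and hom: "\<And>c a. \<phi> (c *\<^sub>C a) = c *\<^sub>C \<phi> a"
      and st: "\<And>a. \<phi> (star a) \<simeq> star (\<phi> a)"
      and def: "\<And>z w c. z \<in> defects \<phi> \<Longrightarrow> w \<in> words \<Phi> \<Longrightarrow> z * w * kk_diff \<Phi> c \<in> C0"
      using W \<phi> by auto
    show "continuous_on UNIV (\<lambda>a. M * \<phi> a)" by (intro continuous_intros cont)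
    show "M * \<phi> (c *\<^sub>C a) = c *\<^sub>C (M * \<phi> a)" for c a by (simp add: hom scaleC_mult_right)
    show "M * \<phi> (star a) \<simeq> star (M * \<phi> a)" for a
    proof -
      have "M * \<phi> (star a) \<simeq> \<phi> (star a) * M" by (rule Mc[OF \<phi>])
      also have "\<dots> \<simeq> star (\<phi> a) * M" by (rule asymp_eq_mult_right[OF st])
      finally show ?thesis by (simp add: star_mult sM)
    qed
    fix z w' c assume z: "z \<in> defects (\<lambda>a. M * \<phi> a)" and w': "w' \<in> words (kk_cut M \<Phi>)"
    obtain w where w: "w \<in> words \<Phi>" and ww: "\<And>c. w' * kk_diff \<Phi> c \<simeq> w * kk_diff \<Phi> c"
      using kk_cut_words[OF M w'] by blast
    define x where "x = w * kk_diff \<Phi> c"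
    have Mx: "M * (v * x) \<simeq> v * x" if "v \<in> words \<Phi>" for v
      unfolding x_def using asym_unit_words_diff[OF M words_mult[OF that w]] by (simp add: mult.assoc)
    have "w' * (M * kk_diff \<Phi> c) \<simeq> w' * kk_diff \<Phi> c" by (rule asymp_eq_mult_left[OF Md])
    also have "\<dots> \<simeq> x" unfolding x_def by (rule ww)
    finally have w'x: "z * w' * kk_diff (kk_cut M \<Phi>) c \<simeq> z * x"
      unfolding diff mult.assoc by (rule asymp_eq_mult_left)
    have "z * x \<in> C0"
    proof -
      consider a b where "z = M * \<phi> (a + b) - M * \<phi> a - M * \<phi> b" | a b where "z = M * \<phi> (a * b) - M * \<phi> a * (M * \<phi> b)"
        using z by (auto simp: defects_def)
      then show ?thesis
      proof cases
        case 1
        have "z * x = M * ((\<phi> (a + b) - \<phi> a - \<phi> b) * w * kk_diff \<Phi> c)"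
          unfolding 1 x_def by (simp add: algebra_simps)
        then show ?thesis using C0_mult(1)[OF def[OF defects_addI w]] by simp
      next
        case 2
        have "\<phi> b * 1 \<in> words \<Phi>" by (rule words_letter[OF \<phi> words_one])
        then have "M * (\<phi> b * x) \<simeq> \<phi> b * x" using Mx by simp
        then have "M * \<phi> a * (M * (\<phi> b * x)) \<simeq> M * \<phi> a * (\<phi> b * x)" by (rule asymp_eq_mult_left)
        then have "z * x \<simeq> M * (\<phi> (a * b) * x) - M * \<phi> a * (\<phi> b * x)"
          unfolding 2 left_diff_distrib mult.assoc by (intro asymp_eq_diff asymp_eq_refl)
        also have "M * (\<phi> (a * b) * x) - M * \<phi> a * (\<phi> b * x) = M * ((\<phi> (a * b) - \<phi> a * \<phi> b) * w * kk_diff \<Phi> c)"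
          unfolding x_def by (simp add: algebra_simps)
        finally show ?thesis by (rule asymp_eq_C0[OF _ C0_mult(1)[OF def[OF defects_multI w]]])
      qed
    qed
    then show "z * w' * kk_diff (kk_cut M \<Phi>) c \<in> C0" by (rule asymp_eq_C0[OF w'x])
  qed
  have "kk_diff (kk_cut M \<Phi>) c \<in> Cb" for c
    unfolding diff using W by (intro Cb_mult) auto
  then show ?thesis
    unfolding asymptotic_cycle_iff using main[of "fst \<Phi>"] main[of "snd \<Phi>"]
    by (simp add: kk_cut_def)
qed

text \<open>Each \<open>u i\<close> has the form \<open>star y * y\<close>, so its value
  \<open>v\<close> at time t is self-adjoint. The limits in the definition become membership in
  \<open>C0\<close> because \<open>Cb\<close> is an ideal containing \<open>v\<close> and
  \<open>kk_D \<Phi>\<close>.\<close>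

lemma cutoff_asym_unit:
  assumes \<Phi>: "asymptotic_cycle \<Phi>" and v: "cutoff \<Phi> v" shows "asym_unit \<Phi> v" "v \<in> Cb"
proof -
  obtain u :: "halfline \<Rightarrow> 'b scont" and r where vCb: "v \<in> Cb" and u: "approximate_unit (kk_D \<Phi>) u at_infty"
    and uv: "\<And>t. apply_scont v t = apply_scont (u (r t)) t"
    using v unfolding cutoff_def by blast
  then show "v \<in> Cb" by simp
  have "star (u i) = u i" for i
    using u unfolding approximate_unit_def by (metis star_mult star_star)
  then have "star v = v"
    by (intro scont_eqI) (metis star_scont.rep_eq uv)
  moreover have "v * \<phi> a \<simeq> \<phi> a * v" if "\<phi> \<in> {fst \<Phi>, snd \<Phi>}" for \<phi> a
    using v that vCb unfolding cutoff_def asymp_eq_def C0_iff by (blast intro: Cb_diff Cb_mult)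
  moreover have "v * kk_diff \<Phi> c \<simeq> kk_diff \<Phi> c" for c
    using v vCb kk_diff_D[of \<Phi> c] \<Phi> unfolding cutoff_def asymp_eq_def C0_iff asymptotic_cycle_def
    by (blast intro: Cb_diff Cb_mult)
  ultimately show "asym_unit \<Phi> v" unfolding asym_unit_def by blast
qed

section \<open>Existence of cutoffs\<close>

lemma bounded_linear_lmul_left: "bounded_linear (\<lambda>m. lmul m b)"
  by (rule bounded_linear_intro[where K = "norm b"]) (simp_all add: mul_simps norm_lmul)

lemma bounded_linear_rmul_left: "bounded_linear (\<lambda>m. rmul b m)"
  by (rule bounded_linear_intro[where K = "norm b"]) (simp_all add: mul_simps norm_rmul)

lemma continuous_closure_image:
  assumes "continuous_on UNIV \<phi>" "closure (range a) = UNIV"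
  shows "range \<phi> \<subseteq> closure (range (\<lambda>j. \<phi> (a j)))"
  using image_closure_subset[of "range a" \<phi> "closure (range (\<lambda>j. \<phi> (a j)))"] assms
  by (auto intro: closure_subset[THEN subsetD])

text \<open>The quasicentral path of \<open>D\<close> can be evaluated on the diagonal without reparametrisation,
  because its limits are uniform in \<open>t\<close>.\<close>

lemma cutoff_exists:
  fixes \<Phi> :: "('a::cstar_algebra, 'b::cstar_algebra) kk_pair"
  assumes sep: "separable_space (euclidean :: 'a topology)" and \<Phi>: "asymptotic_cycle \<Phi>"
  obtains v where "cutoff \<Phi> v"
proof -
  obtain C :: "'a set" where C: "countable C" "closure C = UNIV"
    using sep by (auto simp: separable_space_def)
  then have "C \<noteq> {}" by auto
  define a where "a = from_nat_into C"
  have a: "closure (range a) = UNIV" using C \<open>C \<noteq> {}\<close> by (simp add: a_def range_from_nat_into)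
  have cont: "continuous_on UNIV (fst \<Phi>)" "continuous_on UNIV (snd \<Phi>)"
    using \<Phi> by (auto simp: asymptotic_cycle_def)
  define e where "e n = (if even n then fst \<Phi> (a (n div 2)) else snd \<Phi> (a (n div 2)))" for n
  have e: "fst \<Phi> (a j) \<in> range e" "snd \<Phi> (a j) \<in> range e" for j
    using rangeI[of e "2 * j"] rangeI[of e "2 * j + 1"] by (simp_all add: e_def)
  have r1: "range (fst \<Phi>) \<union> range (snd \<Phi>) \<subseteq> closure (range e)"
    using continuous_closure_image[OF cont(1) a] continuous_closure_image[OF cont(2) a]
      closure_mono[of "range (\<lambda>j. fst \<Phi> (a j))" "range e"] closure_mono[of "range (\<lambda>j. snd \<Phi> (a j))" "range e"] e
    by blast
  have r2: "range (kk_diff \<Phi>) \<subseteq> closure (range (\<lambda>j. kk_diff \<Phi> (a j)))"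
    by (intro continuous_closure_image a continuous_intros cont)
  have r3: "range (kk_diff \<Phi>) \<subseteq> cstar_generated (range (fst \<Phi>) \<union> range (snd \<Phi>))"
    using kk_diff_E[of \<Phi>] by (auto simp: kk_E_def)
  have r4: "range e \<subseteq> range (fst \<Phi>) \<union> range (snd \<Phi>)" by (auto simp: e_def)
  have r5: "range (\<lambda>j. kk_diff \<Phi> (a j)) \<subseteq> range (kk_diff \<Phi>)" by auto
  obtain h :: "halfline \<Rightarrow> 'b scont" where h: "continuous_on UNIV h" "\<And>t. h t \<in> kk_D \<Phi>"
    "\<And>t. star (h t) = h t" "\<And>t. norm (h t) \<le> 1"
    and hE: "\<And>z. z \<in> kk_E \<Phi> \<Longrightarrow> ((\<lambda>t. h t * z - z * h t) \<longlongrightarrow> 0) at_infty"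
    and hD: "\<And>z. z \<in> kk_D \<Phi> \<Longrightarrow> ((\<lambda>t. h t * z - z) \<longlongrightarrow> 0) at_infty"
    "\<And>z. z \<in> kk_D \<Phi> \<Longrightarrow> ((\<lambda>t. z * h t - z) \<longlongrightarrow> 0) at_infty"
    by (rule quasicentral_path[OF r3 r4 r1 r5 r2, folded kk_E_def, folded kk_D_def]) (rule that)
  \<comment> \<open>Squaring gives the form \<open>star y * y\<close> with y in the ideal that an
    approximate unit must have. Since \<open>h\<close> is contractive, the limits pass to the
    squares.\<close>
  define u where "u t = h t * h t" for t
  have bnd: "norm (h t * z) \<le> norm z" "norm (z * h t) \<le> norm z" for t z
  proof -
    have "norm (h t * z) \<le> 1 * norm z" "norm (z * h t) \<le> norm z * 1"
      using h(4)[of t] by (intro order_trans[OF norm_mult_ineq] mult_mono; simp)+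
    then show "norm (h t * z) \<le> norm z" "norm (z * h t) \<le> norm z" by simp_all
  qed
  have uE: "((\<lambda>t. u t * z - z * u t) \<longlongrightarrow> 0) at_infty" if "z \<in> kk_E \<Phi>" for z
  proof -
    note l = tendsto_norm_zero[OF hE[OF that]]
    have "((\<lambda>t. h t * (h t * z - z * h t) + (h t * z - z * h t) * h t) \<longlongrightarrow> 0 + 0) at_infty"
      by (intro tendsto_add Lim_null_comparison[OF _ l] always_eventually allI bnd)
    then show ?thesis by (simp add: u_def algebra_simps)
  qed
  have uD: "((\<lambda>t. u t * z - z) \<longlongrightarrow> 0) at_infty" "((\<lambda>t. z * u t - z) \<longlongrightarrow> 0) at_infty" if "z \<in> kk_D \<Phi>" for z
  proof -
    note l = tendsto_norm_zero[OF hD(1)[OF that]] tendsto_norm_zero[OF hD(2)[OF that]]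
    have "((\<lambda>t. h t * (h t * z - z) + (h t * z - z)) \<longlongrightarrow> 0 + 0) at_infty"
      by (intro tendsto_add Lim_null_comparison[OF _ l(1)] always_eventually allI bnd hD that)
    then show "((\<lambda>t. u t * z - z) \<longlongrightarrow> 0) at_infty" by (simp add: u_def algebra_simps)
    have "((\<lambda>t. (z * h t - z) * h t + (z * h t - z)) \<longlongrightarrow> 0 + 0) at_infty"
      by (intro tendsto_add Lim_null_comparison[OF _ l(2)] always_eventually allI bnd hD that)
    then show "((\<lambda>t. z * u t - z) \<longlongrightarrow> 0) at_infty" by (simp add: u_def algebra_simps)
  qed
  have u_cont: "continuous_on UNIV u" unfolding u_def by (intro continuous_intros h)
  have u_norm: "norm (u t) \<le> 1" for t
    unfolding u_def using bnd(1)[of t "h t"] h(4)[of t] by simp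
  have u_Cb: "u t \<in> Cb" for t
    unfolding u_def using h(2)[of t] \<Phi> by (intro Cb_mult) (auto simp: asymptotic_cycle_def)
  define V where "V t = apply_scont (u t) t" for t
  \<comment> \<open>Moving the index of \<open>u\<close> changes the function uniformly little, and
    the fixed function \<open>u t0\<close> is norm continuous in its argument because it lies in
    \<open>Cb\<close>.\<close>
  have V_cont: "continuous_on UNIV V"
    unfolding continuous_on_def
  proof
    fix t0
    have "((\<lambda>t. norm (u t - u t0)) \<longlongrightarrow> 0) (at t0)"
      using u_cont by (simp add: continuous_on_def LIM_zero tendsto_norm_zero)
    then have "((\<lambda>t. apply_scont (u t - u t0) t) \<longlongrightarrow> 0) (at t0)"
      by (rule Lim_null_comparison[rotated]) (simp add: norm_scont_ge)
    moreover have "((\<lambda>t. apply_scont (u t0) t) \<longlongrightarrow> apply_scont (u t0) t0) (at t0)"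
      using u_Cb[of t0] by (simp add: Cb_iff continuous_on_def)
    ultimately have "((\<lambda>t. apply_scont (u t - u t0) t + apply_scont (u t0) t) \<longlongrightarrow> 0 + apply_scont (u t0) t0) (at t0)"
      by (rule tendsto_add)
    then show "(V \<longlongrightarrow> V t0) (at t0)" by (simp add: V_def[abs_def] scont_ap)
  qed
  have V_range: "V t \<in> range mult_embed" for t using u_Cb[of t] by (auto simp: V_def Cb_iff)
  have "norm (V t) \<le> 1" for t using norm_scont_ge[of "u t" t] u_norm[of t] by (simp add: V_def)
  then have "bounded (range V)" by (rule bounded_range_normI)
  then have ap_V: "apply_scont (Scont V) = V"
    using V_cont by (intro Scont_inverse) (auto intro!: bounded_linear.continuous_on[OF bounded_linear_lmul_left]
        bounded_linear.continuous_on[OF bounded_linear_rmul_left])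
  have diag: "((\<lambda>t. apply_scont (X t) t) \<longlongrightarrow> 0) at_infty" if "(X \<longlongrightarrow> 0) at_infty" for X :: "halfline \<Rightarrow> 'b scont"
    by (rule Lim_null_comparison[OF _ tendsto_norm_zero[OF that]]) (simp add: norm_scont_ge)
  have "cutoff \<Phi> (Scont V)"
    unfolding cutoff_def
  proof (intro conjI ballI allI exI[of _ u] exI[of _ id])
    show "Scont V \<in> Cb" using V_cont V_range by (auto simp: Cb_iff ap_V)
    show "approximate_unit (kk_D \<Phi>) u at_infty"
      unfolding approximate_unit_def
    proof (intro conjI allI ballI)
      show "\<exists>y\<in>kk_D \<Phi>. u t = star y * y" for t by (rule bexI[of _ "h t"]) (simp_all add: u_def h)
    qed (use u_norm uD in \<open>auto simp: LIM_zero_iff\<close>)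
    show "quasicentral (kk_E \<Phi>) u at_infty" using uE by (simp add: quasicentral_def)
    show "homeomorphism UNIV UNIV id (id :: halfline \<Rightarrow> halfline)" by (simp add: homeomorphism_def id_def)
    show "strict_mono (id :: halfline \<Rightarrow> halfline)" by (simp add: strict_mono_def)
    show "apply_scont (Scont V) t = apply_scont (u (id t)) t" for t by (simp add: ap_V V_def)
    show "((\<lambda>t. apply_scont (Scont V * \<phi> a - \<phi> a * Scont V) t) \<longlongrightarrow> 0) at_infty" if "\<phi> \<in> {fst \<Phi>, snd \<Phi>}" for \<phi> a
      using diag[OF uE[OF kk_E_letter[OF that, of a]]] by (simp add: scont_ap ap_V V_def)
    show "((\<lambda>t. apply_scont (Scont V * x - x) t) \<longlongrightarrow> 0) at_infty" if "x \<in> kk_D \<Phi>" for x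
      using diag[OF uD(1)[OF that]] by (simp add: scont_ap ap_V V_def)
  qed
  then show ?thesis by (rule that)
qed

section \<open>Multipliers of the path algebra as strictly continuous families\<close>

text \<open>Up to a function \<open>g\<close> vanishing at \<open>s\<close>, \<open>f\<close> is the
  constant function with value f(s). Left multiplication of \<open>lmul m g\<close> by a constant
  \<open>c\<close> shifts the multiplier onto \<open>c\<close> and leaves the factor g(s) = 0, so
  the value at \<open>s\<close> is annihilated by every \<open>c\<close> and vanishes.\<close>

lemma ev_multiplier_lmul: "apply_bcontfun (lmul m f) s = lmul (ev_multiplier s m) (apply_bcontfun f s)"
proof -
  define g where "g = f - const_bcontfun (apply_bcontfun f s)"
  have g: "apply_bcontfun g s = 0" by (simp add: g_def)
  have "c * apply_bcontfun (lmul m g) s = 0" for c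
    using arg_cong[OF rmul_lmul[of "const_bcontfun c" m g], of "\<lambda>f. apply_bcontfun f s"]
    by (simp add: bcontfun_cstar_simps g)
  then have "apply_bcontfun (lmul m g) s = 0" using cmult_eqI'[of "apply_bcontfun (lmul m g) s" 0] by simp
  then show "apply_bcontfun (lmul m f) s = lmul (ev_multiplier s m) (apply_bcontfun f s)"
    by (simp add: g_def linear_diff[OF bounded_linear.linear[OF bounded_linear_lmul]] ev_multiplier(1))
qed

lemma ev_multiplier_hom:
  "ev_multiplier s (m + n) = ev_multiplier s m + ev_multiplier s n"
  "ev_multiplier s (m - n) = ev_multiplier s m - ev_multiplier s n"
  "ev_multiplier s (m * n) = ev_multiplier s m * ev_multiplier s n"
  "ev_multiplier s (c *\<^sub>C m) = c *\<^sub>C ev_multiplier s m"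
  "ev_multiplier s (r *\<^sub>R m) = r *\<^sub>R ev_multiplier s m"
  "ev_multiplier s (star m) = star (ev_multiplier s m)"
  "ev_multiplier s 0 = 0" "ev_multiplier s 1 = 1"
  "ev_multiplier s (mult_embed f) = mult_embed (apply_bcontfun f s)"
proof -
  have "const_bcontfun (star b) = star (const_bcontfun b :: 'a path_algebra)" for b :: 'a
    by (rule bcontfun_eqI) (simp add: bcontfun_cstar_simps)
  then show "ev_multiplier s (star m) = star (ev_multiplier s m)"
    by (intro multiplier_eqI) (simp add: ev_multiplier mul_simps bcontfun_cstar_simps)
  have one: "lmul 1 b = b" for b :: "'c::cstar_algebra"
    unfolding one_multiplier_def by (subst mk_multiplier) simp_all
  show "ev_multiplier s 1 = 1" by (rule multiplier_eqI) (simp add: ev_multiplier one)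
qed (rule multiplier_eqI, subst ev_multiplier(1),
    simp add: mul_simps mul_mult_embed bcontfun_cstar_simps ev_multiplier_lmul)+

lemma norm_ev_multiplier: "norm (ev_multiplier s m) \<le> norm m"
proof (rule norm_multiplier_le)
  fix b :: 'a
  have "norm (lmul (ev_multiplier s m) b) \<le> norm (lmul m (const_bcontfun b))"
    by (simp add: ev_multiplier norm_bounded)
  also have "\<dots> \<le> norm m * norm (const_bcontfun b :: 'a path_algebra)" by (rule norm_lmul)
  also have "\<dots> \<le> norm m * norm b" by (intro mult_left_mono norm_const_bcontfun_le) simp
  finally show "norm (lmul (ev_multiplier s m) b) \<le> norm m * norm b" .
qed simp

lemma path_multiplier_eqI: "(\<And>s. ev_multiplier s m = ev_multiplier s n) \<Longrightarrow> m = n"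
  by (intro multiplier_eqI bcontfun_eqI) (simp add: ev_multiplier_lmul)

lemma norm_path_multiplier_le:
  assumes "\<And>s. norm (ev_multiplier s m) \<le> c" shows "norm m \<le> c"
proof (rule norm_multiplier_le)
  show "0 \<le> c" using assms[of undefined] norm_ge_zero order_trans by blast
  fix f
  have "norm (apply_bcontfun (lmul m f) s) \<le> c * norm f" for s
    unfolding ev_multiplier_lmul using assms[of s] \<open>0 \<le> c\<close>
    by (intro order_trans[OF norm_lmul] mult_mono norm_bounded) auto
  then show "norm (lmul m f) \<le> c * norm f" by (rule norm_bound)
qed

text \<open>The two-variable picture of a function with values in the multipliers of IB. It reduces
  algebraic identities to pointwise ones, and its possible values are exactly the families singled
  out by \<open>strict_family\<close>.\<close>

definition family :: "'b::cstar_algebra path_algebra scont \<Rightarrow> halfline \<Rightarrow> unit_interval \<Rightarrow> 'b multiplier" where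
  "family F t s = ev_multiplier s (apply_scont F t)"

lemma apply_ev_scont: "apply_scont (ev_scont s F) t = family F t s"
  by (simp add: family_def ev_scont.rep_eq)

lemma path_scont_eqI: "(\<And>t s. family F t s = family G t s) \<Longrightarrow> F = G"
  by (intro scont_eqI path_multiplier_eqI) (simp add: family_def)

lemma family_simps:
  "family (F + G) t s = family F t s + family G t s" "family (F - G) t s = family F t s - family G t s"
  "family (F * G) t s = family F t s * family G t s" "family (c *\<^sub>C F) t s = c *\<^sub>C family F t s"
  "family (star F) t s = star (family F t s)" "family 1 t s = 1" "family 0 t s = 0"
  by (simp_all add: family_def scont_ap ev_multiplier_hom)

lemma norm_family: "norm (family F t s) \<le> norm (apply_scont F t)"
  by (simp add: family_def norm_ev_multiplier)

lemma norm_path_scont_le: "(\<And>s. norm (family F t s) \<le> c) \<Longrightarrow> norm (apply_scont F t) \<le> c"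
  by (rule norm_path_multiplier_le) (simp add: family_def)

section \<open>Joint continuity in time and path parameter\<close>

lemma compact_unit_interval: "compact (UNIV :: unit_interval set)"
proof -
  have "continuous_on {0..1} unit_of_real"
    by (auto simp: continuous_on_iff dist_unit_interval_def unit_of_real_inverse)
  then have "compact (unit_of_real ` {0..1})" by (intro compact_continuous_image) simp_all
  moreover have "unit_of_real ` {0..1} = UNIV"
    using real_of_unit real_of_unit_inverse by (metis surj_def image_eqI UNIV_eq_I)
  ultimately show ?thesis by simp
qed

lemma continuous_on_eval:
  fixes g :: "'t::topological_space \<Rightarrow> 's::metric_space \<Rightarrow>\<^sub>C 'b::real_normed_vector"
  assumes "continuous_on UNIV g"
  shows "continuous_on UNIV (\<lambda>(t, s). apply_bcontfun (g t) s)"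
  unfolding continuous_on_def
proof
  fix p :: "'t \<times> 's"
  obtain t0 s0 where p: "p = (t0, s0)" by fastforce
  have "continuous_on UNIV (\<lambda>p :: 't \<times> 's. g (fst p))"
    by (rule continuous_on_compose2[OF assms]) (auto intro: continuous_intros)
  then have "((\<lambda>p. norm (g (fst p) - g t0)) \<longlongrightarrow> 0) (at p)"
    unfolding continuous_on_def by (simp add: p LIM_zero tendsto_norm_zero)
  then have "((\<lambda>p. apply_bcontfun (g (fst p) - g t0) (snd p)) \<longlongrightarrow> 0) (at p)"
    by (rule Lim_null_comparison[rotated]) (simp add: norm_bounded del: minus_bcontfun.rep_eq)
  moreover have "continuous_on UNIV (\<lambda>p :: 't \<times> 's. apply_bcontfun (g t0) (snd p))"
    by (rule continuous_on_compose2[OF continuous_on_apply_bcontfun]) (auto intro: continuous_intros)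
  then have "((\<lambda>p. apply_bcontfun (g t0) (snd p)) \<longlongrightarrow> apply_bcontfun (g t0) s0) (at p)"
    unfolding continuous_on_def by (auto simp: p)
  ultimately have "((\<lambda>p. apply_bcontfun (g (fst p) - g t0) (snd p) + apply_bcontfun (g t0) (snd p)) \<longlongrightarrow> 0 + apply_bcontfun (g t0) s0) (at p)"
    by (rule tendsto_add)
  then show "((\<lambda>(t, s). apply_bcontfun (g t) s) \<longlongrightarrow> (case p of (t, s) \<Rightarrow> apply_bcontfun (g t) s)) (at p)"
    by (simp add: p case_prod_unfold)
qed

text \<open>Compactness of the interval makes joint continuity at \<open>t0\<close> uniform in s,
  which is continuity in the supremum norm. Together with \<open>continuous_on_eval\<close> this is
  the exponential law.\<close>

lemma continuous_on_curry:
  fixes K :: "halfline \<Rightarrow> unit_interval \<Rightarrow> 'b::real_normed_vector"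
  assumes K: "continuous_on UNIV (\<lambda>(t, s). K t s)" and G: "\<And>t s. apply_bcontfun (G t) s = K t s"
  shows "continuous_on UNIV G"
  unfolding continuous_on_iff
proof (intro ballI allI impI)
  fix t0 :: halfline and e :: real assume "e > 0"
  have "continuous_on (UNIV \<times> UNIV) (\<lambda>(t, s). K t s)" using K by simp
  then obtain U where U: "t0 \<in> U" "open U" "\<forall>t\<in>U \<inter> UNIV. \<forall>s\<in>UNIV. dist (K t s) (K t0 s) \<le> e / 2"
    using continuous_on_prod_compactE[of UNIV UNIV "\<lambda>(t, s). K t s" t0 "e / 2"] compact_unit_interval \<open>e > 0\<close>
    by (metis UNIV_I half_gt_zero old.prod.case)
  then obtain d where d: "d > 0" "\<And>t. dist t t0 < d \<Longrightarrow> t \<in> U"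
    using openE[of U t0] by (auto simp: ball_def dist_commute subset_iff)
  have "dist (G t) (G t0) < e" if "dist t t0 < d" for t
  proof -
    have "dist (G t) (G t0) \<le> e / 2"
      using U(3) d(2)[OF that] by (intro dist_bound) (simp add: G)
    then show ?thesis using \<open>e > 0\<close> by simp
  qed
  then show "\<exists>d>0. \<forall>t\<in>UNIV. dist t t0 < d \<longrightarrow> dist (G t) (G t0) < e" using d(1) by blast
qed

lemma continuous_on_strict_lmul:
  fixes F :: "'p::topological_space \<Rightarrow> 'b::cstar_algebra multiplier"
  assumes C: "\<And>p. norm (F p) \<le> C" and F: "\<And>b. continuous_on S (\<lambda>p. lmul (F p) b)"
    and g: "continuous_on S g"
  shows "continuous_on S (\<lambda>p. lmul (F p) (g p))"
  unfolding continuous_on_def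
proof
  fix p0 assume "p0 \<in> S"
  have "((\<lambda>p. lmul (F p) (g p - g p0)) \<longlongrightarrow> 0) (at p0 within S)"
  proof (rule Lim_null_comparison)
    show "\<forall>\<^sub>F p in at p0 within S. norm (lmul (F p) (g p - g p0)) \<le> C * norm (g p - g p0)"
      by (intro always_eventually allI order_trans[OF norm_lmul] mult_right_mono C) auto
    have "((\<lambda>p. norm (g p - g p0)) \<longlongrightarrow> 0) (at p0 within S)"
      using g \<open>p0 \<in> S\<close> by (simp add: continuous_on_def LIM_zero tendsto_norm_zero)
    then show "((\<lambda>p. C * norm (g p - g p0)) \<longlongrightarrow> 0) (at p0 within S)" by (rule tendsto_mult_right_zero)
  qed
  moreover have "((\<lambda>p. lmul (F p) (g p0)) \<longlongrightarrow> lmul (F p0) (g p0)) (at p0 within S)"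
    using F \<open>p0 \<in> S\<close> by (simp add: continuous_on_def)
  ultimately have "((\<lambda>p. lmul (F p) (g p - g p0) + lmul (F p) (g p0)) \<longlongrightarrow> 0 + lmul (F p0) (g p0)) (at p0 within S)"
    by (rule tendsto_add)
  then show "((\<lambda>p. lmul (F p) (g p)) \<longlongrightarrow> lmul (F p0) (g p0)) (at p0 within S)"
    by (simp add: linear_diff[OF bounded_linear.linear[OF bounded_linear_lmul]])
qed

lemma continuous_on_strict_rmul:
  fixes F :: "'p::topological_space \<Rightarrow> 'b::cstar_algebra multiplier"
  assumes C: "\<And>p. norm (F p) \<le> C" and F: "\<And>b. continuous_on S (\<lambda>p. rmul b (F p))"
    and g: "continuous_on S g"
  shows "continuous_on S (\<lambda>p. rmul (g p) (F p))"
  unfolding rmul_via_star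
  by (rule continuous_star, rule continuous_on_strict_lmul[where C = C])
    (simp_all add: C mul_star continuous_star F g)

text \<open>Continuity is imposed jointly because, over a compact interval, this amounts to
  continuity in t uniformly in s after applying the family to \<open>b\<close>.\<close>

definition strict_family :: "(halfline \<Rightarrow> unit_interval \<Rightarrow> 'b::cstar_algebra multiplier) \<Rightarrow> bool" where
  "strict_family G \<longleftrightarrow> (\<exists>C. \<forall>t s. norm (G t s) \<le> C) \<and>
     (\<forall>b. continuous_on UNIV (\<lambda>(t, s). lmul (G t s) b) \<and> continuous_on UNIV (\<lambda>(t, s). rmul b (G t s)))"

lemma strict_family_family: "strict_family (family F)"
  unfolding strict_family_def
proof (intro conjI allI)
  show "\<exists>C. \<forall>t s. norm (family F t s) \<le> C"
    by (intro exI[of _ "norm F"] allI order_trans[OF norm_family norm_scont_ge])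
  fix b
  have "continuous_on UNIV (\<lambda>(t, s). apply_bcontfun (lmul (apply_scont F t) (const_bcontfun b)) s)"
    "continuous_on UNIV (\<lambda>(t, s). apply_bcontfun (rmul (const_bcontfun b) (apply_scont F t)) s)"
    by (intro continuous_on_eval apply_scont_lmul apply_scont_rmul continuous_on_const)+
  then show "continuous_on UNIV (\<lambda>(t, s). lmul (family F t s) b)" "continuous_on UNIV (\<lambda>(t, s). rmul b (family F t s))"
    by (simp_all add: family_def ev_multiplier)
qed

text \<open>The family acts pointwise in s as a double centralizer of IB. Joint continuity enters
  twice: it makes the result a continuous path, and by compactness it makes the action strictly
  continuous in t.\<close>

lemma strict_family_realize:
  assumes "strict_family G"
  obtains F where "\<And>t s. family F t s = G t s"
proof -
  obtain C where C: "\<And>t s. norm (G t s) \<le> C" using assms by (auto simp: strict_family_def)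
  have "0 \<le> C" using C norm_ge_zero order_trans by blast
  define H where "H p = G (fst p) (snd p)" for p
  have H: "norm (H p) \<le> C" "continuous_on UNIV (\<lambda>p. lmul (H p) b)" "continuous_on UNIV (\<lambda>p. rmul b (H p))" for p b
    using assms C by (auto simp: strict_family_def H_def case_prod_unfold)
  have cL: "continuous_on UNIV (\<lambda>(t, s). lmul (G t s) (apply_bcontfun f s))"
    and cR: "continuous_on UNIV (\<lambda>(t, s). rmul (apply_bcontfun f s) (G t s))" for f
  proof -
    have "continuous_on UNIV (\<lambda>p :: halfline \<times> unit_interval. apply_bcontfun f (snd p))"
      by (rule continuous_on_compose2[OF continuous_on_apply_bcontfun]) (auto intro: continuous_intros)
    then show "continuous_on UNIV (\<lambda>(t, s). lmul (G t s) (apply_bcontfun f s))"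
      "continuous_on UNIV (\<lambda>(t, s). rmul (apply_bcontfun f s) (G t s))"
      using continuous_on_strict_lmul[OF H(1,2)] continuous_on_strict_rmul[OF H(1,3)]
      by (simp_all add: H_def case_prod_unfold)
  qed
  have bd: "norm (lmul (G t s) (apply_bcontfun f s)) \<le> C * norm f"
    "norm (rmul (apply_bcontfun f s) (G t s)) \<le> C * norm f" for t s f
    using C[of t s] \<open>0 \<le> C\<close>
    by (auto intro!: order_trans[OF norm_lmul] order_trans[OF norm_rmul] mult_mono norm_bounded)
  have slice: "continuous_on UNIV (k t)" if "continuous_on UNIV (\<lambda>(t, s). k t s)" for k :: "halfline \<Rightarrow> unit_interval \<Rightarrow> 'a" and t
    using continuous_on_compose2[OF that continuous_on_Pair[OF continuous_on_const continuous_on_id], of t UNIV] by simp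
  define L where "L t f = Bcontfun (\<lambda>s. lmul (G t s) (apply_bcontfun f s))" for t f
  define R where "R t f = Bcontfun (\<lambda>s. rmul (apply_bcontfun f s) (G t s))" for t f
  have L: "apply_bcontfun (L t f) s = lmul (G t s) (apply_bcontfun f s)" for t f s
    by (simp add: L_def Bcontfun_inverse[OF bcontfun_normI[OF slice[OF cL] bd(1)]])
  have R: "apply_bcontfun (R t f) s = rmul (apply_bcontfun f s) (G t s)" for t f s
    by (simp add: R_def Bcontfun_inverse[OF bcontfun_normI[OF slice[OF cR] bd(2)]])
  note lin = linear_add[OF bounded_linear.linear] linear_scale[OF bounded_linear.linear]
  have ax: "L t (c *\<^sub>C f) = c *\<^sub>C L t f" "R t (c *\<^sub>C f) = c *\<^sub>C R t f"
    "L t (f * g) = L t f * g" "R t (f * g) = f * R t g" "R t f * g = f * L t g" for t c f g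
    by (rule bcontfun_eqI, simp add: L R bcontfun_cstar_simps lmul_simps rmul_lmul)+
  have bL: "bounded_linear (L t)" for t
  proof (rule bounded_linear_intro[where K = C])
    show "norm (L t f) \<le> norm f * C" for f by (rule norm_bound) (simp add: L bd mult.commute)
  qed (rule bcontfun_eqI, simp add: L lin[OF bounded_linear_lmul])+
  have bR: "bounded_linear (R t)" for t
  proof (rule bounded_linear_intro[where K = C])
    show "norm (R t f) \<le> norm f * C" for f by (rule norm_bound) (simp add: R bd mult.commute)
  qed (rule bcontfun_eqI, simp add: R lin[OF bounded_linear_rmul])+
  have mk: "lmul (mk_multiplier (L t) (R t)) f = L t f" "rmul f (mk_multiplier (L t) (R t)) = R t f" for t f
    by (rule mk_multiplier[OF bL bR ax])+
  have "norm (mk_multiplier (L t) (R t)) \<le> C" for t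
    using \<open>0 \<le> C\<close> by (intro norm_multiplier_le norm_bound) (simp_all add: mk L bd)
  then have "bounded (range (\<lambda>t. mk_multiplier (L t) (R t)))" by (rule bounded_range_normI)
  then have "apply_scont (Scont (\<lambda>t. mk_multiplier (L t) (R t))) t = mk_multiplier (L t) (R t)" for t
    using continuous_on_curry[OF cL L] continuous_on_curry[OF cR R]
    by (intro fun_cong[OF Scont_inverse]) (simp add: mk)
  then have "family (Scont (\<lambda>t. mk_multiplier (L t) (R t))) t s = G t s" for t s
    by (intro multiplier_eqI) (simp add: family_def ev_multiplier(1) mk L)
  then show ?thesis by (rule that)
qed

text \<open>The exponential law for norm-continuous functions, transported through the isometric
  embedding of \<open>B\<close>.\<close>

lemma path_Cb_iff:
  "F \<in> Cb \<longleftrightarrow> (\<forall>t s. family F t s \<in> range mult_embed) \<and> continuous_on UNIV (\<lambda>(t, s). family F t s)"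
proof
  assume "F \<in> Cb"
  then obtain f :: "halfline \<Rightarrow>\<^sub>C 'a path_algebra" where f: "apply_scont F t = mult_embed (f t)" for t
    by (auto simp: Cb_def)
  have eq: "family F t s = mult_embed (apply_bcontfun (f t) s)" for t s by (simp add: family_def f ev_multiplier_hom)
  have "continuous_on UNIV (\<lambda>(t, s). apply_bcontfun (apply_bcontfun f t) s)"
    by (intro continuous_on_eval) simp
  then show "(\<forall>t s. family F t s \<in> range mult_embed) \<and> continuous_on UNIV (\<lambda>(t, s). family F t s)"
    using bounded_linear.continuous_on[OF bounded_linear_mult_embed] by (auto simp: eq case_prod_unfold)
next
  assume *: "(\<forall>t s. family F t s \<in> range mult_embed) \<and> continuous_on UNIV (\<lambda>(t, s). family F t s)"
  then have "\<exists>b. family F t s = mult_embed b" for t s by blast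
  then obtain k where k: "family F t s = mult_embed (k t s)" for t s by metis
  have kc: "continuous_on UNIV (\<lambda>(t, s). k t s)"
    using * by (simp add: continuous_on_iff k case_prod_unfold dist_mult_embed)
  have kt: "continuous_on UNIV (k t)" for t
    using continuous_on_compose2[OF kc continuous_on_Pair[OF continuous_on_const continuous_on_id], of t UNIV] by simp
  have kb: "norm (k t s) \<le> norm F" for t s
    using order_trans[OF norm_family norm_scont_ge, of F t s] by (simp add: k norm_mult_embed)
  have ap: "apply_bcontfun (Bcontfun (k t)) s = k t s" for t s
    by (simp add: Bcontfun_inverse[OF bcontfun_normI[OF kt kb]])
  have F: "apply_scont F t = mult_embed (Bcontfun (k t))" for t
    by (rule path_multiplier_eqI) (simp add: ev_multiplier_hom ap k[symmetric, unfolded family_def])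
  have "continuous_on UNIV (\<lambda>t. Bcontfun (k t))" by (rule continuous_on_curry[OF kc ap])
  then have "continuous_on UNIV (apply_scont F)"
    using bounded_linear.continuous_on[OF bounded_linear_mult_embed] by (simp add: F[abs_def])
  then show "F \<in> Cb" using F by (auto simp: Cb_iff)
qed

section \<open>Homomorphisms acting on cycles\<close>

definition kk_map :: "('b::cstar_algebra scont \<Rightarrow> 'c::cstar_algebra scont) \<Rightarrow> ('a, 'b) kk_pair \<Rightarrow> ('a, 'c) kk_pair" where
  "kk_map T \<Phi> = (\<lambda>a. T (fst \<Phi> a), \<lambda>a. T (snd \<Phi> a))"

text \<open>\<open>kk_cycle False\<close> and \<open>kk_cycle True\<close> are the cycles of \<open>EL\<close> and \<open>EM\<close>.\<close>

definition kk_cycle :: "bool \<Rightarrow> ('a::cstar_algebra, 'b::cstar_algebra) kk_pair \<Rightarrow> bool" where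
  "kk_cycle k \<Phi> \<longleftrightarrow> asymptotic_cycle \<Phi> \<and> (k \<longrightarrow> (\<forall>a. fst \<Phi> a \<in> Cb \<and> snd \<Phi> a \<in> Cb))"

lemma kk_cycle_cut:
  assumes "asymptotic_cycle \<Phi>" "asym_unit \<Phi> M"
    and "k \<Longrightarrow> M \<in> Cb \<or> (\<forall>a. fst \<Phi> a \<in> Cb \<and> snd \<Phi> a \<in> Cb)"
  shows "kk_cycle k (kk_cut M \<Phi>)"
  using assms asymptotic_cycle_cut[OF assms(1,2)] by (auto simp: kk_cycle_def kk_cut_def intro: Cb_mult)

text \<open>The conditions in \<open>asymptotic_cycle_iff\<close> are algebraic modulo
  \<open>C0\<close>, apart from continuity and membership in \<open>Cb\<close>, so unital star
  homomorphisms preserving both ideals transport cycles. Evaluations, constant paths and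
  reparametrisations are the instances; unitality accounts for the empty word.\<close>

locale cycle_hom =
  fixes T :: "'b::cstar_algebra scont \<Rightarrow> 'c::cstar_algebra scont"
  assumes add: "T (F + G) = T F + T G" and mult: "T (F * G) = T F * T G"
    and scaleC: "T (c *\<^sub>C F) = c *\<^sub>C T F" and star: "T (star F) = star (T F)" and one: "T 1 = 1"
    and norm_le: "norm (T F) \<le> norm F" and Cb: "F \<in> Cb \<Longrightarrow> T F \<in> Cb" and C0: "F \<in> C0 \<Longrightarrow> T F \<in> C0"
begin

lemma diff: "T (F - G) = T F - T G"
  using add[of "F - G" G] by simp

lemma bounded_linear: "bounded_linear T"
proof (rule bounded_linear_intro[where K = 1])
  show "T (r *\<^sub>R F) = r *\<^sub>R T F" for r F
    using scaleC[of "complex_of_real r" F] by (simp add: scaleC_of_real)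
qed (simp_all add: add norm_le)

lemma asymp_eq: "F \<simeq> G \<Longrightarrow> T F \<simeq> T G"
  using C0[of "F - G"] by (simp add: asymp_eq_def diff)

lemma words_map: "w \<in> words (kk_map T \<Phi>) \<Longrightarrow> \<exists>v\<in>words \<Phi>. w = T v"
proof (induction rule: words.induct)
  case words_one
  show ?case using words.words_one one by metis
next
  case (words_fst w a)
  then show ?case by (auto simp: kk_map_def mult[symmetric] intro: words.words_fst)
next
  case (words_snd w a)
  then show ?case by (auto simp: kk_map_def mult[symmetric] intro: words.words_snd)
qed

lemma defects_map: "z \<in> defects (\<lambda>a. T (\<phi> a)) \<Longrightarrow> \<exists>y\<in>defects \<phi>. z = T y"
  by (auto simp: defects_def diff[symmetric] mult[symmetric])

lemma asymptotic_cycle_map: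
  assumes "asymptotic_cycle \<Phi>" shows "asymptotic_cycle (kk_map T \<Phi>)"
proof -
  note W = assms[unfolded asymptotic_cycle_iff]
  have diff_map: "kk_diff (kk_map T \<Phi>) c = T (kk_diff \<Phi> c)" for c by (simp add: kk_map_def diff)
  have "continuous_on UNIV (\<lambda>a. T (\<phi> a)) \<and> (\<forall>c a. T (\<phi> (c *\<^sub>C a)) = c *\<^sub>C T (\<phi> a)) \<and>
        (\<forall>a. T (\<phi> (star a)) \<simeq> star (T (\<phi> a))) \<and>
        (\<forall>z\<in>defects (\<lambda>a. T (\<phi> a)). \<forall>w\<in>words (kk_map T \<Phi>). \<forall>c. z * w * kk_diff (kk_map T \<Phi>) c \<in> C0)"
    if \<phi>: "\<phi> \<in> {fst \<Phi>, snd \<Phi>}" for \<phi>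
  proof (intro conjI allI ballI)
    show "continuous_on UNIV (\<lambda>a. T (\<phi> a))"
      using W \<phi> by (intro bounded_linear.continuous_on[OF bounded_linear]) blast
    show "T (\<phi> (c *\<^sub>C a)) = c *\<^sub>C T (\<phi> a)" for c a using W \<phi> by (metis scaleC)
    show "T (\<phi> (star a)) \<simeq> star (T (\<phi> a))" for a
      unfolding star[symmetric] using W \<phi> by (intro asymp_eq) blast
    fix z w c assume "z \<in> defects (\<lambda>a. T (\<phi> a))" "w \<in> words (kk_map T \<Phi>)"
    then obtain y v where "y \<in> defects \<phi>" "v \<in> words \<Phi>" "z = T y" "w = T v"
      using defects_map words_map by metis
    moreover from this have "y * v * kk_diff \<Phi> c \<in> C0" using W \<phi> by blast
    ultimately show "z * w * kk_diff (kk_map T \<Phi>) c \<in> C0"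
      using C0 by (simp add: diff_map mult[symmetric])
  qed
  from this[of "fst \<Phi>"] this[of "snd \<Phi>"] show ?thesis
    unfolding asymptotic_cycle_iff using W Cb by (simp add: kk_map_def diff[symmetric])
qed

lemma kk_cycle_map: "kk_cycle k \<Phi> \<Longrightarrow> kk_cycle k (kk_map T \<Phi>)"
  by (auto simp: kk_cycle_def asymptotic_cycle_map) (auto simp: kk_map_def Cb)

lemma asym_unit_map: "asym_unit \<Phi> M \<Longrightarrow> asym_unit (kk_map T \<Phi>) (T M)"
  unfolding asym_unit_def
  by (auto simp: kk_map_def star[symmetric] diff[symmetric] mult[symmetric] intro: asymp_eq)

lemma kk_cut_map: "kk_map T (kk_cut M \<Phi>) = kk_cut (T M) (kk_map T \<Phi>)"
  by (simp add: kk_map_def kk_cut_def mult)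

end

section \<open>Constant paths and reparametrisations\<close>

definition path_scont :: "(halfline \<Rightarrow> unit_interval \<Rightarrow> 'b::cstar_algebra multiplier) \<Rightarrow> 'b path_algebra scont" where
  "path_scont G = (SOME F. \<forall>t s. family F t s = G t s)"

text \<open>Realisations are unique by \<open>path_scont_eqI\<close>, so the choice in
  \<open>path_scont\<close> is harmless.\<close>

lemma family_path_scont:
  assumes "strict_family G" shows "family (path_scont G) t s = G t s"
proof -
  have "\<exists>F. \<forall>t s. family F t s = G t s" using strict_family_realize[OF assms] by metis
  from someI_ex[OF this] show ?thesis unfolding path_scont_def by blast
qed

lemma continuous_on_prod_compose:
  assumes "continuous_on UNIV (\<lambda>(t, s). K t s)" "continuous_on S f" "continuous_on S g"
  shows "continuous_on S (\<lambda>p. K (f p) (g p))"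
  using continuous_on_compose2[OF assms(1) continuous_on_Pair[OF assms(2,3)]] by simp

definition const_path :: "'b::cstar_algebra scont \<Rightarrow> 'b path_algebra scont" where
  "const_path F = path_scont (\<lambda>t s. apply_scont F t)"

definition reparam :: "(unit_interval \<Rightarrow> unit_interval) \<Rightarrow> 'b::cstar_algebra path_algebra scont \<Rightarrow> 'b path_algebra scont" where
  "reparam g F = path_scont (\<lambda>t s. family F t (g s))"

lemma family_const_path [simp]: "family (const_path F) t s = apply_scont F t"
  unfolding const_path_def
proof (rule family_path_scont)
  have "continuous_on UNIV (\<lambda>p :: halfline \<times> unit_interval. lmul (apply_scont F (fst p)) b)"
    "continuous_on UNIV (\<lambda>p :: halfline \<times> unit_interval. rmul b (apply_scont F (fst p)))" for b
    by (rule continuous_on_compose2[OF apply_scont_lmul[OF continuous_on_const] continuous_on_fst[OF continuous_on_id]]; simp)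
      (rule continuous_on_compose2[OF apply_scont_rmul[OF continuous_on_const] continuous_on_fst[OF continuous_on_id]]; simp)
  then show "strict_family (\<lambda>t s. apply_scont F t)"
    using norm_scont_ge[of F] by (auto simp: strict_family_def case_prod_unfold)
qed

lemma family_reparam [simp]:
  assumes "continuous_on UNIV g" shows "family (reparam g F) t s = family F t (g s)"
  unfolding reparam_def
proof (rule family_path_scont)
  have g: "continuous_on UNIV (\<lambda>p :: halfline \<times> unit_interval. g (snd p))"
    by (rule continuous_on_compose2[OF assms continuous_on_snd[OF continuous_on_id]]) simp
  have "continuous_on UNIV (\<lambda>p :: halfline \<times> unit_interval. lmul (family F (fst p) (g (snd p))) b)"
    "continuous_on UNIV (\<lambda>p :: halfline \<times> unit_interval. rmul b (family F (fst p) (g (snd p))))" for b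
    using strict_family_family[of F]
    by (auto simp: strict_family_def intro!: continuous_on_prod_compose[OF _ continuous_on_fst[OF continuous_on_id] g])
  moreover have "\<exists>C. \<forall>t s. norm (family F t (g s)) \<le> C"
    using strict_family_family[of F] unfolding strict_family_def by blast
  ultimately show "strict_family (\<lambda>t s. family F t (g s))" by (simp add: strict_family_def case_prod_unfold)
qed

lemma path_C0I:
  assumes "F \<in> Cb" "\<And>t s. norm (family F t s) \<le> c t" "(c \<longlongrightarrow> 0) at_infty"
  shows "F \<in> C0"
proof -
  have "norm (apply_scont F t) \<le> c t" for t using assms(2) by (rule norm_path_scont_le)
  then show ?thesis
    unfolding C0_iff using assms(1) Lim_null_comparison[OF always_eventually assms(3), of "apply_scont F"] by blast
qed

lemma C0_norm: "F \<in> C0 \<Longrightarrow> ((\<lambda>t. norm (apply_scont F t)) \<longlongrightarrow> 0) at_infty"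
  by (simp add: C0_iff tendsto_norm_zero)

lemma norm_scont_family: "norm F \<le> norm G" if dom: "\<And>t s. \<exists>s'. norm (family F t s) \<le> norm (family G t s')"
proof (rule norm_scont_le, rule norm_path_scont_le)
  fix t s
  obtain s' where "norm (family F t s) \<le> norm (family G t s')" using dom by blast
  also have "\<dots> \<le> norm (apply_scont G t)" by (rule norm_family)
  also have "\<dots> \<le> norm G" by (rule norm_scont_ge)
  finally show "norm (family F t s) \<le> norm G" .
qed

interpretation ev: cycle_hom "ev_scont s" for s
proof
  show evCb: "ev_scont s F \<in> Cb" if F: "F \<in> Cb" for F :: "'a path_algebra scont"
  proof -
    have "continuous_on UNIV (\<lambda>t. family F t s)"
      using continuous_on_prod_compose[of "family F" UNIV "\<lambda>t. t" "\<lambda>_. s"] F by (simp add: path_Cb_iff)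
    then show ?thesis using F[unfolded path_Cb_iff] by (auto simp: Cb_iff apply_ev_scont[abs_def])
  qed
  show "ev_scont s F \<in> C0" if F: "F \<in> C0" for F :: "'a path_algebra scont"
  proof -
    have "((\<lambda>t. family F t s) \<longlongrightarrow> 0) at_infty"
      by (rule Lim_null_comparison[OF _ C0_norm[OF F]]) (simp add: norm_family)
    then show ?thesis using evCb[OF C0_Cb[OF F]] by (simp add: C0_iff apply_ev_scont[abs_def])
  qed
  show "norm (ev_scont s F) \<le> norm F" for F :: "'a path_algebra scont"
    by (rule norm_scont_le) (simp add: apply_ev_scont order_trans[OF norm_family norm_scont_ge])
qed (rule scont_eqI, simp add: apply_ev_scont family_simps scont_ap)+

interpretation const_path: cycle_hom const_path
proof
  show "const_path F \<in> Cb" if F: "F \<in> Cb" for F :: "'a scont"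
  proof -
    have "continuous_on UNIV (\<lambda>p :: halfline \<times> unit_interval. apply_scont F (fst p))"
      using F by (intro continuous_on_compose2[OF _ continuous_on_fst[OF continuous_on_id]]) (auto simp: Cb_iff)
    then show ?thesis unfolding path_Cb_iff using F[unfolded Cb_iff] by (auto simp: case_prod_unfold)
  qed
  then show "const_path F \<in> C0" if F: "F \<in> C0" for F :: "'a scont"
    using F C0_norm[OF F] by (intro path_C0I[where c = "\<lambda>t. norm (apply_scont F t)"]) (auto simp: C0_iff)
  show "norm (const_path F) \<le> norm F" for F :: "'a scont"
    by (intro norm_scont_le norm_path_scont_le) (simp add: norm_scont_ge)
qed (rule path_scont_eqI, simp add: family_simps scont_ap)+

lemma cycle_hom_reparam:
  assumes g: "continuous_on UNIV g" shows "cycle_hom (reparam g)"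
proof
  show "reparam g F \<in> Cb" if F: "F \<in> Cb" for F :: "'a path_algebra scont"
  proof -
    have "continuous_on UNIV (\<lambda>p :: halfline \<times> unit_interval. family F (fst p) (g (snd p)))"
      using F g by (intro continuous_on_prod_compose[of "family F" UNIV fst "\<lambda>p. g (snd p)"]
          continuous_on_compose2[OF g continuous_on_snd[OF continuous_on_id]] continuous_on_fst[OF continuous_on_id])
        (simp_all add: path_Cb_iff)
    then show ?thesis using F by (auto simp: path_Cb_iff case_prod_unfold g)
  qed
  then show "reparam g F \<in> C0" if F: "F \<in> C0" for F :: "'a path_algebra scont"
    using F C0_norm[OF F]
    by (intro path_C0I[where c = "\<lambda>t. norm (apply_scont F t)"]) (auto simp: C0_iff g norm_family)
  show "norm (reparam g F) \<le> norm F" for F :: "'a path_algebra scont"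
    by (rule norm_scont_family) (auto simp: g)
qed (rule path_scont_eqI, simp add: family_simps g)+

lemma ev_const_path [simp]: "ev_scont s (const_path F) = F"
  by (rule scont_eqI) (simp add: apply_ev_scont)

lemma ev_reparam: "continuous_on UNIV g \<Longrightarrow> ev_scont s (reparam g F) = ev_scont (g s) F"
  by (rule scont_eqI) (simp add: apply_ev_scont)

lemma ev_pair_eq: "ev_pair s H = kk_map (ev_scont (unit_of_real s)) H"
  by (simp add: ev_pair_def kk_map_def)

lemma kk_map_ev_const [simp]: "kk_map (ev_scont s) (kk_map const_path \<Phi>) = \<Phi>"
  by (simp add: kk_map_def)

section \<open>Homotopy is an equivalence relation\<close>

text \<open>Reparametrising along a half map restricts a path to that half. The doubling maps undo
  this on the respective half and are clamped in order to remain defined on the whole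
  interval.\<close>

definition fst_half :: "unit_interval \<Rightarrow> unit_interval" where
  "fst_half s = unit_of_real (real_of_unit s / 2)"

definition snd_half :: "unit_interval \<Rightarrow> unit_interval" where
  "snd_half s = unit_of_real ((real_of_unit s + 1) / 2)"

definition fst_double :: "unit_interval \<Rightarrow> unit_interval" where
  "fst_double s = unit_of_real (min 1 (2 * real_of_unit s))"

definition snd_double :: "unit_interval \<Rightarrow> unit_interval" where
  "snd_double s = unit_of_real (max 0 (2 * real_of_unit s - 1))"

definition flip :: "unit_interval \<Rightarrow> unit_interval" where
  "flip s = unit_of_real (1 - real_of_unit s)"

lemma real_of_unit_bounds: "0 \<le> real_of_unit s" "real_of_unit s \<le> 1"
  using real_of_unit[of s] by auto

lemma real_of_reparam:
  "real_of_unit (fst_half s) = real_of_unit s / 2" "real_of_unit (snd_half s) = (real_of_unit s + 1) / 2"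
  "real_of_unit (fst_double s) = min 1 (2 * real_of_unit s)"
  "real_of_unit (snd_double s) = max 0 (2 * real_of_unit s - 1)"
  "real_of_unit (flip s) = 1 - real_of_unit s"
  using real_of_unit_bounds[of s]
  by (simp_all add: fst_half_def snd_half_def fst_double_def snd_double_def flip_def unit_of_real_inverse)

lemma continuous_real_of_unit: "continuous_on S real_of_unit"
  by (auto simp: continuous_on_iff dist_unit_interval_def)

lemma continuous_into_unit:
  fixes g :: "'x::metric_space \<Rightarrow> unit_interval"
  assumes "continuous_on S (\<lambda>s. real_of_unit (g s))"
  shows "continuous_on S g"
  using assms by (simp add: continuous_on_iff dist_unit_interval_def)

lemma continuous_reparam:
  "continuous_on UNIV fst_half" "continuous_on UNIV snd_half" "continuous_on UNIV fst_double"
  "continuous_on UNIV snd_double" "continuous_on UNIV flip"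
  by (rule continuous_into_unit, simp only: real_of_reparam, intro continuous_intros continuous_real_of_unit, simp?)+

lemma unit_eqI: "real_of_unit s = real_of_unit t \<Longrightarrow> s = t"
  by (simp add: real_of_unit_inject)

lemma reparam_ends:
  "flip (unit_of_real 0) = unit_of_real 1" "flip (unit_of_real 1) = unit_of_real 0"
  "fst_half (unit_of_real 0) = unit_of_real 0" "fst_half (unit_of_real 1) = snd_half (unit_of_real 0)"
  "snd_half (unit_of_real 1) = unit_of_real 1"
  by (rule unit_eqI, simp add: real_of_reparam unit_of_real_inverse)+

section \<open>Gluing along the two halves of the interval\<close>

lemma family_halves:
  "real_of_unit s \<le> 1/2 \<Longrightarrow> family F t s = family (reparam fst_half F) t (fst_double s)"
  "1/2 \<le> real_of_unit s \<Longrightarrow> family F t s = family (reparam snd_half F) t (snd_double s)"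
proof -
  assume "real_of_unit s \<le> 1/2"
  then have "fst_half (fst_double s) = s" by (intro unit_eqI) (simp add: real_of_reparam)
  then show "family F t s = family (reparam fst_half F) t (fst_double s)" by (simp add: continuous_reparam)
next
  assume "1/2 \<le> real_of_unit s"
  then have "snd_half (snd_double s) = s" by (intro unit_eqI) (simp add: real_of_reparam)
  then show "family F t s = family (reparam snd_half F) t (snd_double s)" by (simp add: continuous_reparam)
qed

lemma closed_halves:
  "closed {p :: halfline \<times> unit_interval. real_of_unit (snd p) \<le> 1/2}"
  "closed {p :: halfline \<times> unit_interval. 1/2 \<le> real_of_unit (snd p)}"
proof -
  have "continuous_on UNIV (\<lambda>p :: halfline \<times> unit_interval. real_of_unit (snd p))"
    by (rule continuous_on_compose2[OF continuous_real_of_unit[of UNIV] continuous_on_snd[OF continuous_on_id]]) simp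
  then show "closed {p :: halfline \<times> unit_interval. real_of_unit (snd p) \<le> 1/2}"
    "closed {p :: halfline \<times> unit_interval. 1/2 \<le> real_of_unit (snd p)}"
    by (intro closed_Collect_le continuous_on_const; simp)+
qed

text \<open>The pasting lemma for two closed pieces; the clamped doublings allow both pieces to be
  given on all of the half-line times the interval.\<close>

lemma continuous_on_halves:
  fixes K :: "halfline \<Rightarrow> unit_interval \<Rightarrow> 'x::topological_space"
  assumes K1: "continuous_on UNIV (\<lambda>(t, s). K1 t s)" and K2: "continuous_on UNIV (\<lambda>(t, s). K2 t s)"
    and eq1: "\<And>t s. real_of_unit s \<le> 1/2 \<Longrightarrow> K t s = K1 t (fst_double s)"
    and eq2: "\<And>t s. 1/2 \<le> real_of_unit s \<Longrightarrow> K t s = K2 t (snd_double s)"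
  shows "continuous_on UNIV (\<lambda>(t, s). K t s)"
proof -
  let ?A = "{p :: halfline \<times> unit_interval. real_of_unit (snd p) \<le> 1/2}"
  let ?B = "{p :: halfline \<times> unit_interval. 1/2 \<le> real_of_unit (snd p)}"
  have fst: "continuous_on S (fst :: halfline \<times> unit_interval \<Rightarrow> _)" for S
    by (rule continuous_on_fst[OF continuous_on_id])
  have double: "continuous_on S (\<lambda>p :: halfline \<times> unit_interval. fst_double (snd p))"
    "continuous_on S (\<lambda>p :: halfline \<times> unit_interval. snd_double (snd p))" for S
    by (rule continuous_on_compose2[OF continuous_reparam(3) continuous_on_snd[OF continuous_on_id]], simp)
      (rule continuous_on_compose2[OF continuous_reparam(4) continuous_on_snd[OF continuous_on_id]], simp)
  have "continuous_on ?A (\<lambda>p. K1 (fst p) (fst_double (snd p)))"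
    by (rule continuous_on_prod_compose[OF K1 fst double(1)])
  then have A: "continuous_on ?A (\<lambda>(t, s). K t s)"
    by (rule continuous_on_eq) (auto simp: eq1)
  have "continuous_on ?B (\<lambda>p. K2 (fst p) (snd_double (snd p)))"
    by (rule continuous_on_prod_compose[OF K2 fst double(2)])
  then have B: "continuous_on ?B (\<lambda>(t, s). K t s)"
    by (rule continuous_on_eq) (auto simp: eq2)
  have "?A \<union> ?B = UNIV" by auto
  then show ?thesis using continuous_on_closed_Un[OF closed_halves A B] by simp
qed

lemma halves_Cb:
  assumes "reparam fst_half F \<in> Cb" "reparam snd_half F \<in> Cb" shows "F \<in> Cb"
  unfolding path_Cb_iff
proof
  show "continuous_on UNIV (\<lambda>(t, s). family F t s)"
    using assms[unfolded path_Cb_iff]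
    by - (rule continuous_on_halves[of "family (reparam fst_half F)" "family (reparam snd_half F)"];
        blast intro: family_halves)
  show "\<forall>t s. family F t s \<in> range mult_embed"
    using assms unfolding path_Cb_iff by (metis family_halves linear)
qed

lemma halves_norm:
  assumes "norm (apply_scont (reparam fst_half F) t) \<le> c" "norm (apply_scont (reparam snd_half F) t) \<le> c"
  shows "norm (apply_scont F t) \<le> c"
proof (rule norm_path_scont_le)
  fix s
  consider "real_of_unit s \<le> 1/2" | "1/2 \<le> real_of_unit s" by linarith
  then show "norm (family F t s) \<le> c"
    by cases (use family_halves[of s F t] order_trans[OF norm_family assms(1)] order_trans[OF norm_family assms(2)] in simp_all)
qed

lemma halves_C0:
  assumes "reparam fst_half F \<in> C0" "reparam snd_half F \<in> C0" shows "F \<in> C0"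
proof -
  let ?c = "\<lambda>t. norm (apply_scont (reparam fst_half F) t) + norm (apply_scont (reparam snd_half F) t)"
  have "(?c \<longlongrightarrow> 0 + 0) at_infty" by (intro tendsto_add C0_norm assms)
  moreover have "norm (apply_scont F t) \<le> ?c t" for t by (rule halves_norm) simp_all
  ultimately have "(apply_scont F \<longlongrightarrow> 0) at_infty"
    using Lim_null_comparison[OF always_eventually, of "apply_scont F" ?c] by simp
  then show ?thesis using halves_Cb[OF C0_Cb C0_Cb, OF assms] by (simp add: C0_iff)
qed

lemma halves_eqI:
  assumes "reparam fst_half F = reparam fst_half G" "reparam snd_half F = reparam snd_half G" shows "F = G"
proof (rule path_scont_eqI)
  fix t s
  show "family F t s = family G t s"
    using family_halves[of s F t] family_halves[of s G t] assms by (cases "real_of_unit s \<le> 1/2") simp_all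
qed

interpretation fst_half: cycle_hom "reparam fst_half"
  by (rule cycle_hom_reparam[OF continuous_reparam(1)])

interpretation snd_half: cycle_hom "reparam snd_half"
  by (rule cycle_hom_reparam[OF continuous_reparam(2)])

lemma halves_asymp_eq:
  "reparam fst_half F \<simeq> reparam fst_half G \<Longrightarrow> reparam snd_half F \<simeq> reparam snd_half G \<Longrightarrow> F \<simeq> G"
  unfolding asymp_eq_def by (rule halves_C0) (simp_all add: fst_half.diff snd_half.diff)

lemma (in cycle_hom) words_image: "w \<in> words \<Phi> \<Longrightarrow> T w \<in> words (kk_map T \<Phi>)"
proof (induction rule: words.induct)
  case words_one
  show ?case by (simp add: one words.words_one)
next
  case (words_fst w a)
  then show ?case using words.words_fst[of "T w" "kk_map T \<Phi>" a] by (simp add: kk_map_def mult)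
next
  case (words_snd w a)
  then show ?case using words.words_snd[of "T w" "kk_map T \<Phi>" a] by (simp add: kk_map_def mult)
qed

lemma (in cycle_hom) defects_image: "z \<in> defects \<phi> \<Longrightarrow> T z \<in> defects (\<lambda>a. T (\<phi> a))"
  using defects_addI[of "\<lambda>a. T (\<phi> a)"] defects_multI[of "\<lambda>a. T (\<phi> a)"]
  by (fastforce simp: defects_def[of \<phi>] diff mult)

text \<open>Every condition in \<open>asymptotic_cycle_iff\<close> is an equality, a membership in
  \<open>Cb\<close> or \<open>C0\<close>, or norm continuity, and each of these is detected by the
  two restrictions. Words and defects of \<open>H\<close> restrict to words and defects of the
  restricted pairs.\<close>

lemma halves_cycle:
  assumes 1: "kk_cycle k (kk_map (reparam fst_half) H)" and 2: "kk_cycle k (kk_map (reparam snd_half) H)"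
  shows "kk_cycle k H"
proof -
  let ?T1 = "reparam fst_half" and ?T2 = "reparam snd_half"
  note W1 = 1[unfolded kk_cycle_def asymptotic_cycle_iff] and W2 = 2[unfolded kk_cycle_def asymptotic_cycle_iff]
  have diff: "kk_diff (kk_map ?T1 H) c = ?T1 (kk_diff H c)" "kk_diff (kk_map ?T2 H) c = ?T2 (kk_diff H c)" for c
    by (simp_all add: kk_map_def fst_half.diff snd_half.diff)
  have main: "continuous_on UNIV \<phi> \<and> (\<forall>c a. \<phi> (c *\<^sub>C a) = c *\<^sub>C \<phi> a) \<and> (\<forall>a. \<phi> (star a) \<simeq> star (\<phi> a)) \<and>
        (\<forall>z\<in>defects \<phi>. \<forall>w\<in>words H. \<forall>c. z * w * kk_diff H c \<in> C0)"
    if \<phi>: "\<phi> \<in> {fst H, snd H}" for \<phi>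
  proof (intro conjI allI ballI)
    have \<phi>1: "(\<lambda>a. ?T1 (\<phi> a)) \<in> {fst (kk_map ?T1 H), snd (kk_map ?T1 H)}"
      and \<phi>2: "(\<lambda>a. ?T2 (\<phi> a)) \<in> {fst (kk_map ?T2 H), snd (kk_map ?T2 H)}"
      using \<phi> by (auto simp: kk_map_def)
    note V1 = W1[THEN conjunct1, THEN conjunct1, rule_format, OF \<phi>1]
      and V2 = W2[THEN conjunct1, THEN conjunct1, rule_format, OF \<phi>2]
    show "\<phi> (c *\<^sub>C a) = c *\<^sub>C \<phi> a" for c a
      by (rule halves_eqI) (use V1 V2 in \<open>simp_all add: fst_half.scaleC snd_half.scaleC\<close>)
    show "\<phi> (star a) \<simeq> star (\<phi> a)" for a
      by (rule halves_asymp_eq) (use V1 V2 in \<open>simp_all add: fst_half.star snd_half.star\<close>)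
    have c1: "continuous_on UNIV (\<lambda>a. ?T1 (\<phi> a))" and c2: "continuous_on UNIV (\<lambda>a. ?T2 (\<phi> a))" using V1 V2 by auto
    show "continuous_on UNIV \<phi>"
      unfolding continuous_on_def
    proof
      fix a
      have lim: "((\<lambda>x. norm (?T1 (\<phi> x) - ?T1 (\<phi> a)) + norm (?T2 (\<phi> x) - ?T2 (\<phi> a))) \<longlongrightarrow> 0 + 0) (at a)"
        using c1 c2 by (intro tendsto_add tendsto_norm_zero LIM_zero) (simp_all add: continuous_on_def)
      have le: "norm (\<phi> x - \<phi> a) \<le> norm (?T1 (\<phi> x) - ?T1 (\<phi> a)) + norm (?T2 (\<phi> x) - ?T2 (\<phi> a))" for x
        by (rule norm_scont_le, rule halves_norm)
          (simp_all add: fst_half.diff snd_half.diff add_increasing add_increasing2 norm_scont_ge)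
      have "((\<lambda>x. \<phi> x - \<phi> a) \<longlongrightarrow> 0) (at a)"
        by (rule Lim_null_comparison[OF always_eventually[OF allI[OF le]] lim[unfolded add_0]])
      then show "(\<phi> \<longlongrightarrow> \<phi> a) (at a)" by (rule LIM_zero_cancel)
    qed
    fix z w c assume z: "z \<in> defects \<phi>" and w: "w \<in> words H"
    have "?T1 z * ?T1 w * kk_diff (kk_map ?T1 H) c \<in> C0"
      using V1 fst_half.defects_image[OF z] fst_half.words_image[OF w] by blast
    moreover have "?T2 z * ?T2 w * kk_diff (kk_map ?T2 H) c \<in> C0"
      using V2 snd_half.defects_image[OF z] snd_half.words_image[OF w] by blast
    ultimately show "z * w * kk_diff H c \<in> C0"
      unfolding diff by - (rule halves_C0; simp add: fst_half.mult snd_half.mult)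
  qed
  have "kk_diff H c \<in> Cb" for c
  proof (rule halves_Cb)
    show "?T1 (kk_diff H c) \<in> Cb" "?T2 (kk_diff H c) \<in> Cb" using W1 W2 unfolding diff by blast+
  qed
  then have "asymptotic_cycle H"
    unfolding asymptotic_cycle_iff using main by blast
  moreover have "fst H a \<in> Cb" "snd H a \<in> Cb" if k for a
    by (rule halves_Cb; use W1 W2 that in \<open>simp add: kk_map_def\<close>)+
  ultimately show ?thesis by (simp add: kk_cycle_def)
qed

text \<open>The hypothesis is agreement of the two pieces at s = 1/2, so the glued family is again
  bounded and jointly strictly continuous.\<close>

lemma concatenation:
  assumes "ev_scont (unit_of_real 1) F = ev_scont (unit_of_real 0) G"
  obtains X where "reparam fst_half X = F" "reparam snd_half X = G"
proof -
  define K where "K t s = (if real_of_unit s \<le> 1/2 then family F t (fst_double s) else family G t (snd_double s))" for t s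
  have mid: "family F t (fst_double s) = family G t (snd_double s)" if "real_of_unit s = 1/2" for t s
  proof -
    have "fst_double s = unit_of_real 1" "snd_double s = unit_of_real 0"
      by (rule unit_eqI, simp add: real_of_reparam unit_of_real_inverse that)+
    then show ?thesis using assms by (metis apply_ev_scont)
  qed
  have K1: "K t s = family F t (fst_double s)" if "real_of_unit s \<le> 1/2" for t s
    using that by (simp add: K_def)
  have K2: "K t s = family G t (snd_double s)" if "1/2 \<le> real_of_unit s" for t s
    using that mid[of s t] by (cases "real_of_unit s = 1/2") (simp_all add: K_def)
  have "strict_family K"
    unfolding strict_family_def
  proof (intro conjI allI)
    have "norm (family F t s) \<le> norm F + norm G" "norm (family G t s) \<le> norm F + norm G" for t s
      using norm_family[of F t s] norm_family[of G t s] norm_scont_ge[of F t] norm_scont_ge[of G t]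
        norm_ge_zero[of F] norm_ge_zero[of G] by linarith+
    then show "\<exists>C. \<forall>t s. norm (K t s) \<le> C" by (intro exI[of _ "norm F + norm G"]) (simp add: K_def)
    show "continuous_on UNIV (\<lambda>(t, s). lmul (K t s) b)" for b
      using strict_family_family[of F] strict_family_family[of G]
      by - (rule continuous_on_halves[of "\<lambda>t s. lmul (family F t s) b" "\<lambda>t s. lmul (family G t s) b"];
          simp add: strict_family_def K1 K2)
    show "continuous_on UNIV (\<lambda>(t, s). rmul b (K t s))" for b
      using strict_family_family[of F] strict_family_family[of G]
      by - (rule continuous_on_halves[of "\<lambda>t s. rmul b (family F t s)" "\<lambda>t s. rmul b (family G t s)"];
          simp add: strict_family_def K1 K2)
  qed
  from strict_family_realize[OF this] obtain X where X: "\<And>t s. family X t s = K t s" by blast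
  show ?thesis
  proof
    have "fst_double (fst_half s) = s" "snd_double (snd_half s) = s" for s
      using real_of_unit_bounds[of s] by (auto intro!: unit_eqI simp: real_of_reparam field_simps)
    then show "reparam fst_half X = F" "reparam snd_half X = G"
      using real_of_unit_bounds
      by (auto intro!: path_scont_eqI simp: continuous_reparam X K1 K2 real_of_reparam)
  qed
qed

section \<open>The homotopy relation for both kinds of cycles\<close>

definition kk_homotopic :: "bool \<Rightarrow> (('a::cstar_algebra, 'b::cstar_algebra) kk_pair \<times> ('a, 'b) kk_pair) set" where
  "kk_homotopic k = {(\<Phi>, \<Psi>). kk_cycle k \<Phi> \<and> kk_cycle k \<Psi> \<and>
     (\<exists>H :: ('a, 'b path_algebra) kk_pair. kk_cycle k H \<and> ev_pair 0 H = \<Phi> \<and> ev_pair 1 H = \<Psi>)}"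

lemma asymptotic_cycle_eq: "asymptotic_cycle = kk_cycle False"
  by (simp add: fun_eq_iff kk_cycle_def)

lemma compact_cycle_eq: "compact_cycle = kk_cycle True"
  by (auto simp: fun_eq_iff kk_cycle_def compact_cycle_def)

lemma EL_homotopic_eq: "EL_homotopic = kk_homotopic False"
  unfolding EL_homotopic_def kk_homotopic_def asymptotic_cycle_eq ..

lemma EM_homotopic_eq: "EM_homotopic = kk_homotopic True"
  unfolding EM_homotopic_def kk_homotopic_def compact_cycle_eq ..

lemma kk_homotopicI:
  assumes "kk_cycle k H"
  shows "(ev_pair 0 H, ev_pair 1 H) \<in> kk_homotopic k"
proof -
  have "kk_cycle k (ev_pair s H)" for s unfolding ev_pair_eq by (rule ev.kk_cycle_map[OF assms])
  then show ?thesis unfolding kk_homotopic_def using assms by blast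
qed

lemma equiv_kk_homotopic:
  "equiv {\<Phi> :: ('a::cstar_algebra, 'b::cstar_algebra) kk_pair. kk_cycle k \<Phi>} (kk_homotopic k)" (is "equiv ?A ?R")
proof (rule equivI)
  show "?R \<subseteq> ?A \<times> ?A" by (auto simp: kk_homotopic_def)
  show "refl_on ?A ?R"
  proof (rule refl_onI)
    fix \<Phi> :: "('a, 'b) kk_pair" assume "\<Phi> \<in> ?A"
    then show "(\<Phi>, \<Phi>) \<in> kk_homotopic k"
      using kk_homotopicI[OF const_path.kk_cycle_map, of k \<Phi>] by (simp add: ev_pair_eq)
  qed
  show "sym ?R"
  proof (rule symI)
    fix \<Phi> \<Psi> :: "('a, 'b) kk_pair" assume "(\<Phi>, \<Psi>) \<in> kk_homotopic k"
    then obtain H :: "('a, 'b path_algebra) kk_pair" where H: "kk_cycle k H" "ev_pair 0 H = \<Phi>" "ev_pair 1 H = \<Psi>"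
      by (auto simp: kk_homotopic_def)
    have "kk_cycle k (kk_map (reparam flip) H)"
      by (rule cycle_hom.kk_cycle_map[OF cycle_hom_reparam[OF continuous_reparam(5)] H(1)])
    moreover have "ev_pair 0 (kk_map (reparam flip) H) = \<Psi>" "ev_pair 1 (kk_map (reparam flip) H) = \<Phi>"
      using H by (simp_all add: ev_pair_eq kk_map_def ev_reparam continuous_reparam reparam_ends)
    ultimately show "(\<Psi>, \<Phi>) \<in> kk_homotopic k" using kk_homotopicI by metis
  qed
  show "trans ?R"
  proof (rule transI)
    fix \<Phi> \<Psi> \<Theta> :: "('a, 'b) kk_pair" assume "(\<Phi>, \<Psi>) \<in> kk_homotopic k" "(\<Psi>, \<Theta>) \<in> kk_homotopic k"
    then obtain H K :: "('a, 'b path_algebra) kk_pair" where H: "kk_cycle k H" "ev_pair 0 H = \<Phi>" "ev_pair 1 H = \<Psi>"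
      and K: "kk_cycle k K" "ev_pair 0 K = \<Psi>" "ev_pair 1 K = \<Theta>"
      by (auto simp: kk_homotopic_def)
    have HK: "ev_scont (unit_of_real 1) (fst H a) = ev_scont (unit_of_real 0) (fst K a)"
      "ev_scont (unit_of_real 1) (snd H a) = ev_scont (unit_of_real 0) (snd K a)" for a
      using H(3) K(2) by (auto simp: ev_pair_def fun_eq_iff)
    \<comment> \<open>Concatenations are chosen separately for each \<open>a\<close>;
      \<open>halves_cycle\<close> recovers continuity and homogeneity in \<open>a\<close> from the
      restrictions.\<close>
    have "\<exists>X. reparam fst_half X = fst H a \<and> reparam snd_half X = fst K a"
      "\<exists>X. reparam fst_half X = snd H a \<and> reparam snd_half X = snd K a" for a
      using concatenation[OF HK(1)[of a]] concatenation[OF HK(2)[of a]] by metis+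
    then obtain L M where L: "\<And>a. reparam fst_half (L a) = fst H a" "\<And>a. reparam snd_half (L a) = fst K a"
      and M: "\<And>a. reparam fst_half (M a) = snd H a" "\<And>a. reparam snd_half (M a) = snd K a"
      by metis
    have eq: "kk_map (reparam fst_half) (L, M) = H" "kk_map (reparam snd_half) (L, M) = K"
      by (simp_all add: kk_map_def L M)
    have "kk_cycle k (L, M)" by (rule halves_cycle) (simp_all add: eq H K)
    moreover have "ev_pair 0 (L, M) = ev_pair 0 (kk_map (reparam fst_half) (L, M))"
      "ev_pair 1 (L, M) = ev_pair 1 (kk_map (reparam snd_half) (L, M))"
      by (simp_all add: ev_pair_eq kk_map_def ev_reparam continuous_reparam reparam_ends)
    ultimately show "(\<Phi>, \<Theta>) \<in> kk_homotopic k"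
      using kk_homotopicI[of k "(L, M)"] H K by (simp add: eq)
  qed
qed

section \<open>The linear homotopy\<close>

text \<open>The coordinate function s, viewed as a central multiplier of IB that is constant in
  time. It turns convex combinations along the path into algebra.\<close>

definition path_parameter :: "'b::cstar_algebra path_algebra scont" where
  "path_parameter = path_scont (\<lambda>t s. real_of_unit s *\<^sub>R 1)"

lemma family_path_parameter: "family path_parameter t s = real_of_unit s *\<^sub>R (1 :: 'b::cstar_algebra multiplier)"
  unfolding path_parameter_def
proof (rule family_path_scont)
  have "norm (real_of_unit s *\<^sub>R (1 :: 'b multiplier)) \<le> 1" for s
    using mult_mono[OF real_of_unit_bounds(2) norm_one_le, of s] real_of_unit_bounds by simp
  moreover have "continuous_on UNIV (\<lambda>p :: halfline \<times> unit_interval. real_of_unit (snd p))"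
    by (rule continuous_on_compose2[OF continuous_real_of_unit[of UNIV] continuous_on_snd[OF continuous_on_id]]) simp
  ultimately show "strict_family (\<lambda>t s. real_of_unit s *\<^sub>R (1 :: 'b multiplier))"
    by (auto simp: strict_family_def case_prod_unfold mul_simps intro!: continuous_on_scaleR continuous_on_const)
qed

definition linear_path :: "'b::cstar_algebra scont \<Rightarrow> 'b scont \<Rightarrow> 'b path_algebra scont" where
  "linear_path M N = path_parameter * const_path N + (1 - path_parameter) * const_path M"

lemma ev_path_parameter: "ev_scont (unit_of_real 0) path_parameter = 0" "ev_scont (unit_of_real 1) path_parameter = 1"
  by (rule scont_eqI, simp add: apply_ev_scont family_path_parameter unit_of_real_inverse scont_ap)+

lemma ev_linear_path: "ev_scont (unit_of_real 0) (linear_path M N) = M" "ev_scont (unit_of_real 1) (linear_path M N) = N"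
  by (simp_all add: linear_path_def ev.add ev.mult ev.diff ev.one ev_path_parameter)

lemma path_parameter_central: "F * path_parameter = path_parameter * F"
  by (rule path_scont_eqI) (simp add: family_simps family_path_parameter)

text \<open>The commutation and unit conditions are affine in \<open>M\<close>, and multiplication
  by the central elements \<open>path_parameter\<close> and \<open>1 - path_parameter\<close>
  preserves equality modulo \<open>C0\<close>.\<close>

lemma linear_path_asym_unit:
  fixes \<Phi> :: "('a::cstar_algebra, 'b::cstar_algebra) kk_pair"
  assumes M: "asym_unit \<Phi> M" and N: "asym_unit \<Phi> N"
  shows "asym_unit (kk_map const_path \<Phi>) (linear_path M N)"
proof -
  let ?p = "path_parameter :: 'b path_algebra scont"
  have "star ?p = ?p"
    by (rule path_scont_eqI) (simp add: family_simps family_path_parameter star_scaleR)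
  moreover have central: "(1 - ?p) * F = F * (1 - ?p)" for F :: "'b path_algebra scont"
    by (simp add: algebra_simps path_parameter_central)
  moreover have "star (const_path M) = const_path M" "star (const_path N) = const_path N"
    using M N by (auto simp: asym_unit_def const_path.star[symmetric])
  ultimately have "star (linear_path M N) = linear_path M N"
    unfolding linear_path_def by (simp add: star_add star_mult star_diff path_parameter_central)
  moreover have "linear_path M N * const_path F \<simeq> const_path G"
    if "M * F \<simeq> G" "N * F \<simeq> G" for F G
  proof -
    have "?p * const_path (N * F) + (1 - ?p) * const_path (M * F) \<simeq> ?p * const_path G + (1 - ?p) * const_path G"
      by (intro asymp_eq_add asymp_eq_mult_left const_path.asymp_eq that)
    then show ?thesis by (simp add: linear_path_def const_path.mult algebra_simps)
  qed
  moreover have "linear_path M N * const_path F \<simeq> const_path F * linear_path M N"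
    if "M * F \<simeq> F * M" "N * F \<simeq> F * N" for F
  proof -
    have "?p * const_path (N * F) + (1 - ?p) * const_path (M * F) \<simeq> ?p * const_path (F * N) + (1 - ?p) * const_path (F * M)"
      by (intro asymp_eq_add asymp_eq_mult_left const_path.asymp_eq that)
    also have "?p * const_path (F * N) + (1 - ?p) * const_path (F * M) = const_path F * linear_path M N"
      unfolding linear_path_def const_path.mult distrib_left
      by (simp only: mult.assoc[symmetric] path_parameter_central[of "const_path F"] central[of "const_path F", symmetric])
    finally show ?thesis by (simp add: linear_path_def const_path.mult distrib_right mult.assoc)
  qed
  ultimately show ?thesis
    using M N unfolding asym_unit_def by (auto simp: kk_map_def const_path.diff[symmetric])
qed

text \<open>The constant homotopy is cut by the linear path from \<open>M\<close> to
  \<open>N\<close>. Membership in \<open>Cb\<close> is asked of the products rather than of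
  \<open>M\<close> and \<open>N\<close>, so that \<open>N = 1\<close> with a compact cycle is
  covered.\<close>

lemma kk_cut_homotopic:
  assumes \<Phi>: "asymptotic_cycle \<Phi>" and M: "asym_unit \<Phi> M" and N: "asym_unit \<Phi> N"
    and Cb: "\<And>a. k \<Longrightarrow> M * fst \<Phi> a \<in> Cb \<and> M * snd \<Phi> a \<in> Cb \<and> N * fst \<Phi> a \<in> Cb \<and> N * snd \<Phi> a \<in> Cb"
  shows "(kk_cut M \<Phi>, kk_cut N \<Phi>) \<in> kk_homotopic k"
proof -
  let ?H = "kk_cut (linear_path M N) (kk_map const_path \<Phi>)"
  have "asymptotic_cycle ?H"
    by (intro asymptotic_cycle_cut const_path.asymptotic_cycle_map linear_path_asym_unit assms)
  moreover have "linear_path M N * const_path F \<in> Cb" if "M * F \<in> Cb" "N * F \<in> Cb" for F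
  proof -
    have "path_parameter * const_path (N * F) + (1 - path_parameter) * const_path (M * F) \<in> Cb"
      by (intro Cb_add Cb_mult const_path.Cb that)
    then show ?thesis by (simp add: linear_path_def const_path.mult distrib_right mult.assoc)
  qed
  ultimately have "kk_cycle k ?H" using Cb by (simp add: kk_cycle_def kk_cut_def kk_map_def)
  moreover have "ev_pair 0 ?H = kk_cut M \<Phi>" "ev_pair 1 ?H = kk_cut N \<Phi>"
    by (simp_all add: ev_pair_eq ev.kk_cut_map ev_linear_path)
  ultimately show ?thesis using kk_homotopicI by metis
qed

lemma kk_cut_one [simp]: "kk_cut 1 \<Phi> = \<Phi>"
  by (simp add: kk_cut_def)

section \<open>Sums\<close>

text \<open>Formulated inside the algebra of strictly continuous functions so that the images of the
  isometries under \<open>const_path\<close> and under evaluations are covered too.\<close>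

locale isometry_pair =
  fixes S1 S2 :: "'b::cstar_algebra scont"
  assumes iso1: "star S1 * S1 = 1" and iso2: "star S2 * S2 = 1" and complete: "S1 * star S1 + S2 * star S2 = 1"
begin

text \<open>Inserting the completeness relation between \<open>star S1\<close> and \<open>S2\<close>
  gives X = X + X for \<open>X = star S1 * S2\<close>.\<close>

lemma orthogonal: "star S1 * S2 = 0" "star S2 * S1 = 0"
proof -
  have "star S1 * (S1 * star S1 + S2 * star S2) * S2 = (star S1 * S1) * (star S1 * S2) + (star S1 * S2) * (star S2 * S2)"
    by (simp add: algebra_simps)
  then have "star S1 * S2 = star S1 * S2 + star S1 * S2" unfolding complete iso1 iso2 by simp
  then show *: "star S1 * S2 = 0" by simp
  show "star S2 * S1 = 0" using arg_cong[OF *, of star] by (simp add: star_mult star_star)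
qed

text \<open>The diagonal 2 by 2 matrices, compressed into one copy by the isometries. The embedding
  of pairs is a unital star homomorphism, so words, defects and asymptotic units split into
  components.\<close>

definition diag :: "'b scont \<Rightarrow> 'b scont \<Rightarrow> 'b scont" where
  "diag F G = S1 * F * star S1 + S2 * G * star S2"

lemma cancel: "star S1 * (S1 * X) = X" "star S2 * (S2 * X) = X" "star S1 * (S2 * X) = 0" "star S2 * (S1 * X) = 0"
  by (simp_all add: mult.assoc[symmetric] iso1 iso2 orthogonal)

lemma diag_simps:
  "diag F G * diag F' G' = diag (F * F') (G * G')" "diag F G + diag F' G' = diag (F + F') (G + G')"
  "diag F G - diag F' G' = diag (F - F') (G - G')" "c *\<^sub>C diag F G = diag (c *\<^sub>C F) (c *\<^sub>C G)"
  "star (diag F G) = diag (star F) (star G)" "diag 1 1 = 1"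
  by (simp_all add: diag_def complete algebra_simps cancel scaleC_add_right scaleC_mult_left scaleC_mult_right
      star_add star_mult star_star)

lemma diag_Cb: "F \<in> Cb \<Longrightarrow> G \<in> Cb \<Longrightarrow> diag F G \<in> Cb"
  unfolding diag_def by (intro Cb_add Cb_mult)

lemma diag_C0: "F \<in> C0 \<Longrightarrow> G \<in> C0 \<Longrightarrow> diag F G \<in> C0"
  unfolding diag_def by (intro C0_add C0_mult)

lemma diag_asymp_eq: "F \<simeq> F' \<Longrightarrow> G \<simeq> G' \<Longrightarrow> diag F G \<simeq> diag F' G'"
  by (simp add: asymp_eq_def diag_simps diag_C0)

definition pair_sum :: "('a, 'b) kk_pair \<Rightarrow> ('a, 'b) kk_pair \<Rightarrow> ('a, 'b) kk_pair" where
  "pair_sum \<Phi> \<Psi> = (\<lambda>a. diag (fst \<Phi> a) (fst \<Psi> a), \<lambda>a. diag (snd \<Phi> a) (snd \<Psi> a))"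

lemma pair_sum_words: "w \<in> words (pair_sum \<Phi> \<Psi>) \<Longrightarrow> \<exists>u\<in>words \<Phi>. \<exists>v\<in>words \<Psi>. w = diag u v"
proof (induction rule: words.induct)
  case words_one
  show ?case using words.words_one[of \<Phi>] words.words_one[of \<Psi>] diag_simps(6) by metis
next
  case (words_fst w a)
  then obtain u v where "u \<in> words \<Phi>" "v \<in> words \<Psi>" "w = diag u v" by blast
  then show ?case using words.words_fst[of u \<Phi> a] words.words_fst[of v \<Psi> a]
    by (auto simp: pair_sum_def diag_simps)
next
  case (words_snd w a)
  then obtain u v where "u \<in> words \<Phi>" "v \<in> words \<Psi>" "w = diag u v" by blast
  then show ?case using words.words_snd[of u \<Phi> a] words.words_snd[of v \<Psi> a]
    by (auto simp: pair_sum_def diag_simps)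
qed

lemma diag_defects: "z \<in> defects (\<lambda>a. diag (\<phi> a) (\<psi> a)) \<Longrightarrow> \<exists>x\<in>defects \<phi>. \<exists>y\<in>defects \<psi>. z = diag x y"
proof -
  assume "z \<in> defects (\<lambda>a. diag (\<phi> a) (\<psi> a))"
  then obtain a b where "z = diag (\<phi> (a + b) - \<phi> a - \<phi> b) (\<psi> (a + b) - \<psi> a - \<psi> b) \<or>
      z = diag (\<phi> (a * b) - \<phi> a * \<phi> b) (\<psi> (a * b) - \<psi> a * \<psi> b)"
    by (auto simp: defects_def diag_simps)
  then show ?thesis by (blast intro: defects_addI defects_multI)
qed

lemma pair_sum_cycle:
  assumes "kk_cycle k \<Phi>" "kk_cycle k \<Psi>" shows "kk_cycle k (pair_sum \<Phi> \<Psi>)"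
proof -
  have cyc: "asymptotic_cycle \<Phi>" "asymptotic_cycle \<Psi>" using assms by (auto simp: kk_cycle_def)
  note V = cyc(1)[unfolded asymptotic_cycle_iff] and W = cyc(2)[unfolded asymptotic_cycle_iff]
  have diff: "kk_diff (pair_sum \<Phi> \<Psi>) c = diag (kk_diff \<Phi> c) (kk_diff \<Psi> c)" for c
    by (simp add: pair_sum_def diag_simps)
  have main: "continuous_on UNIV (\<lambda>a. diag (\<phi> a) (\<psi> a)) \<and>
        (\<forall>c a. diag (\<phi> (c *\<^sub>C a)) (\<psi> (c *\<^sub>C a)) = c *\<^sub>C diag (\<phi> a) (\<psi> a)) \<and>
        (\<forall>a. diag (\<phi> (star a)) (\<psi> (star a)) \<simeq> star (diag (\<phi> a) (\<psi> a))) \<and>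
        (\<forall>z\<in>defects (\<lambda>a. diag (\<phi> a) (\<psi> a)). \<forall>w\<in>words (pair_sum \<Phi> \<Psi>). \<forall>c. z * w * kk_diff (pair_sum \<Phi> \<Psi>) c \<in> C0)"
    if \<phi>: "\<phi> \<in> {fst \<Phi>, snd \<Phi>}" and \<psi>: "\<psi> \<in> {fst \<Psi>, snd \<Psi>}" for \<phi> \<psi>
  proof (intro conjI allI ballI)
    note V' = V[THEN conjunct1, rule_format, OF \<phi>] and W' = W[THEN conjunct1, rule_format, OF \<psi>]
    show "continuous_on UNIV (\<lambda>a. diag (\<phi> a) (\<psi> a))"
      unfolding diag_def using V' W' by (intro continuous_intros) auto
    show "diag (\<phi> (c *\<^sub>C a)) (\<psi> (c *\<^sub>C a)) = c *\<^sub>C diag (\<phi> a) (\<psi> a)" for c a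
      using V' W' by (simp add: diag_simps)
    show "diag (\<phi> (star a)) (\<psi> (star a)) \<simeq> star (diag (\<phi> a) (\<psi> a))" for a
      unfolding diag_simps using V' W' by (intro diag_asymp_eq) auto
    fix z w c assume z: "z \<in> defects (\<lambda>a. diag (\<phi> a) (\<psi> a))" and w: "w \<in> words (pair_sum \<Phi> \<Psi>)"
    obtain x y where xy: "x \<in> defects \<phi>" "y \<in> defects \<psi>" "z = diag x y" using diag_defects[OF z] by blast
    obtain u v where uv: "u \<in> words \<Phi>" "v \<in> words \<Psi>" "w = diag u v" using pair_sum_words[OF w] by blast
    have "x * u * kk_diff \<Phi> c \<in> C0" "y * v * kk_diff \<Psi> c \<in> C0" using V' W' xy uv by blast+
    then show "z * w * kk_diff (pair_sum \<Phi> \<Psi>) c \<in> C0"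
      unfolding diff xy(3) uv(3) diag_simps by (rule diag_C0)
  qed
  have "kk_diff (pair_sum \<Phi> \<Psi>) c \<in> Cb" for c
    unfolding diff using V W by (intro diag_Cb) auto
  then have "asymptotic_cycle (pair_sum \<Phi> \<Psi>)"
    unfolding asymptotic_cycle_iff using main[of "fst \<Phi>" "fst \<Psi>"] main[of "snd \<Phi>" "snd \<Psi>"]
    by (simp add: pair_sum_def)
  then show ?thesis using assms by (auto simp: kk_cycle_def pair_sum_def intro!: diag_Cb)
qed

lemma pair_sum_asym_unit:
  assumes "asym_unit \<Phi> M" "asym_unit \<Psi> N" shows "asym_unit (pair_sum \<Phi> \<Psi>) (diag M N)"
  using assms unfolding asym_unit_def by (auto simp: pair_sum_def diag_simps intro: diag_asymp_eq)

lemma pair_sum_cut: "kk_cut (diag M N) (pair_sum \<Phi> \<Psi>) = pair_sum (kk_cut M \<Phi>) (kk_cut N \<Psi>)"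
  by (simp add: kk_cut_def pair_sum_def diag_simps)

end

lemma (in cycle_hom) isometry_pair_map: "isometry_pair S1 S2 \<Longrightarrow> isometry_pair (T S1) (T S2)"
  by (simp add: isometry_pair_def star[symmetric] mult[symmetric] add[symmetric] one)

lemma (in cycle_hom) pair_sum_map:
  assumes "isometry_pair S1 S2"
  shows "kk_map T (isometry_pair.pair_sum S1 S2 \<Phi> \<Psi>) = isometry_pair.pair_sum (T S1) (T S2) (kk_map T \<Phi>) (kk_map T \<Psi>)"
  using assms isometry_pair_map[OF assms]
  by (simp add: isometry_pair.pair_sum_def isometry_pair.diag_def kk_map_def add mult star)

text \<open>The homotopies are added with the constant paths of the isometries, and evaluation
  returns the original isometries at both ends.\<close>

lemma (in isometry_pair) pair_sum_homotopic:
  assumes "(\<Phi>, \<Phi>') \<in> kk_homotopic k" "(\<Psi>, \<Psi>') \<in> kk_homotopic k"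
  shows "(pair_sum \<Phi> \<Psi>, pair_sum \<Phi>' \<Psi>') \<in> kk_homotopic k"
proof -
  obtain H K :: "('a, 'b path_algebra) kk_pair" where H: "kk_cycle k H" "ev_pair 0 H = \<Phi>" "ev_pair 1 H = \<Phi>'"
    and K: "kk_cycle k K" "ev_pair 0 K = \<Psi>" "ev_pair 1 K = \<Psi>'"
    using assms by (auto simp: kk_homotopic_def)
  interpret P: isometry_pair "const_path S1" "const_path S2"
    by (rule const_path.isometry_pair_map) unfold_locales
  have "ev_pair s (P.pair_sum H K) = pair_sum (ev_pair s H) (ev_pair s K)" for s
    unfolding ev_pair_eq ev.pair_sum_map[OF P.isometry_pair_axioms] by simp
  then show ?thesis using kk_homotopicI[OF P.pair_sum_cycle[OF H(1) K(1)]] H K by simp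
qed

lemma const_scont_isometry_pair:
  assumes "cuntz_pair s1 s2" shows "isometry_pair (const_scont s1) (const_scont s2)"
  using assms by unfold_locales (rule scont_eqI, simp add: scont_ap cuntz_pair_def)+

lemma kk_sum_eq:
  assumes "cuntz_pair s1 s2"
  shows "kk_sum s1 s2 \<Phi> \<Psi> = isometry_pair.pair_sum (const_scont s1) (const_scont s2) \<Phi> \<Psi>"
proof -
  have "const_scont (star s) = star (const_scont s)" for s :: "'a multiplier"
    by (rule scont_eqI) (simp add: scont_ap)
  then show ?thesis
    by (simp add: kk_sum_def map_sum_def[abs_def] isometry_pair.pair_sum_def[OF const_scont_isometry_pair[OF assms]]
        isometry_pair.diag_def[OF const_scont_isometry_pair[OF assms]])
qed

section \<open>The map \<open>p\<close>\<close>

lemma kk_homotopic_refl: "kk_cycle k \<Phi> \<Longrightarrow> (\<Phi>, \<Phi>) \<in> kk_homotopic k"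
  by (rule refl_onD[of "{\<Phi>. kk_cycle k \<Phi>}"], rule equivE[OF equiv_kk_homotopic]) simp_all

lemma kk_homotopic_trans:
  "(\<Phi>, \<Psi>) \<in> kk_homotopic k \<Longrightarrow> (\<Psi>, \<Theta>) \<in> kk_homotopic k \<Longrightarrow> (\<Phi>, \<Theta>) \<in> kk_homotopic k"
  by (rule transD[of "kk_homotopic k"], rule equivE[OF equiv_kk_homotopic])

lemma kk_homotopic_class_eq:
  "(\<Phi>, \<Psi>) \<in> kk_homotopic k \<Longrightarrow> kk_homotopic k `` {\<Phi>} = kk_homotopic k `` {\<Psi>}"
  by (rule equiv_class_eq[OF equiv_kk_homotopic])

lemma asym_unit_ev:
  assumes "asym_unit H M" shows "asym_unit (ev_pair s H) (ev_scont (unit_of_real s) M)"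
  unfolding ev_pair_eq by (rule ev.asym_unit_map[OF assms])

lemma Cb_cut_homotopic:
  assumes "asymptotic_cycle \<Phi>" "asym_unit \<Phi> v" "v \<in> Cb" "asym_unit \<Phi> w" "w \<in> Cb"
  shows "(kk_cut v \<Phi>, kk_cut w \<Phi>) \<in> kk_homotopic True"
  using assms by (intro kk_cut_homotopic) (auto intro: Cb_mult)

text \<open>A cutoff of a homotopy from \<open>\<Phi>\<close> to \<open>\<Psi>\<close> links cutoffs of \<open>\<Phi>\<close> and \<open>\<Psi>\<close>.\<close>

lemma cut_homotopic:
  fixes \<Phi> \<Psi> :: "('a::cstar_algebra, 'b::cstar_algebra) kk_pair"
  assumes sep: "separable_space (euclidean :: 'a topology)" and h: "(\<Phi>, \<Psi>) \<in> kk_homotopic False"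
    and v: "asym_unit \<Phi> v" "v \<in> Cb" and w: "asym_unit \<Psi> w" "w \<in> Cb"
  shows "(kk_cut v \<Phi>, kk_cut w \<Psi>) \<in> kk_homotopic True"
proof -
  obtain H :: "('a, 'b path_algebra) kk_pair" where H: "asymptotic_cycle H" "ev_pair 0 H = \<Phi>" "ev_pair 1 H = \<Psi>"
    and cyc: "asymptotic_cycle \<Phi>" "asymptotic_cycle \<Psi>"
    using h by (auto simp: kk_homotopic_def kk_cycle_def)
  \<comment> \<open>Passing to IB changes only the target of the pair; its source is still the
    separable algebra A.\<close>
  obtain V where "cutoff H V" using cutoff_exists[OF sep H(1)] by blast
  note V = cutoff_asym_unit[OF H(1) this]
  let ?V = "\<lambda>s. ev_scont (unit_of_real s) V"
  have V0: "asym_unit \<Phi> (?V 0)" "?V 0 \<in> Cb" and V1: "asym_unit \<Psi> (?V 1)" "?V 1 \<in> Cb"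
    using asym_unit_ev[OF V(1), of 0] asym_unit_ev[OF V(1), of 1] ev.Cb[OF V(2)] H by auto

  have "(kk_cut v \<Phi>, kk_cut (?V 0) \<Phi>) \<in> kk_homotopic True"
    by (rule Cb_cut_homotopic[OF cyc(1) v V0])
  moreover have "(kk_cut (?V 0) \<Phi>, kk_cut (?V 1) \<Psi>) \<in> kk_homotopic True"
  proof -
    have "kk_cycle True (kk_cut V H)" by (rule kk_cycle_cut[OF H(1) V(1)]) (simp add: V(2))
    from kk_homotopicI[OF this] show ?thesis
      using H by (simp add: ev_pair_eq ev.kk_cut_map)
  qed
  moreover have "(kk_cut (?V 1) \<Psi>, kk_cut w \<Psi>) \<in> kk_homotopic True"
    by (rule Cb_cut_homotopic[OF cyc(2) V1 w])
  ultimately show ?thesis using kk_homotopic_trans by blast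
qed

text \<open>The union defining \<open>p_map\<close> is nonempty because cutoffs exist, and all its
  members agree by \<open>cut_homotopic\<close>. The element \<open>v\<close> may be any asymptotic
  unit in \<open>Cb\<close>, so that \<open>p\<close> of a sum can be computed with a diagonal of
  two units.\<close>

lemma p_map_class:
  fixes \<Phi> :: "('a::cstar_algebra, 'b::cstar_algebra) kk_pair"
  assumes sep: "separable_space (euclidean :: 'a topology)" and \<Phi>: "asymptotic_cycle \<Phi>"
    and v: "asym_unit \<Phi> v" "v \<in> Cb"
  shows "p_map (kk_homotopic False `` {\<Phi>}) = kk_homotopic True `` {kk_cut v \<Phi>}"
proof -
  have cl: "kk_homotopic True `` {kk_cut w \<Psi>} = kk_homotopic True `` {kk_cut v \<Phi>}"
    if \<Psi>: "(\<Phi>, \<Psi>) \<in> kk_homotopic False" and w: "cutoff \<Psi> w" for \<Psi> w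
  proof -
    have "asymptotic_cycle \<Psi>" using \<Psi> by (simp add: kk_homotopic_def kk_cycle_def)
    from cut_homotopic[OF sep \<Psi> v cutoff_asym_unit[OF this w]]
    show ?thesis using kk_homotopic_class_eq by metis
  qed
  have refl: "(\<Phi>, \<Phi>) \<in> kk_homotopic False"
    using \<Phi> by (intro kk_homotopic_refl) (simp add: kk_cycle_def)
  obtain w where w: "cutoff \<Phi> w" using cutoff_exists[OF sep \<Phi>] by blast
  show ?thesis
    unfolding p_map_def EM_homotopic_eq
  proof (intro equalityI UN_least)
    fix \<Psi> u assume "\<Psi> \<in> kk_homotopic False `` {\<Phi>}" "u \<in> {u. cutoff \<Psi> u}"
    then show "kk_homotopic True `` {kk_cut u \<Psi>} \<subseteq> kk_homotopic True `` {kk_cut v \<Phi>}"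
      using cl[of \<Psi> u] by simp
  next
    have "kk_homotopic True `` {kk_cut w \<Phi>} \<subseteq> (\<Union>u\<in>{u. cutoff \<Phi> u}. kk_homotopic True `` {kk_cut u \<Phi>})"
      using w by (intro UN_upper[where B = "\<lambda>u. kk_homotopic True `` {kk_cut u \<Phi>}"]) simp
    also have "\<dots> \<subseteq> (\<Union>\<Psi>\<in>kk_homotopic False `` {\<Phi>}. \<Union>u\<in>{u. cutoff \<Psi> u}. kk_homotopic True `` {kk_cut u \<Psi>})"
      using refl by (intro UN_upper[where B = "\<lambda>\<Psi>. \<Union>u\<in>{u. cutoff \<Psi> u}. kk_homotopic True `` {kk_cut u \<Psi>}"]) simp
    finally show "kk_homotopic True `` {kk_cut v \<Phi>} \<subseteq>
        (\<Union>\<Psi>\<in>kk_homotopic False `` {\<Phi>}. \<Union>u\<in>{u. cutoff \<Psi> u}. kk_homotopic True `` {kk_cut u \<Psi>})"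
      unfolding cl[OF refl w] .
  qed
qed

lemma union_classes_sum:
  assumes S: "isometry_pair S1 S2" and "kk_cycle k \<Phi>" "kk_cycle k \<Psi>"
  shows "(\<Union>\<Phi>'\<in>kk_homotopic k `` {\<Phi>}. \<Union>\<Psi>'\<in>kk_homotopic k `` {\<Psi>}.
      kk_homotopic k `` {isometry_pair.pair_sum S1 S2 \<Phi>' \<Psi>'}) = kk_homotopic k `` {isometry_pair.pair_sum S1 S2 \<Phi> \<Psi>}"
proof (rule UN_equiv_class2[OF equiv_kk_homotopic equiv_kk_homotopic])
  show "congruent2 (kk_homotopic k) (kk_homotopic k)
      (\<lambda>\<Phi> \<Psi>. kk_homotopic k `` {isometry_pair.pair_sum S1 S2 \<Phi> \<Psi>})"
    by (rule congruent2I', rule kk_homotopic_class_eq, rule isometry_pair.pair_sum_homotopic[OF S])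
qed (use assms in auto)

theorem theorem2p2:
  fixes s1 s2 :: "'b::cstar_algebra multiplier"
  assumes "separable_space (euclidean :: 'a::cstar_algebra topology)"
    and "stable_algebra TYPE('b)" and "sigma_unital TYPE('b)"
    and "cuntz_pair s1 s2"
  shows "p_map \<in> iso (EL s1 s2 :: ('a, 'b) kk_pair set monoid) (EM s1 s2)"
proof -
  note sep = assms(1)
  interpret S: isometry_pair "const_scont s1" "const_scont s2"
    by (rule const_scont_isometry_pair[OF assms(4)])
  let ?EL = "EL s1 s2 :: ('a, 'b) kk_pair set monoid" and ?EM = "EM s1 s2 :: ('a, 'b) kk_pair set monoid"
  define cl where "cl k \<Phi> = kk_homotopic k `` {\<Phi>}" for k and \<Phi> :: "('a, 'b) kk_pair"
  have carrier: "carrier ?EL = cl False ` {\<Phi>. kk_cycle False \<Phi>}" "carrier ?EM = cl True ` {\<Phi>. kk_cycle True \<Phi>}"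
    by (auto simp: EL_def EM_def asymptotic_cycle_eq compact_cycle_eq EL_homotopic_eq EM_homotopic_eq quotient_def cl_def)
  have mult: "cl False \<Phi> \<otimes>\<^bsub>?EL\<^esub> cl False \<Psi> = cl False (S.pair_sum \<Phi> \<Psi>)"
    if "kk_cycle False \<Phi>" "kk_cycle False \<Psi>" for \<Phi> \<Psi>
    using union_classes_sum[OF S.isometry_pair_axioms that]
    by (simp add: EL_def kk_sum_eq[OF assms(4)] EL_homotopic_eq cl_def)
  have mult': "cl True \<Phi> \<otimes>\<^bsub>?EM\<^esub> cl True \<Psi> = cl True (S.pair_sum \<Phi> \<Psi>)"
    if "kk_cycle True \<Phi>" "kk_cycle True \<Psi>" for \<Phi> \<Psi>
    using union_classes_sum[OF S.isometry_pair_axioms that]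
    by (simp add: EM_def kk_sum_eq[OF assms(4)] EM_homotopic_eq cl_def)
  have unit: "\<exists>v. asym_unit \<Phi> v \<and> v \<in> Cb" if "kk_cycle False \<Phi>" for \<Phi> :: "('a, 'b) kk_pair"
  proof -
    have \<Phi>: "asymptotic_cycle \<Phi>" using that by (simp add: kk_cycle_def)
    then show ?thesis using cutoff_exists[OF sep \<Phi>] cutoff_asym_unit[OF \<Phi>] by metis
  qed
  \<comment> \<open>The last fact says that \<open>p\<close> followed by the inclusion of compact
    cycles is the identity on classes.\<close>
  have p: "p_map (cl False \<Phi>) = cl True (kk_cut v \<Phi>)" "kk_cycle True (kk_cut v \<Phi>)"
    "cl False (kk_cut v \<Phi>) = cl False \<Phi>"
    if "kk_cycle False \<Phi>" "asym_unit \<Phi> v" "v \<in> Cb" for \<Phi> :: "('a, 'b) kk_pair" and v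
  proof -
    have \<Phi>: "asymptotic_cycle \<Phi>" using that(1) by (simp add: kk_cycle_def)
    show "p_map (cl False \<Phi>) = cl True (kk_cut v \<Phi>)"
      unfolding cl_def by (rule p_map_class[OF sep \<Phi> that(2,3)])
    show "kk_cycle True (kk_cut v \<Phi>)" by (rule kk_cycle_cut[OF \<Phi> that(2)]) (simp add: that(3))
    show "cl False (kk_cut v \<Phi>) = cl False \<Phi>"
      using kk_cut_homotopic[OF \<Phi> that(2) asym_unit_one, of False] kk_homotopic_class_eq
      unfolding cl_def by fastforce
  qed
  \<comment> \<open>A compact homotopy is in particular a homotopy, so the inclusion of compact
    cycles is well defined on classes.\<close>
  have weaken: "cl False \<Phi> = cl False \<Psi>" if "cl True \<Phi> = cl True \<Psi>" "kk_cycle True \<Psi>" for \<Phi> \<Psi> :: "('a, 'b) kk_pair"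
  proof -
    have "(\<Phi>, \<Psi>) \<in> kk_homotopic True"
      using eq_equiv_class[OF _ equiv_kk_homotopic, of True \<Phi> \<Psi>] that by (simp add: cl_def)
    then have "(\<Phi>, \<Psi>) \<in> kk_homotopic False"
      by (auto simp: kk_homotopic_def kk_cycle_def)
    then show ?thesis using kk_homotopic_class_eq unfolding cl_def by metis
  qed
  have "p_map \<in> hom ?EL ?EM"
  proof (rule homI)
    show "p_map X \<in> carrier ?EM" if "X \<in> carrier ?EL" for X
      using that unit p(1,2) unfolding carrier by blast
    show "p_map (X \<otimes>\<^bsub>?EL\<^esub> Y) = p_map X \<otimes>\<^bsub>?EM\<^esub> p_map Y" if XY: "X \<in> carrier ?EL" "Y \<in> carrier ?EL" for X Y
    proof -
      obtain \<Phi> \<Psi> where \<Phi>: "X = cl False \<Phi>" "kk_cycle False \<Phi>" and \<Psi>: "Y = cl False \<Psi>" "kk_cycle False \<Psi>"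
        using XY unfolding carrier by blast
      obtain v where v: "asym_unit \<Phi> v" "v \<in> Cb" using unit[OF \<Phi>(2)] by blast
      obtain w where w: "asym_unit \<Psi> w" "w \<in> Cb" using unit[OF \<Psi>(2)] by blast
      \<comment> \<open>The diagonal of the two units is an asymptotic unit of the sum, and cutting
        the sum by it gives the sum of the two cuts.\<close>
      have "p_map (X \<otimes>\<^bsub>?EL\<^esub> Y) = cl True (kk_cut (S.diag v w) (S.pair_sum \<Phi> \<Psi>))"
        unfolding \<Phi>(1) \<Psi>(1) mult[OF \<Phi>(2) \<Psi>(2)]
        by (intro p(1) S.pair_sum_cycle S.pair_sum_asym_unit S.diag_Cb \<Phi> \<Psi> v w)
      also have "\<dots> = p_map X \<otimes>\<^bsub>?EM\<^esub> p_map Y"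
        using mult'[OF p(2)[OF \<Phi>(2) v] p(2)[OF \<Psi>(2) w]] p(1)[OF \<Phi>(2) v] p(1)[OF \<Psi>(2) w]
        by (simp add: \<Phi>(1) \<Psi>(1) S.pair_sum_cut)
      finally show ?thesis .
    qed
  qed
  moreover have "bij_betw p_map (carrier ?EL) (carrier ?EM)"
    unfolding bij_betw_def
  proof
    show "inj_on p_map (carrier ?EL)"
    proof (rule inj_onI)
      fix X Y assume "X \<in> carrier ?EL" "Y \<in> carrier ?EL" and eq: "p_map X = p_map Y"
      then obtain \<Phi> \<Psi> where \<Phi>: "X = cl False \<Phi>" "kk_cycle False \<Phi>" and \<Psi>: "Y = cl False \<Psi>" "kk_cycle False \<Psi>"
        unfolding carrier by blast
      obtain v where v: "asym_unit \<Phi> v" "v \<in> Cb" using unit[OF \<Phi>(2)] by blast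
      obtain w where w: "asym_unit \<Psi> w" "w \<in> Cb" using unit[OF \<Psi>(2)] by blast
      have "cl False (kk_cut v \<Phi>) = cl False (kk_cut w \<Psi>)"
        using eq p(1)[OF \<Phi>(2) v] p(1)[OF \<Psi>(2) w] p(2)[OF \<Psi>(2) w] by (intro weaken) (simp_all add: \<Phi>(1) \<Psi>(1))
      then show "X = Y" using p(3)[OF \<Phi>(2) v] p(3)[OF \<Psi>(2) w] by (simp add: \<Phi>(1) \<Psi>(1))
    qed
    have "cl True \<Phi> \<in> p_map ` carrier ?EL" if \<Phi>: "kk_cycle True \<Phi>" for \<Phi>
    proof -
      have F: "kk_cycle False \<Phi>" "asymptotic_cycle \<Phi>" using \<Phi> by (simp_all add: kk_cycle_def)
      obtain v where v: "asym_unit \<Phi> v" "v \<in> Cb" using unit[OF F(1)] by blast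
      \<comment> \<open>A compact cycle represents its own preimage: \<open>v\<close> and 1 are both
        asymptotic units, and the linear path between them stays within compact cycles.\<close>
      have "(kk_cut v \<Phi>, kk_cut 1 \<Phi>) \<in> kk_homotopic True"
        using \<Phi> by (intro kk_cut_homotopic F v asym_unit_one) (auto simp: kk_cycle_def intro: Cb_mult)
      then have "cl True (kk_cut v \<Phi>) = cl True \<Phi>"
        using kk_homotopic_class_eq unfolding cl_def by fastforce
      then show ?thesis using p(1)[OF F(1) v] F(1) unfolding carrier by blast
    qed
    then show "p_map ` carrier ?EL = carrier ?EM"
      using hom_carrier[OF \<open>p_map \<in> hom ?EL ?EM\<close>] unfolding carrier(2) by blast
  qed
  ultimately show ?thesis by (simp add: iso_def)
qed

end
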